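(* (1) Let $a,b\ge 0$ be integers. Then for every partition $\nu$, $$\bar{g}_{(1^{p})\,(1^{q})}^{\nu} \geq \bar{g}_{(1^a)\,(1^b)}^{\nu},\qquad\text{where } p=\left\lceil \tfrac{a+b}{2}\right\rceil,\ q=\left\lfloor \tfrac{a+b}{2}\right\rfloor .$$ (2) More strongly, let $i,j,k,l$ be nonnegative integers with $i<j\le k<l$ and $j+k=i+l$. Then for every partition $\nu$, $$\bar{g}_{(1^j)\,(1^k)}^{\nu} \geq \bar{g}_{(1^i)\,(1^l)}^{\nu}.$$
   Context: For a partition $\alpha$ of $d$, let $V_\alpha$ be the irreducible complex representation of the symmetric group $S_d$ indexed by $\alpha$. For partitions $\alpha,\beta,\gamma$ of $d$, the Kronecker coefficient $g_{\alpha\beta}^{\gamma}$ is the multiplicity of $V_\gamma$ in $V_\alpha\otimes V_\beta$ (with diagonal $S_d$-action). For a partition $\lambda=(\lambda_1\ge\lambda_2\ge\cdots)$ of any size and an integer $d\ge|\lambda|+\lambda_1$, the padded partition is $\lambda[d]=(d-|\lambda|,\lambda_1,\lambda_2,\dots)$, a partition of $d$. For arbitrary partitions $\lambda,\mu,\nu$ (not necessarily of the same size), the sequence $g_{\lambda[d]\,\mu[d]}^{\nu[d]}$ is constant for all sufficiently large $d$ (Murnaghan); its stable value is the reduced Kronecker coefficient $\bar g_{\lambda\mu}^{\nu}$. Here $(1^m)$ denotes the partition with $m$ parts all equal to $1$ (a single column), and $(1^0)$ is the empty partition. *)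

theory Defs
  imports Complex_Main "HOL-Library.FuncSet" "HOL-Library.Function_Algebras" "HOL-Combinatorics.Permutations"
begin

definition cscale :: "complex \<Rightarrow> ('x \<Rightarrow> complex) \<Rightarrow> 'x \<Rightarrow> complex" where
  "cscale c f = (\<lambda>x. c * f x)"

interpretation cfun: vector_space "cscale :: complex \<Rightarrow> ('x \<Rightarrow> complex) \<Rightarrow> 'x \<Rightarrow> complex"
  by unfold_locales (auto simp: cscale_def fun_eq_iff algebra_simps)


section \<open>Complex representations of symmetric groups\<close>

text \<open>
  The group \<open>S\<^sub>d\<close> consists of the \<open>\<sigma>\<close> with \<open>\<sigma> permutes {1..d}\<close>. All representations considered here
  are subspaces of a space of functions on a type \<open>'x\<close> of points, on which \<open>S\<^sub>d\<close> acts from the right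
  by \<open>rep_move\<close>; the resulting left action on functions is precomposition.
\<close>

record 'x rep =
  rep_space :: "('x \<Rightarrow> complex) set"
  rep_move :: "(nat \<Rightarrow> nat) \<Rightarrow> 'x \<Rightarrow> 'x"

definition act :: "'x rep \<Rightarrow> (nat \<Rightarrow> nat) \<Rightarrow> ('x \<Rightarrow> complex) \<Rightarrow> 'x \<Rightarrow> complex" where
  "act R \<sigma> f = (\<lambda>x. f (rep_move R \<sigma> x))"

definition subrep :: "nat \<Rightarrow> 'x rep \<Rightarrow> ('x \<Rightarrow> complex) set \<Rightarrow> bool" where
  "subrep d R U \<longleftrightarrow> cfun.subspace U \<and> U \<subseteq> rep_space R \<and>
     (\<forall>\<sigma>. \<sigma> permutes {1..d} \<longrightarrow> (\<forall>u\<in>U. act R \<sigma> u \<in> U))"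

definition irreducible_subrep :: "nat \<Rightarrow> 'x rep \<Rightarrow> ('x \<Rightarrow> complex) set \<Rightarrow> bool" where
  "irreducible_subrep d R U \<longleftrightarrow> subrep d R U \<and> U \<noteq> {0} \<and>
     (\<forall>W. subrep d R W \<and> W \<subseteq> U \<longrightarrow> W = {0} \<or> W = U)"

definition rep_iso :: "nat \<Rightarrow> 'x rep \<Rightarrow> 'y rep \<Rightarrow> bool" where
  "rep_iso d R S \<longleftrightarrow> (\<exists>\<phi>. bij_betw \<phi> (rep_space R) (rep_space S) \<and>
     (\<forall>u\<in>rep_space R. \<forall>v\<in>rep_space R. \<phi> (u + v) = \<phi> u + \<phi> v) \<and>
     (\<forall>c. \<forall>u\<in>rep_space R. \<phi> (cscale c u) = cscale c (\<phi> u)) \<and>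
     (\<forall>\<sigma>. \<sigma> permutes {1..d} \<longrightarrow> (\<forall>u\<in>rep_space R. \<phi> (act R \<sigma> u) = act S \<sigma> (\<phi> u))))"

text \<open>
  A decomposition of a representation as an internal direct sum of irreducible subrepresentations.
  The summands are non-zero and independent, hence pairwise distinct as subspaces, so a set of
  subspaces records isomorphic summands separately.
\<close>

definition irreducible_decomposition ::
    "nat \<Rightarrow> 'x rep \<Rightarrow> ('x \<Rightarrow> complex) set set \<Rightarrow> bool" where
  "irreducible_decomposition d R \<U> \<longleftrightarrow> finite \<U> \<and> (\<forall>U\<in>\<U>. irreducible_subrep d R U) \<and>
     (\<forall>v\<in>rep_space R. \<exists>!f. f \<in> (\<Pi>\<^sub>E U\<in>\<U>. U) \<and> v = (\<Sum>U\<in>\<U>. f U))"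

text \<open>The multiplicity of the irreducible representation \<open>S\<close> in \<open>R\<close>; by complete reducibility and
  the Krull--Schmidt theorem the number does not depend on the decomposition.\<close>

definition multiplicity_in :: "nat \<Rightarrow> 'y rep \<Rightarrow> 'x rep \<Rightarrow> nat" where
  "multiplicity_in d S R = (THE m. \<exists>\<U>. irreducible_decomposition d R \<U> \<and>
     m = card {U \<in> \<U>. rep_iso d S (R\<lparr>rep_space := U\<rparr>)})"

text \<open>
  The tensor product of two function spaces, where \<open>f \<otimes> g\<close> is the function \<open>(x, y) \<mapsto> f x * g y\<close>.
  The diagonal action on points sends \<open>f \<otimes> g\<close> to \<open>\<sigma> f \<otimes> \<sigma> g\<close>.
\<close>

definition tensor_rep :: "'x rep \<Rightarrow> 'y rep \<Rightarrow> ('x \<times> 'y) rep" where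
  "tensor_rep R S =
     \<lparr>rep_space = cfun.span {\<lambda>(x, y). f x * g y | f g. f \<in> rep_space R \<and> g \<in> rep_space S},
      rep_move = (\<lambda>\<sigma> (x, y). (rep_move R \<sigma> x, rep_move S \<sigma> y))\<rparr>"


section \<open>Partitions and Specht modules\<close>

definition is_partition :: "nat list \<Rightarrow> bool" where
  "is_partition \<alpha> \<longleftrightarrow> sorted_wrt (\<ge>) \<alpha> \<and> 0 \<notin> set \<alpha>"

definition young_diagram :: "nat list \<Rightarrow> (nat \<times> nat) set" where
  "young_diagram \<alpha> = {(r, c). r < length \<alpha> \<and> c < \<alpha> ! r}"

definition tableaux :: "nat list \<Rightarrow> (nat \<times> nat \<Rightarrow> nat) set" where
  "tableaux \<alpha> = {T. bij_betw T (young_diagram \<alpha>) {1..sum_list \<alpha>}}"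

text \<open>
  The tabloid of a tableau (its class modulo permutations within rows) is encoded by the function
  sending each entry to the row containing it.
\<close>

definition tabloid :: "nat list \<Rightarrow> (nat \<times> nat \<Rightarrow> nat) \<Rightarrow> nat \<Rightarrow> nat" where
  "tabloid \<alpha> T = (\<lambda>i. if i \<in> {1..sum_list \<alpha>}
     then fst (the_inv_into (young_diagram \<alpha>) T i) else 0)"

definition column_stabilizer :: "nat list \<Rightarrow> (nat \<times> nat \<Rightarrow> nat) \<Rightarrow> (nat \<Rightarrow> nat) set" where
  "column_stabilizer \<alpha> T = {\<sigma>. \<sigma> permutes {1..sum_list \<alpha>} \<and>
     (\<forall>(r, c) \<in> young_diagram \<alpha>. \<exists>r'. (r', c) \<in> young_diagram \<alpha> \<and> \<sigma> (T (r, c)) = T (r', c))}"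

definition polytabloid :: "nat list \<Rightarrow> (nat \<times> nat \<Rightarrow> nat) \<Rightarrow> (nat \<Rightarrow> nat) \<Rightarrow> complex" where
  "polytabloid \<alpha> T = (\<lambda>w. \<Sum>\<sigma>\<in>column_stabilizer \<alpha> T.
     of_int (sign \<sigma>) * (if w = tabloid \<alpha> (\<sigma> \<circ> T) then 1 else 0))"

text \<open>
  The irreducible representation \<open>V\<^sub>\<alpha>\<close> of the symmetric group, realised as the Specht module: the span
  of the polytabloids. The tabloid of \<open>\<sigma> \<circ> T\<close> is that of \<open>T\<close> precomposed with \<open>\<sigma>\<^sup>-\<^sup>1\<close>, so the
  action below satisfies \<open>\<sigma> e\<^sub>T = e\<^bsub>\<sigma> \<circ> T\<^esub>\<close>. With this convention \<open>(d)\<close> gives the trivial and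
  \<open>(1\<^sup>d)\<close> the sign representation.
\<close>

definition specht :: "nat list \<Rightarrow> (nat \<Rightarrow> nat) rep" where
  "specht \<alpha> = \<lparr>rep_space = cfun.span (polytabloid \<alpha> ` tableaux \<alpha>), rep_move = (\<lambda>\<sigma> w. w \<circ> \<sigma>)\<rparr>"


section \<open>Kronecker coefficients\<close>

text \<open>The coefficient \<open>g\<^sub>\<alpha>\<^sub>\<beta>\<^sup>\<gamma>\<close>; meaningful when the three partitions have the same size.\<close>

definition kronecker :: "nat list \<Rightarrow> nat list \<Rightarrow> nat list \<Rightarrow> nat" where
  "kronecker \<alpha> \<beta> \<gamma> =
     multiplicity_in (sum_list \<gamma>) (specht \<gamma>) (tensor_rep (specht \<alpha>) (specht \<beta>))"

text \<open>The padded partition \<open>\<mu>[d]\<close>; meaningful when \<open>d\<close> is at least \<open>\<bar>\<mu>\<bar> + \<mu>\<^sub>1\<close>.\<close>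

definition padded :: "nat list \<Rightarrow> nat \<Rightarrow> nat list" where
  "padded \<mu> d = (d - sum_list \<mu>) # \<mu>"

definition reduced_kronecker :: "nat list \<Rightarrow> nat list \<Rightarrow> nat list \<Rightarrow> nat" where
  "reduced_kronecker \<kappa> \<mu> \<nu> =
     (THE m. \<forall>\<^sub>F d in sequentially. kronecker (padded \<kappa> d) (padded \<mu> d) (padded \<nu> d) = m)"

definition column :: "nat \<Rightarrow> nat list" where
  "column m = replicate m 1"

end

theory Submission
  imports Defs
begin

text \<open>
  \<open>V\<^bsub>(d-a,1^a)\<^esub>\<close> is \<open>\<Lambda>\<^sup>a W\<close> for the standard representation \<open>W\<close> of dimension \<open>d - 1\<close>, and
  \<open>\<Lambda>\<^sup>i W \<otimes> \<Lambda>\<^sup>l W\<close> embeds equivariantly into \<open>\<Lambda>\<^sup>i\<^sup>+\<^sup>1 W \<otimes> \<Lambda>\<^sup>l\<^sup>-\<^sup>1 W\<close> for \<open>i < l\<close>.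
  The embedding moves one tensor factor from the right to the left, the raising operator of
  the \<open>sl\<^sub>2\<close> commuting with \<open>GL(W)\<close>; it is injective because it goes towards the zero weight space.
  Working with alternating simplicial cocycles instead of exterior powers makes all formulas
  independent of \<open>d\<close>.

  The multiplicity of a Specht module in \<open>R\<close> is the dimension of the image of its Young symmetrizer
  on \<open>R\<close>. For the padded shape \<open>\<nu>[d]\<close> the column part of the symmetrizer can be chosen independently of
  \<open>d\<close>, and restricting cocycles from \<open>{1..d+1}\<close> to \<open>{1..d}\<close> is injective on these images for large
  \<open>d\<close>. So the Kronecker coefficients in question eventually decrease in \<open>d\<close>, hence stabilize.
\<close>

text \<open>Both \<open>multiplicity_in\<close> and \<open>reduced_kronecker\<close> are
  \<open>THE\<close> terms, meaningful only after uniqueness and existence are proved; turning them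
  into dimensions of symmetrizer images settles this. The inequality then holds in each single
  degree, as an injective equivariant map carries one such image into another, and stability serves
  to read it off at a common large degree. The cocycles come from polytabloids. A polytabloid of
  shape (d-a,1^a) is given by the a+1 entries of its first column, is alternating in them, and the
  alternating sum over the faces of a+2 entries vanishes. Pairing a function with all polytabloids
  thus yields an alternating cocycle in a+1 positions, and every cocycle arises so because the full
  simplex on {1..d} is acyclic: filling a position with the point 1 is the contracting homotopy. Two
  hooks give functions of a+b+2 positions in two blocks. Moving a position between the blocks keeps
  the total, and the raising operator becomes antisymmetrization over the enlarged block.\<close>

declare One_nat_def [simp del]

section \<open>Linear algebra of functions vanishing off a finite set\<close>

lemma sum_fun_apply: "(\<Sum>i\<in>I. f i) x = (\<Sum>i\<in>I. f i x)"
  by (induction I rule: infinite_finite_induct) auto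

lemma subspaceD:
  assumes "cfun.subspace U"
  shows "0 \<in> U" "\<And>u v. u \<in> U \<Longrightarrow> v \<in> U \<Longrightarrow> u + v \<in> U" "\<And>c u. u \<in> U \<Longrightarrow> cscale c u \<in> U"
    "\<And>u v. u \<in> U \<Longrightarrow> v \<in> U \<Longrightarrow> u - v \<in> U"
  using assms cfun.subspace_diff by (auto simp: cfun.subspace_def)

definition clinear :: "(('x \<Rightarrow> complex) \<Rightarrow> 'y \<Rightarrow> complex) \<Rightarrow> bool" where
  "clinear f \<longleftrightarrow> (\<forall>u v. f (u + v) = f u + f v) \<and> (\<forall>c u. f (cscale c u) = cscale c (f u))"

lemma clinear_iff: "clinear f \<longleftrightarrow> Vector_Spaces.linear cscale cscale f"
  by (auto simp: clinear_def Vector_Spaces.linear_def module_hom_def module_hom_axioms_def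
      cfun.vector_space_axioms cfun.module_axioms)

lemma clinearI:
  assumes "\<And>u v. f (u + v) = f u + f v" "\<And>c u. f (cscale c u) = cscale c (f u)"
  shows "clinear f"
  using assms by (simp add: clinear_def)

lemma clinearD:
  assumes "clinear f"
  shows "f (u + v) = f u + f v" "f (cscale c u) = cscale c (f u)"
    "f 0 = 0" "f (u - v) = f u - f v" "f (sum g I) = (\<Sum>i\<in>I. f (g i))"
proof -
  interpret Vector_Spaces.linear cscale cscale f
    using assms by (simp add: clinear_iff)
  show "f (u + v) = f u + f v" "f (cscale c u) = cscale c (f u)"
    "f 0 = 0" "f (u - v) = f u - f v" "f (sum g I) = (\<Sum>i\<in>I. f (g i))"
    by (fact add scale zero diff sum)+
qed

lemma clinear_subspace_image:
  assumes "clinear f" "cfun.subspace U"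
  shows "cfun.subspace (f ` U)"
proof -
  interpret Vector_Spaces.linear cscale cscale f
    using assms by (simp add: clinear_iff)
  show ?thesis using assms by (simp add: subspace_image)
qed

lemma clinear_inj_on:
  assumes "clinear f" "cfun.subspace U" "\<And>u. u \<in> U \<Longrightarrow> f u = 0 \<Longrightarrow> u = 0"
  shows "inj_on f U"
proof (rule inj_onI)
  fix u v assume "u \<in> U" "v \<in> U" "f u = f v"
  then have "u - v = 0"
    using assms subspaceD(4) by (intro assms(3)) (auto simp: clinearD(4)[OF assms(1)])
  then show "u = v" by simp
qed

lemma clinear_compose: "clinear f \<Longrightarrow> clinear g \<Longrightarrow> clinear (\<lambda>x. f (g x))"
  by (simp add: clinear_def)

lemma clinear_span_image:
  assumes "clinear f"
  shows "f ` cfun.span B = cfun.span (f ` B)"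
proof -
  interpret Vector_Spaces.linear cscale cscale f
    using assms by (simp add: clinear_iff)
  show ?thesis by (simp add: span_image)
qed

text \<open>The point types are infinite and so are the dimensions of their full function spaces.
  Finite dimensionality enters everywhere as vanishing off a fixed finite set of points.\<close>

definition supported :: "'x set \<Rightarrow> ('x \<Rightarrow> complex) set" where
  "supported X = {f. \<forall>x. x \<notin> X \<longrightarrow> f x = 0}"

lemma subspace_supported: "cfun.subspace (supported X)"
  by (auto simp: cfun.subspace_def supported_def cscale_def)

definition delta :: "'x \<Rightarrow> 'x \<Rightarrow> complex" where
  "delta x = (\<lambda>y. if y = x then 1 else 0)"

lemma supported_eq_span:
  assumes "finite X"
  shows "supported X = cfun.span (delta ` X)"
proof
  show "supported X \<subseteq> cfun.span (delta ` X)"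
  proof
    fix f assume f: "f \<in> supported X"
    have "f = (\<Sum>x\<in>X. cscale (f x) (delta x))"
      using f assms by (auto simp: fun_eq_iff sum_fun_apply cscale_def delta_def supported_def
          if_distrib sum.If_cases Int_def cong: if_cong)
    also have "\<dots> \<in> cfun.span (delta ` X)"
      by (intro cfun.span_sum cfun.span_scale cfun.span_base) auto
    finally show "f \<in> cfun.span (delta ` X)" .
  qed
  show "cfun.span (delta ` X) \<subseteq> supported X"
    by (rule cfun.span_minimal[OF _ subspace_supported]) (auto simp: delta_def supported_def)
qed

lemma finite_basis:
  assumes "finite X" "U \<subseteq> supported X"
  obtains B where "B \<subseteq> U" "finite B" "cfun.independent B" "U \<subseteq> cfun.span B" "card B = cfun.dim U"
proof -
  obtain B where B: "B \<subseteq> U" "cfun.independent B" "U \<subseteq> cfun.span B" "card B = cfun.dim U"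
    using cfun.basis_exists by blast
  have "B \<subseteq> cfun.span (delta ` X)" using B assms supported_eq_span by blast
  then have "finite B"
    using cfun.independent_span_bound[of "delta ` X" B] B assms by blast
  with B that show thesis by blast
qed

lemma card_independent_le_dim:
  assumes "finite X" "U \<subseteq> supported X" "B \<subseteq> U" "cfun.independent B"
  shows "finite B \<and> card B \<le> cfun.dim U"
proof -
  obtain C where "finite C" "U \<subseteq> cfun.span C" "card C = cfun.dim U"
    using finite_basis[OF assms(1,2)] by metis
  then show ?thesis
    using cfun.independent_span_bound[of C B] assms by auto
qed

lemma dim_mono_supported:
  assumes "finite X" "U \<subseteq> supported X" "V \<subseteq> U"
  shows "cfun.dim V \<le> cfun.dim U"
proof -
  obtain B where "B \<subseteq> V" "cfun.independent B" "card B = cfun.dim V"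
    using finite_basis[OF assms(1), of V] assms by (metis subset_trans)
  then show ?thesis using card_independent_le_dim[OF assms(1,2), of B] assms by auto
qed

lemma dim_less_supported:
  assumes "finite X" "U \<subseteq> supported X" "V \<subseteq> U" "cfun.subspace V" "V \<noteq> U"
  shows "cfun.dim V < cfun.dim U"
proof -
  obtain B where B: "B \<subseteq> V" "finite B" "cfun.independent B" "V \<subseteq> cfun.span B" "card B = cfun.dim V"
    using finite_basis[OF assms(1), of V] assms by (metis subset_trans)
  obtain u where u: "u \<in> U" "u \<notin> V" using assms by blast
  have "cfun.span B \<subseteq> V" using B assms by (simp add: cfun.span_minimal)
  then have "cfun.independent (insert u B)" "u \<notin> B"
    using u B cfun.independent_insertI by blast+
  then show ?thesis
    using card_independent_le_dim[OF assms(1,2), of "insert u B"] B u assms(3)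
    by (simp add: subset_trans[OF B(1) assms(3)])
qed

lemma dim_clinear_image:
  assumes "clinear f" "inj_on f U" "cfun.subspace U" "finite X" "U \<subseteq> supported X"
  shows "cfun.dim (f ` U) = cfun.dim U"
proof -
  interpret vector_space_pair cscale cscale ..
  obtain B where B: "B \<subseteq> U" "finite B" "cfun.independent B" "U \<subseteq> cfun.span B" "card B = cfun.dim U"
    using finite_basis[OF assms(4,5)] by metis
  have BU: "cfun.span B = U" using B assms by (simp add: cfun.span_minimal subset_antisym)
  have f: "Vector_Spaces.linear cscale cscale f" using assms by (simp add: clinear_iff)
  have "cfun.independent (f ` B)"
    using linear_independent_injective_image[OF f] B assms BU by blast
  moreover have "cfun.span (f ` B) = f ` U"
    using clinear_span_image[OF assms(1), of B] BU by simp
  ultimately have "cfun.dim (f ` U) = card (f ` B)"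
    using cfun.dim_span_eq_card_independent by metis
  also have "\<dots> = card B"
    using card_image inj_on_subset[OF assms(2) B(1)] by blast
  finally show ?thesis using B by simp
qed

section \<open>Unitary structure and complete reducibility\<close>

text \<open>For finite X this is definite on \<open>supported X\<close>; on all functions it is only
  semidefinite, its radical being the functions that vanish on X.\<close>

definition cinner :: "'x set \<Rightarrow> ('x \<Rightarrow> complex) \<Rightarrow> ('x \<Rightarrow> complex) \<Rightarrow> complex" where
  "cinner X f g = (\<Sum>x\<in>X. f x * cnj (g x))"

lemma cinner_simps:
  "cinner X (f + g) h = cinner X f h + cinner X g h"
  "cinner X (f - g) h = cinner X f h - cinner X g h"
  "cinner X (cscale c f) h = c * cinner X f h"
  "cinner X h (f + g) = cinner X h f + cinner X h g"
  "cinner X h (f - g) = cinner X h f - cinner X h g"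
  "cinner X h (cscale c f) = cnj c * cinner X h f"
  "cinner X 0 h = 0" "cinner X h 0 = 0"
  by (auto simp: cinner_def cscale_def algebra_simps sum.distrib sum_subtractf sum_distrib_left)

lemma cinner_sum:
  "cinner X (sum f I) h = (\<Sum>i\<in>I. cinner X (f i) h)"
  "cinner X h (sum f I) = (\<Sum>i\<in>I. cinner X h (f i))"
  by (induction I rule: infinite_finite_induct) (auto simp: cinner_simps)

lemma cinner_commute: "cinner X g f = cnj (cinner X f g)"
  by (simp add: cinner_def mult.commute)

lemma cinner_self: "cinner X f f = of_real (\<Sum>x\<in>X. (cmod (f x))\<^sup>2)"
  by (simp add: cinner_def complex_norm_square[symmetric])

lemma cinner_self_eq_0:
  assumes "finite X"
  shows "cinner X f f = 0 \<longleftrightarrow> (\<forall>x\<in>X. f x = 0)"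
  using assms by (simp only: cinner_self of_real_eq_0_iff) (simp add: sum_nonneg_eq_0_iff)

lemma supported_cinner_0:
  assumes "finite X" "f \<in> supported X" "cinner X f f = 0"
  shows "f = 0"
  using assms by (auto simp: cinner_self_eq_0 supported_def fun_eq_iff)

text \<open>One Gram-Schmidt step per generator: b is replaced by its component b' orthogonal to the
  span of B, and b' then corrects the projection of f.\<close>

lemma projection_finite:
  assumes "finite X" "finite B"
  shows "\<exists>u\<in>cfun.span B. \<forall>b\<in>cfun.span B. cinner X (f - u) b = 0"
  using assms(2)
proof (induction B arbitrary: f rule: finite_induct)
  case empty
  show ?case by (auto simp: cinner_def)
next
  case (insert b B)
  obtain p where p: "p \<in> cfun.span B" "\<And>c. c \<in> cfun.span B \<Longrightarrow> cinner X (b - p) c = 0"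
    using insert.IH[of b] by blast
  obtain q where q: "q \<in> cfun.span B" "\<And>c. c \<in> cfun.span B \<Longrightarrow> cinner X (f - q) c = 0"
    using insert.IH[of f] by blast
  define b' where "b' = b - p"
  define k where "k = cinner X (f - q) b' / cinner X b' b'"
  define u where "u = q + cscale k b'"
  have sub: "c \<in> cfun.span B \<Longrightarrow> c \<in> cfun.span (insert b B)" for c
    using cfun.span_mono[of B "insert b B"] by auto
  have b': "b' \<in> cfun.span (insert b B)"
    unfolding b'_def using sub p by (auto intro: cfun.span_diff cfun.span_base)
  \<comment> \<open>A b' of norm 0 vanishes on X and pairs to 0 with everything, so the degenerate
    case, where k is a division by 0, is harmless.\<close>
  have zero: "cinner X g b' = 0" if "cinner X b' b' = 0" for g
    using that assms(1) by (simp add: cinner_self_eq_0) (simp add: cinner_def)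
  have u: "u \<in> cfun.span (insert b B)"
    unfolding u_def using sub q b' by (auto intro: cfun.span_add cfun.span_scale)
  have ub': "cinner X (f - u) b' = 0"
  proof (cases "cinner X b' b' = 0")
    case False
    have "cinner X (f - u) b' = cinner X (f - q) b' - k * cinner X b' b'"
      by (simp add: u_def cinner_simps algebra_simps)
    then show ?thesis using False by (simp add: k_def)
  qed (use zero in auto)
  have uB: "cinner X (f - u) c = 0" if "c \<in> cfun.span B" for c
  proof -
    have "cinner X (f - u) c = cinner X (f - q) c - k * cinner X b' c"
      by (simp add: u_def cinner_simps algebra_simps)
    then show ?thesis using p q that by (simp add: b'_def)
  qed
  have "cinner X (f - u) c = 0" if c: "c \<in> cfun.span (insert b B)" for c
  proof -
    obtain l where "c - cscale l b \<in> cfun.span B"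
      using c by (auto simp: cfun.span_insert)
    then have "c - cscale l b + cscale l p \<in> cfun.span B"
      using p by (simp add: cfun.span_add cfun.span_scale)
    moreover have "c - cscale l b + cscale l p = c - cscale l b'"
      by (auto simp: b'_def cscale_def fun_eq_iff algebra_simps)
    ultimately have "cinner X (f - u) (c - cscale l b') = 0"
      using uB by simp
    then show ?thesis using ub' by (simp add: cinner_simps)
  qed
  then show ?case using u by blast
qed

lemma projection:
  assumes "finite X" "U \<subseteq> supported X" "cfun.subspace U"
  obtains u where "u \<in> U" "\<And>b. b \<in> U \<Longrightarrow> cinner X (f - u) b = 0"
proof -
  obtain B where B: "B \<subseteq> U" "finite B" "U \<subseteq> cfun.span B"
    using finite_basis[OF assms(1,2)] by metis
  then have "cfun.span B = U" using assms by (simp add: cfun.span_minimal subset_antisym)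
  with projection_finite[OF assms(1) B(2), of f] that show thesis by auto
qed

text \<open>Moves are a right action on points, whence the reversed order in
  \<open>move_comp\<close>; \<open>act\<close> is then a left action. As the moves permute the
  finite set X, \<open>cinner X\<close> is invariant and the representation is unitary from the
  start.\<close>

locale function_rep =
  fixes d :: nat and R :: "'x rep" and X :: "'x set"
  assumes finite_points: "finite X"
    and move_closed: "\<And>\<sigma> x. \<sigma> permutes {1..d} \<Longrightarrow> x \<in> X \<Longrightarrow> rep_move R \<sigma> x \<in> X"
    and move_id: "\<And>x. rep_move R id x = x"
    and move_comp: "\<And>\<sigma> \<tau> x. \<sigma> permutes {1..d} \<Longrightarrow> \<tau> permutes {1..d} \<Longrightarrow>
      rep_move R (\<sigma> \<circ> \<tau>) x = rep_move R \<tau> (rep_move R \<sigma> x)"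
    and space_subrep: "subrep d R (rep_space R)"
    and space_supported: "rep_space R \<subseteq> supported X"
begin

lemma act_id: "act R id f = f"
  by (simp add: act_def move_id)

lemma act_comp:
  "\<sigma> permutes {1..d} \<Longrightarrow> \<tau> permutes {1..d} \<Longrightarrow> act R \<sigma> (act R \<tau> f) = act R (\<sigma> \<circ> \<tau>) f"
  by (simp add: act_def move_comp fun_eq_iff)

lemma move_inverse:
  assumes "\<sigma> permutes {1..d}"
  shows "rep_move R (inv \<sigma>) (rep_move R \<sigma> x) = x" "rep_move R \<sigma> (rep_move R (inv \<sigma>) x) = x"
  using move_comp[of \<sigma> "inv \<sigma>" x] move_comp[of "inv \<sigma>" \<sigma> x] assms
  by (auto simp: permutes_inv permutes_inv_o move_id)

lemma move_bij:
  assumes "\<sigma> permutes {1..d}"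
  shows "bij_betw (rep_move R \<sigma>) X X"
  by (rule bij_betwI[of _ _ _ "rep_move R (inv \<sigma>)"])
    (use assms move_closed move_inverse permutes_inv[OF assms] in auto)

lemma cinner_act:
  assumes "\<sigma> permutes {1..d}"
  shows "cinner X (act R \<sigma> f) (act R \<sigma> g) = cinner X f g"
  unfolding cinner_def act_def
  by (rule sum.reindex_bij_betw[OF move_bij[OF assms], of "\<lambda>x. f x * cnj (g x)"])

lemma cinner_act_left:
  assumes "\<sigma> permutes {1..d}"
  shows "cinner X (act R \<sigma> f) g = cinner X f (act R (inv \<sigma>) g)"
proof -
  have "cinner X (act R \<sigma> f) g = cinner X (act R (inv \<sigma>) (act R \<sigma> f)) (act R (inv \<sigma>) g)"
    using cinner_act permutes_inv assms by metis
  then show ?thesis using assms by (simp add: act_comp permutes_inv permutes_inv_o act_id)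
qed

lemma clinear_act: "clinear (act R \<sigma>)"
  by (auto simp: clinear_def act_def cscale_def)

lemma restrict_space:
  assumes "subrep d R U"
  shows "function_rep d (R\<lparr>rep_space := U\<rparr>) X"
  using assms finite_points move_closed move_id move_comp space_supported
  by unfold_locales (auto simp: subrep_def act_def)

text \<open>The adjoint of \<open>act R \<sigma>\<close> is \<open>act R (inv \<sigma>)\<close>,
  which preserves W, so translates of a vector orthogonal to W are orthogonal to W.\<close>

lemma subrep_complement:
  assumes "subrep d R U" "subrep d R W"
  shows "subrep d R {u\<in>U. \<forall>w\<in>W. cinner X u w = 0}"
  unfolding subrep_def
proof (intro conjI allI impI ballI)
  show "cfun.subspace {u \<in> U. \<forall>w\<in>W. cinner X u w = 0}"
    using assms by (auto simp: subrep_def cfun.subspace_def cinner_simps)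
  show "{u \<in> U. \<forall>w\<in>W. cinner X u w = 0} \<subseteq> rep_space R"
    using assms by (auto simp: subrep_def)
  fix \<sigma> u assume "\<sigma> permutes {1..d}" "u \<in> {u \<in> U. \<forall>w\<in>W. cinner X u w = 0}"
  then show "act R \<sigma> u \<in> {u \<in> U. \<forall>w\<in>W. cinner X u w = 0}"
    using assms permutes_inv[of \<sigma> "{1..d}"] by (auto simp: subrep_def cinner_act_left)
qed

lemma subrep_supported: "subrep d R U \<Longrightarrow> U \<subseteq> supported X"
  using space_supported by (auto simp: subrep_def)

lemma ex_irreducible_subrep:
  assumes "subrep d R U" "U \<noteq> {0}"
  shows "\<exists>W. W \<subseteq> U \<and> irreducible_subrep d R W"
  using assms
proof (induction "cfun.dim U" arbitrary: U rule: less_induct)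
  case less
  show ?case
  proof (cases "irreducible_subrep d R U")
    case False
    then obtain W where W: "subrep d R W" "W \<subseteq> U" "W \<noteq> {0}" "W \<noteq> U"
      using less.prems by (auto simp: irreducible_subrep_def)
    then have "cfun.dim W < cfun.dim U"
      using dim_less_supported[OF finite_points subrep_supported] less.prems
      by (auto simp: subrep_def)
    then show ?thesis using less.hyps[of W] W by blast
  qed auto
qed

text \<open>Maschke by orthogonal complements: split off an irreducible W and recurse into its
  complement in U, which is smaller because a nonzero vector of W is not orthogonal to itself.
  Orthogonality of the summands is carried along since it later gives uniqueness of
  components.\<close>

lemma ex_orthogonal_decomposition:
  assumes "subrep d R U"
  shows "\<exists>\<U>. finite \<U> \<and> (\<forall>W\<in>\<U>. irreducible_subrep d R W \<and> W \<subseteq> U) \<and>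
    (\<forall>W\<in>\<U>. \<forall>W'\<in>\<U>. W \<noteq> W' \<longrightarrow> (\<forall>w\<in>W. \<forall>w'\<in>W'. cinner X w w' = 0)) \<and>
    (\<forall>u\<in>U. \<exists>f. (\<forall>W\<in>\<U>. f W \<in> W) \<and> u = (\<Sum>W\<in>\<U>. f W))"
  using assms
proof (induction "cfun.dim U" arbitrary: U rule: less_induct)
  case less
  show ?case
  proof (cases "U = {0}")
    case True
    then show ?thesis by (intro exI[of _ "{}"]) auto
  next
    case False
    obtain W where W: "W \<subseteq> U" "irreducible_subrep d R W"
      using ex_irreducible_subrep[OF less.prems False] by blast
    then have Ws: "subrep d R W" "W \<noteq> {0}" "cfun.subspace W"
      by (auto simp: irreducible_subrep_def subrep_def)
    define V where "V = {u\<in>U. \<forall>w\<in>W. cinner X u w = 0}"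
    have V: "subrep d R V" "V \<subseteq> U"
      using subrep_complement[OF less.prems Ws(1)] by (auto simp: V_def)
    obtain w where w: "w \<in> W" "w \<noteq> 0"
      using Ws subspaceD(1) by blast
    have "w \<notin> V"
      using w supported_cinner_0[OF finite_points] subrep_supported[OF Ws(1)] by (auto simp: V_def)
    then have "V \<noteq> U" using w W by blast
    then have "cfun.dim V < cfun.dim U"
      using dim_less_supported[OF finite_points subrep_supported[OF less.prems] V(2)] V
      by (simp add: subrep_def)
    from less.hyps[OF this V(1)] obtain \<V> where
      "finite \<V> \<and> (\<forall>W\<in>\<V>. irreducible_subrep d R W \<and> W \<subseteq> V) \<and>
      (\<forall>W\<in>\<V>. \<forall>W'\<in>\<V>. W \<noteq> W' \<longrightarrow> (\<forall>w\<in>W. \<forall>w'\<in>W'. cinner X w w' = 0)) \<and>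
      (\<forall>u\<in>V. \<exists>f. (\<forall>W\<in>\<V>. f W \<in> W) \<and> u = (\<Sum>W\<in>\<V>. f W))"
      by (elim exE)
    then have \<V>: "finite \<V>" "\<forall>W\<in>\<V>. irreducible_subrep d R W \<and> W \<subseteq> V"
      "\<forall>W\<in>\<V>. \<forall>W'\<in>\<V>. W \<noteq> W' \<longrightarrow> (\<forall>w\<in>W. \<forall>w'\<in>W'. cinner X w w' = 0)"
      "\<forall>u\<in>V. \<exists>f. (\<forall>W\<in>\<V>. f W \<in> W) \<and> u = (\<Sum>W\<in>\<V>. f W)"
      by simp_all
    have notin: "W \<notin> \<V>" using \<V>(2) w \<open>w \<notin> V\<close> by blast
    have orth: "cinner X w v = 0" "cinner X v w = 0" if "w \<in> W" "v \<in> V" for v w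
      using that cinner_commute[of X v w] by (auto simp: V_def)
    show ?thesis
    proof (intro exI[of _ "insert W \<V>"] conjI ballI impI)
      fix u assume u: "u \<in> U"
      obtain p where p: "p \<in> W" "\<And>b. b \<in> W \<Longrightarrow> cinner X (u - p) b = 0"
        using projection[OF finite_points subrep_supported[OF Ws(1)] Ws(3)] by metis
      have "u - p \<in> V"
        using p u W less.prems subspaceD(4)[of U u p] by (auto simp: V_def subrep_def)
      then obtain f where f: "\<forall>W\<in>\<V>. f W \<in> W" "u - p = (\<Sum>W\<in>\<V>. f W)"
        using bspec[OF \<V>(4)] by blast
      have "(\<Sum>Y\<in>\<V>. (f(W := p)) Y) = (\<Sum>Y\<in>\<V>. f Y)"
        using notin by (intro sum.cong) auto
      then have "u = (\<Sum>Y\<in>insert W \<V>. (f(W := p)) Y)"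
        using \<V>(1) notin f(2)[symmetric] by simp
      moreover have "\<forall>Y\<in>insert W \<V>. (f(W := p)) Y \<in> Y" using f p by auto
      ultimately show "\<exists>f. (\<forall>W\<in>insert W \<V>. f W \<in> W) \<and> u = (\<Sum>W\<in>insert W \<V>. f W)"
        by (intro exI[of _ "f(W := p)"] conjI)
    next
      have \<V>V: "y \<in> V" if "y \<in> Y" "Y \<in> \<V>" for y Y
        using \<V>(2) that by auto
      fix Y Y' y y' assume "Y \<in> insert W \<V>" "Y' \<in> insert W \<V>" "Y \<noteq> Y'" "y \<in> Y" "y' \<in> Y'"
      then show "cinner X y y' = 0"
        using \<V>(3) orth(1)[of y y'] orth(2)[of y' y] \<V>V[of y Y] \<V>V[of y' Y']
        by (auto simp only: insert_iff)
    qed (use \<V>(1,2) W V(2) in auto)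
  qed
qed

lemma ex_irreducible_decomposition: "\<exists>\<U>. irreducible_decomposition d R \<U>"
proof -
  from ex_orthogonal_decomposition[OF space_subrep] obtain \<U> where *:
    "finite \<U> \<and> (\<forall>W\<in>\<U>. irreducible_subrep d R W \<and> W \<subseteq> rep_space R) \<and>
    (\<forall>W\<in>\<U>. \<forall>W'\<in>\<U>. W \<noteq> W' \<longrightarrow> (\<forall>w\<in>W. \<forall>w'\<in>W'. cinner X w w' = 0)) \<and>
    (\<forall>u\<in>rep_space R. \<exists>f. (\<forall>W\<in>\<U>. f W \<in> W) \<and> u = (\<Sum>W\<in>\<U>. f W))"
    by (elim exE)
  then have U: "finite \<U>" "\<And>W. W\<in>\<U> \<Longrightarrow> irreducible_subrep d R W"
    "\<And>W W' w w'. W \<in> \<U> \<Longrightarrow> W' \<in> \<U> \<Longrightarrow> W \<noteq> W' \<Longrightarrow> w \<in> W \<Longrightarrow> w' \<in> W' \<Longrightarrow> cinner X w w' = 0"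
    "\<And>u. u \<in> rep_space R \<Longrightarrow> \<exists>f. (\<forall>W\<in>\<U>. f W \<in> W) \<and> u = (\<Sum>W\<in>\<U>. f W)"
    by simp_all
  have "\<exists>!f. f \<in> (\<Pi>\<^sub>E W\<in>\<U>. W) \<and> v = (\<Sum>W\<in>\<U>. f W)" if v: "v \<in> rep_space R" for v
  proof -
    obtain f where f: "\<forall>W\<in>\<U>. f W \<in> W" "v = (\<Sum>W\<in>\<U>. f W)"
      using U(4)[OF v] by blast
    \<comment> \<open>\<open>irreducible_decomposition\<close> asks for uniqueness in the
      extensional product, hence the restriction.\<close>
    have 1: "restrict f \<U> \<in> (\<Pi>\<^sub>E W\<in>\<U>. W)" "v = (\<Sum>W\<in>\<U>. restrict f \<U> W)"
      using f by auto
    have "g = h" if g: "g \<in> (\<Pi>\<^sub>E W\<in>\<U>. W)" "v = (\<Sum>W\<in>\<U>. g W)"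
      and h: "h \<in> (\<Pi>\<^sub>E W\<in>\<U>. W)" "v = (\<Sum>W\<in>\<U>. h W)" for g h
    proof (rule PiE_ext[OF g(1) h(1)])
      fix W assume W: "W \<in> \<U>"
      have Wsub: "subrep d R W" using U(2)[OF W] by (simp add: irreducible_subrep_def)
      have mem: "g Y - h Y \<in> Y" if "Y \<in> \<U>" for Y
        using U(2)[OF that] g h that subspaceD(4)[of Y "g Y" "h Y"]
        by (auto simp: irreducible_subrep_def subrep_def PiE_def Pi_def)
      \<comment> \<open>Pairing the zero vector, written as the sum of all differences, with the
        W-component leaves only the square norm of that component.\<close>
      have "0 = cinner X (\<Sum>Y\<in>\<U>. g Y - h Y) (g W - h W)"
        using g h by (simp add: sum_subtractf cinner_simps)
      also have "\<dots> = (\<Sum>Y\<in>\<U>. if Y = W then cinner X (g W - h W) (g W - h W) else 0)"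
        unfolding cinner_sum using U(3)[OF _ W] mem W by (intro sum.cong) auto
      also have "\<dots> = cinner X (g W - h W) (g W - h W)" using W U(1) by simp
      finally have "cinner X (g W - h W) (g W - h W) = 0" by (rule sym)
      then have "g W - h W = 0"
        using supported_cinner_0[OF finite_points] subrep_supported[OF Wsub] mem[OF W] by blast
      then show "g W = h W" by simp
    qed
    then show ?thesis using 1 by blast
  qed
  then show ?thesis
    unfolding irreducible_decomposition_def using U(1,2) by (intro exI[of _ \<U>] conjI ballI)
qed

end

section \<open>Young symmetrizers and multiplicities\<close>

text \<open>The group algebra element with coefficients c on G, acting on functions; row sums and
  column sums are its two instances.\<close>

definition gsum :: "(nat \<Rightarrow> nat) set \<Rightarrow> ((nat \<Rightarrow> nat) \<Rightarrow> complex) \<Rightarrow> 'x rep \<Rightarrow>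
    ('x \<Rightarrow> complex) \<Rightarrow> 'x \<Rightarrow> complex" where
  "gsum G c R f = (\<Sum>\<sigma>\<in>G. cscale (c \<sigma>) (act R \<sigma> f))"

lemma gsum_apply: "gsum G c R f x = (\<Sum>\<sigma>\<in>G. c \<sigma> * f (rep_move R \<sigma> x))"
  by (simp add: gsum_def sum_fun_apply cscale_def act_def)

lemma clinear_gsum: "clinear (gsum G c R)"
  by (rule clinearI)
    (auto simp: fun_eq_iff gsum_apply cscale_def algebra_simps sum.distrib sum_distrib_left)

lemma gsum_rep_space: "gsum G c (R\<lparr>rep_space := U\<rparr>) = gsum G c R"
  by (simp add: fun_eq_iff gsum_apply)

definition perms :: "nat \<Rightarrow> (nat \<Rightarrow> nat) set" where
  "perms d = {\<sigma>. \<sigma> permutes {1..d}}"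

lemma finite_perms: "finite (perms d)"
  by (simp add: perms_def finite_permutations)

lemma perms_compose: "\<sigma> \<in> perms d \<Longrightarrow> \<tau> \<in> perms d \<Longrightarrow> \<sigma> \<circ> \<tau> \<in> perms d"
  by (simp add: perms_def permutes_compose)

lemma perms_inv: "\<sigma> \<in> perms d \<Longrightarrow> inv \<sigma> \<in> perms d"
  by (simp add: perms_def permutes_inv)

lemma perms_sign:
  "\<sigma> \<in> perms d \<Longrightarrow> \<tau> \<in> perms d \<Longrightarrow> sign (\<sigma> \<circ> \<tau>) = sign \<sigma> * sign \<tau>"
  "\<sigma> \<in> perms d \<Longrightarrow> sign (inv \<sigma>) = sign \<sigma>"
  using permutes_imp_permutation[of "{1..d}"]
  by (auto simp: perms_def sign_compose sign_inverse)

lemma perms_cancel: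
  assumes "\<sigma> \<in> perms d"
  shows "\<sigma> (inv \<sigma> x) = x" "inv \<sigma> (\<sigma> x) = x" "\<sigma> \<circ> (inv \<sigma> \<circ> f) = f" "inv \<sigma> \<circ> (\<sigma> \<circ> f) = f"
    "g \<circ> \<sigma> \<circ> inv \<sigma> = g" "g \<circ> inv \<sigma> \<circ> \<sigma> = g" "\<sigma> \<circ> inv \<sigma> = id" "inv \<sigma> \<circ> \<sigma> = id"
  using assms permutes_inverses[of \<sigma> "{1..d}"] by (auto simp: perms_def fun_eq_iff)

lemma bij_betw_perms_compose:
  assumes "\<sigma> \<in> perms d" "G \<subseteq> perms d" "\<And>\<tau>. \<tau> \<in> G \<Longrightarrow> \<sigma> \<circ> \<tau> \<in> G" "\<And>\<tau>. \<tau> \<in> G \<Longrightarrow> inv \<sigma> \<circ> \<tau> \<in> G"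
  shows "bij_betw (\<lambda>\<tau>. \<sigma> \<circ> \<tau>) G G"
  by (rule bij_betwI[of _ _ _ "\<lambda>\<tau>. inv \<sigma> \<circ> \<tau>"]) (use assms in \<open>auto simp: perms_cancel\<close>)

lemma bij_betw_inv_perms:
  assumes "G \<subseteq> perms d" "\<And>\<tau>. \<tau> \<in> G \<Longrightarrow> inv \<tau> \<in> G"
  shows "bij_betw inv G G"
  by (rule bij_betwI[of _ _ _ inv])
    (use assms in \<open>auto simp: perms_def permutes_inv_inv subset_iff\<close>)

text \<open>Linearity and equivariance are demanded on U only, because \<open>rep_iso\<close> gives
  no control of its map outside \<open>rep_space\<close>.\<close>

definition intertwines :: "nat \<Rightarrow> ('x \<Rightarrow> complex) set \<Rightarrow> 'x rep \<Rightarrow> 'y rep \<Rightarrow>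
    (('x \<Rightarrow> complex) \<Rightarrow> 'y \<Rightarrow> complex) \<Rightarrow> bool" where
  "intertwines d U R S \<phi> \<longleftrightarrow> (\<forall>u\<in>U. \<forall>v\<in>U. \<phi> (u + v) = \<phi> u + \<phi> v) \<and>
     (\<forall>c. \<forall>u\<in>U. \<phi> (cscale c u) = cscale c (\<phi> u)) \<and>
     (\<forall>\<sigma>\<in>perms d. \<forall>u\<in>U. \<phi> (act R \<sigma> u) = act S \<sigma> (\<phi> u))"

lemma gsum_in_subrep:
  assumes "subrep d R U" "G \<subseteq> perms d" "u \<in> U"
  shows "gsum G c R u \<in> U"
  unfolding gsum_def using assms
  by (intro cfun.subspace_sum subspaceD) (auto simp: subrep_def perms_def subset_iff)

text \<open>Since \<phi> is additive on U only, the sum is built up by induction over G, with every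
  partial sum seen to lie in U.\<close>

lemma gsum_intertwines:
  assumes "intertwines d U R S \<phi>" "subrep d R U" "G \<subseteq> perms d" "u \<in> U"
  shows "\<phi> (gsum G c R u) = gsum G c S (\<phi> u)"
proof -
  have sub: "cfun.subspace U" using assms by (simp add: subrep_def)
  have "cscale 0 (0 :: 'a \<Rightarrow> complex) = 0" "cscale 0 (\<phi> 0) = 0"
    by (auto simp: cscale_def fun_eq_iff)
  then have zero: "\<phi> 0 = 0"
    using assms(1) subspaceD(1)[OF sub] by (metis intertwines_def)
  have mem: "cscale (c \<sigma>) (act R \<sigma> u) \<in> U" if "\<sigma> \<in> perms d" for \<sigma>
    using assms that subspaceD(3)[OF sub] by (auto simp: subrep_def perms_def)
  have act: "\<phi> (cscale (c \<sigma>) (act R \<sigma> u)) = cscale (c \<sigma>) (act S \<sigma> (\<phi> u))" if "\<sigma> \<in> perms d" for \<sigma>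
    using assms that by (auto simp: subrep_def perms_def intertwines_def)
  have "finite G" using assms finite_perms finite_subset by blast
  then show ?thesis using assms(3)
  proof (induction G rule: finite_induct)
    case (insert \<sigma> G)
    have "gsum G c R u \<in> U" using gsum_in_subrep assms insert by blast
    moreover have "gsum (insert \<sigma> G) c R u = cscale (c \<sigma>) (act R \<sigma> u) + gsum G c R u" for R :: "'z rep" and u
      using insert by (simp add: gsum_def)
    moreover have "\<phi> (gsum G c R u) = gsum G c S (\<phi> u)" using insert by simp
    moreover have "\<phi> (v + w) = \<phi> v + \<phi> w" if "v \<in> U" "w \<in> U" for v w
      using assms(1) that by (simp add: intertwines_def)
    ultimately show ?case
      using insert.prems mem[of \<sigma>] act[of \<sigma>] by (metis insert_subset)
  next
    case empty
    show ?case using zero by (simp only: gsum_def sum.empty)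
  qed
qed

lemma clinear_intertwines:
  assumes "clinear \<phi>" "\<And>\<sigma> u. \<sigma> \<in> perms d \<Longrightarrow> u \<in> U \<Longrightarrow> \<phi> (act R \<sigma> u) = act S \<sigma> (\<phi> u)"
  shows "intertwines d U R S \<phi>"
  using assms by (simp add: intertwines_def clinear_def)

section \<open>Young symmetrizers, tabloids and Specht spaces\<close>

definition colsum :: "(nat \<Rightarrow> nat) set \<Rightarrow> 'x rep \<Rightarrow> ('x \<Rightarrow> complex) \<Rightarrow> 'x \<Rightarrow> complex" where
  "colsum G = gsum G (\<lambda>\<sigma>. of_int (sign \<sigma>))"

definition rowsum :: "(nat \<Rightarrow> nat) set \<Rightarrow> 'x rep \<Rightarrow> ('x \<Rightarrow> complex) \<Rightarrow> 'x \<Rightarrow> complex" where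
  "rowsum G = gsum G (\<lambda>\<sigma>. 1)"

text \<open>The row sum acts first. On the tabloid module it multiplies the tabloid t by the order
  of the row group, so the symmetrizer sends this tabloid to a multiple of its polytabloid.\<close>

definition symmetrizer :: "(nat \<Rightarrow> nat) set \<Rightarrow> (nat \<Rightarrow> nat) set \<Rightarrow> 'x rep \<Rightarrow>
    ('x \<Rightarrow> complex) \<Rightarrow> 'x \<Rightarrow> complex" where
  "symmetrizer C G R f = colsum C R (rowsum G R f)"

text \<open>Column numbers are compared on {1..d} only, as \<open>col\<close> may take arbitrary
  values elsewhere; row functions, in contrast, are 0 outside.\<close>

definition column_group :: "nat \<Rightarrow> (nat \<Rightarrow> nat) \<Rightarrow> (nat \<Rightarrow> nat) set" where
  "column_group d col = {\<sigma>\<in>perms d. \<forall>i\<in>{1..d}. col (\<sigma> i) = col i}"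

definition row_group :: "nat \<Rightarrow> (nat \<Rightarrow> nat) \<Rightarrow> (nat \<Rightarrow> nat) set" where
  "row_group d t = {\<sigma>\<in>perms d. t \<circ> \<sigma> = t}"

text \<open>A tabloid is the function from entries to rows. The tabloids of one shape form a single
  orbit, so t can stand for the shape.\<close>

definition tabloids :: "nat \<Rightarrow> (nat \<Rightarrow> nat) \<Rightarrow> (nat \<Rightarrow> nat) set" where
  "tabloids d t = (\<lambda>\<sigma>. t \<circ> \<sigma>) ` perms d"

definition tabloid_rep :: "nat \<Rightarrow> (nat \<Rightarrow> nat) \<Rightarrow> (nat \<Rightarrow> nat) rep" where
  "tabloid_rep d t = \<lparr>rep_space = supported (tabloids d t), rep_move = (\<lambda>\<sigma> w. w \<circ> \<sigma>)\<rparr>"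

definition spechtgen :: "nat \<Rightarrow> (nat \<Rightarrow> nat) \<Rightarrow> (nat \<Rightarrow> nat) \<Rightarrow> (nat \<Rightarrow> nat) \<Rightarrow> complex" where
  "spechtgen d t col = colsum (column_group d col) (tabloid_rep d t) (delta t)"

definition specht_space :: "nat \<Rightarrow> (nat \<Rightarrow> nat) \<Rightarrow> (nat \<Rightarrow> nat) \<Rightarrow> ((nat \<Rightarrow> nat) \<Rightarrow> complex) set" where
  "specht_space d t col =
    cfun.span ((\<lambda>\<sigma>. act (tabloid_rep d t) \<sigma> (spechtgen d t col)) ` perms d)"

lemma clinear_symmetrizer: "clinear (symmetrizer C G R)"
  unfolding symmetrizer_def colsum_def rowsum_def
  by (rule clinear_compose[OF clinear_gsum clinear_gsum])

lemma symmetrizer_rep_space: "symmetrizer C G (R\<lparr>rep_space := U\<rparr>) = symmetrizer C G R"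
  by (simp add: fun_eq_iff symmetrizer_def colsum_def rowsum_def gsum_rep_space)

lemma symmetrizer_in_subrep:
  assumes "subrep d R U" "C \<subseteq> perms d" "G \<subseteq> perms d" "u \<in> U"
  shows "symmetrizer C G R u \<in> U"
  using assms by (simp add: symmetrizer_def colsum_def rowsum_def gsum_in_subrep)

lemma symmetrizer_intertwines:
  assumes "intertwines d U R S \<phi>" "subrep d R U" "C \<subseteq> perms d" "G \<subseteq> perms d" "u \<in> U"
  shows "\<phi> (symmetrizer C G R u) = symmetrizer C G S (\<phi> u)"
  using assms by (simp add: symmetrizer_def colsum_def rowsum_def gsum_in_subrep gsum_intertwines)

lemma column_group_perms: "column_group d col \<subseteq> perms d"
  by (auto simp: column_group_def)

lemma row_group_perms: "row_group d t \<subseteq> perms d"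
  by (auto simp: row_group_def)

lemma column_group_compose:
  assumes "\<sigma> \<in> column_group d col" "\<tau> \<in> column_group d col"
  shows "\<sigma> \<circ> \<tau> \<in> column_group d col"
  using assms perms_compose permutes_in_image[of \<tau> "{1..d}"]
  by (auto simp: column_group_def perms_def simp del: atLeastAtMost_iff)

lemma column_group_inv:
  assumes "\<sigma> \<in> column_group d col"
  shows "inv \<sigma> \<in> column_group d col"
proof -
  have p: "inv \<sigma> \<in> perms d" using assms perms_inv by (auto simp: column_group_def)
  moreover have "col (inv \<sigma> i) = col i" if "i \<in> {1..d}" for i
  proof -
    have "inv \<sigma> i \<in> {1..d}" using p that permutes_in_image[of "inv \<sigma>" "{1..d}" i] by (simp add: perms_def)
    then have "col (\<sigma> (inv \<sigma> i)) = col (inv \<sigma> i)" using assms by (simp add: column_group_def)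
    moreover have "\<sigma> (inv \<sigma> i) = i"
      using assms perms_cancel(1)[of \<sigma> d] by (simp add: column_group_def)
    ultimately show ?thesis by simp
  qed
  ultimately show ?thesis by (simp add: column_group_def)
qed

lemma row_group_inv: "\<sigma> \<in> row_group d t \<Longrightarrow> inv \<sigma> \<in> row_group d t"
  using perms_cancel(5)[of \<sigma> d t] by (auto simp: row_group_def perms_inv)

lemma id_perms: "id \<in> perms d"
  by (simp add: perms_def permutes_id)

context function_rep
begin

lemma perms_actD:
  "\<sigma> \<in> perms d \<Longrightarrow> \<tau> \<in> perms d \<Longrightarrow> act R \<sigma> (act R \<tau> f) = act R (\<sigma> \<circ> \<tau>) f"
  by (simp add: perms_def act_comp)

lemma act_colsum:
  assumes "\<tau> \<in> column_group d col"
  shows "act R \<tau> (colsum (column_group d col) R f) =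
    cscale (of_int (sign \<tau>)) (colsum (column_group d col) R f)"
proof -
  let ?C = "column_group d col"
  have \<tau>: "\<tau> \<in> perms d" using assms column_group_perms by blast
  have "cscale (of_int (sign \<tau>)) (colsum ?C R f) =
      cscale (of_int (sign \<tau>)) (\<Sum>\<sigma>\<in>?C. cscale (of_int (sign (\<tau> \<circ> \<sigma>))) (act R (\<tau> \<circ> \<sigma>) f))"
    unfolding colsum_def gsum_def
    by (subst sum.reindex_bij_betw[OF bij_betw_perms_compose[OF \<tau> column_group_perms], symmetric])
      (use assms column_group_compose column_group_inv in auto)
  also have "\<dots> = (\<Sum>\<sigma>\<in>?C. cscale (of_int (sign \<sigma>)) (act R \<tau> (act R \<sigma> f)))"
    unfolding cfun.scale_sum_right
  proof (rule sum.cong[OF refl])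
    fix \<sigma> assume "\<sigma> \<in> ?C"
    then have \<sigma>: "\<sigma> \<in> perms d" using column_group_perms by blast
    have "complex_of_int (sign \<tau>) * of_int (sign \<tau>) = 1"
      by (metis of_int_1 of_int_mult sign_idempotent)
    then show "cscale (of_int (sign \<tau>)) (cscale (of_int (sign (\<tau> \<circ> \<sigma>))) (act R (\<tau> \<circ> \<sigma>) f)) =
        cscale (of_int (sign \<sigma>)) (act R \<tau> (act R \<sigma> f))"
      using \<sigma> \<tau> by (simp add: perms_actD perms_sign mult.assoc[symmetric])
  qed
  also have "\<dots> = act R \<tau> (colsum ?C R f)"
    unfolding colsum_def gsum_def by (simp add: clinearD[OF clinear_act])
  finally show ?thesis by simp
qed

text \<open>Taking adjoints replaces \<sigma> by its inverse and conjugates its coefficient, so real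
  coefficients invariant under inversion give a self-adjoint operator.\<close>

lemma cinner_gsum:
  assumes "G \<subseteq> perms d" "\<And>\<tau>. \<tau> \<in> G \<Longrightarrow> inv \<tau> \<in> G"
    "\<And>\<tau>. \<tau> \<in> G \<Longrightarrow> c (inv \<tau>) = c \<tau>" "\<And>\<tau>. \<tau> \<in> G \<Longrightarrow> cnj (c \<tau>) = c \<tau>"
  shows "cinner X (gsum G c R f) g = cinner X f (gsum G c R g)"
proof -
  have "cinner X f (gsum G c R g) = (\<Sum>\<sigma>\<in>G. c \<sigma> * cinner X f (act R \<sigma> g))"
    unfolding gsum_def cinner_sum cinner_simps using assms by (intro sum.cong) auto
  also have "\<dots> = (\<Sum>\<sigma>\<in>G. c (inv \<sigma>) * cinner X f (act R (inv \<sigma>) g))"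
    by (rule sum.reindex_bij_betw[OF bij_betw_inv_perms, symmetric]) (use assms in auto)
  also have "\<dots> = (\<Sum>\<sigma>\<in>G. c \<sigma> * cinner X (act R \<sigma> f) g)"
    using assms by (intro sum.cong refl) (auto simp: cinner_act_left perms_def subset_iff)
  finally show ?thesis by (simp add: gsum_def cinner_sum cinner_simps)
qed

lemma cinner_colsum:
  "cinner X (colsum (column_group d col) R f) g = cinner X f (colsum (column_group d col) R g)"
  unfolding colsum_def
proof (rule cinner_gsum)
  show "inv \<tau> \<in> column_group d col" if "\<tau> \<in> column_group d col" for \<tau>
    by (rule column_group_inv[OF that])
  show "complex_of_int (sign (inv \<tau>)) = of_int (sign \<tau>)" if "\<tau> \<in> column_group d col" for \<tau>
    using that column_group_perms perms_sign(2)[of \<tau> d] by auto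
qed (simp_all add: column_group_perms)

lemma cinner_rowsum:
  "cinner X (rowsum (row_group d t) R f) g = cinner X f (rowsum (row_group d t) R g)"
  unfolding rowsum_def
  by (rule cinner_gsum) (use row_group_perms row_group_inv in auto)

lemma span_subrep:
  assumes "B \<subseteq> rep_space R" "\<And>\<sigma> b. \<sigma> \<in> perms d \<Longrightarrow> b \<in> B \<Longrightarrow> act R \<sigma> b \<in> cfun.span B"
  shows "subrep d R (cfun.span B)"
  unfolding subrep_def
proof (intro conjI allI impI ballI)
  show "cfun.span B \<subseteq> rep_space R"
    using assms(1) space_subrep by (intro cfun.span_minimal) (simp_all add: subrep_def)
  fix \<sigma> u assume "\<sigma> permutes {1..d}" "u \<in> cfun.span B"
  then have "act R \<sigma> u \<in> cfun.span (act R \<sigma> ` B)"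
    using clinear_span_image[OF clinear_act[of \<sigma>], of B] by blast
  also have "\<dots> \<subseteq> cfun.span B"
    using assms \<open>\<sigma> permutes {1..d}\<close> by (intro cfun.span_minimal) (auto simp: perms_def)
  finally show "act R \<sigma> u \<in> cfun.span B" .
qed auto

end

text \<open>What James's theory requires of a tableau: entry i has row \<open>t i\<close> and column
  \<open>col i\<close>, no two entries share a cell, and the rows met by a column form an initial
  segment. Rows count from 0, so the value 0 of t outside {1..d} is also the index of the first row;
  stability relies on this.\<close>

locale young =
  fixes d :: nat and t col :: "nat \<Rightarrow> nat"
  assumes row_outside: "\<And>i. i \<notin> {1..d} \<Longrightarrow> t i = 0"
    and row_col_inj: "\<And>i j. i \<in> {1..d} \<Longrightarrow> j \<in> {1..d} \<Longrightarrow> t i = t j \<Longrightarrow> col i = col j \<Longrightarrow> i = j"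
    and columns_initial: "\<And>i r. i \<in> {1..d} \<Longrightarrow> r < t i \<Longrightarrow> \<exists>j\<in>{1..d}. col j = col i \<and> t j = r"
begin

abbreviation "M \<equiv> tabloid_rep d t"
abbreviation "C \<equiv> column_group d col"
abbreviation "G \<equiv> row_group d t"
abbreviation "e \<equiv> spechtgen d t col"
abbreviation "S \<equiv> specht_space d t col"

sublocale M: function_rep d M "tabloids d t"
proof
  show "finite (tabloids d t)" by (simp add: tabloids_def finite_perms)
  show closed: "rep_move M \<sigma> x \<in> tabloids d t" if "\<sigma> permutes {1..d}" "x \<in> tabloids d t" for \<sigma> x
    using that perms_compose by (auto simp: tabloids_def tabloid_rep_def perms_def comp_assoc)
  have closed': "x \<in> tabloids d t" if "\<sigma> permutes {1..d}" "x \<circ> \<sigma> \<in> tabloids d t" for \<sigma> x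
    using closed[OF permutes_inv[OF that(1)] that(2)] perms_cancel(5)[of \<sigma> d x] that
    by (simp add: tabloid_rep_def perms_def)
  show "subrep d M (rep_space M)"
    using subspace_supported closed' by (auto simp: subrep_def tabloid_rep_def supported_def act_def)
qed (auto simp: tabloid_rep_def)

lemma act_M: "act M \<sigma> f w = f (w \<circ> \<sigma>)"
  by (simp add: act_def tabloid_rep_def)

lemma t_in: "t \<in> tabloids d t"
  unfolding tabloids_def by (rule image_eqI[OF _ id_perms]) simp

text \<open>A counting argument: for each column c and bound r, count the entries of c whose row is
  less than r, under w and under t. The first count is at most the second because rows are distinct
  within a column of w and columns of t are initial segments; the totals over all columns agree
  because w rearranges t. So all counts agree, and each column occupies the same rows under w as
  under t.\<close>

lemma column_injective_tabloid:
  assumes w: "w \<in> tabloids d t"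
    and inj: "\<And>i j. i \<in> {1..d} \<Longrightarrow> j \<in> {1..d} \<Longrightarrow> w i = w j \<Longrightarrow> col i = col j \<Longrightarrow> i = j"
  shows "\<exists>\<sigma>\<in>C. w = t \<circ> \<sigma>"
proof -
  obtain \<rho> where \<rho>: "\<rho> \<in> perms d" "w = t \<circ> \<rho>" using w by (auto simp: tabloids_def)
  define L where "L u c r = card {i\<in>{1..d}. u i < r \<and> col i = c}" for u :: "nat \<Rightarrow> nat" and c r
  have total: "(\<Sum>c\<in>col ` {1..d}. L u c r) = card {i\<in>{1..d}. u i < r}" for u :: "nat \<Rightarrow> nat" and r
  proof -
    have "(\<Sum>c\<in>col ` {1..d}. \<Sum>i\<in>{i \<in> {i\<in>{1..d}. u i < r}. col i = c}. 1) = (\<Sum>i\<in>{i\<in>{1..d}. u i < r}. 1::nat)"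
      by (rule sum.group) auto
    then show ?thesis by (simp add: L_def conj_ac)
  qed
  have "bij_betw \<rho> {i\<in>{1..d}. w i < r} {i\<in>{1..d}. t i < r}" for r
    using \<rho> permutes_in_image[of \<rho> "{1..d}"] permutes_in_image[OF permutes_inv, of \<rho> "{1..d}"]
    by (intro bij_betwI[of _ _ _ "inv \<rho>"])
      (auto simp: perms_cancel perms_def permutes_inverses simp del: atLeastAtMost_iff)
  then have "card {i\<in>{1..d}. w i < r} = card {i\<in>{1..d}. t i < r}" for r
    by (rule bij_betw_same_card)
  then have sums: "(\<Sum>c\<in>col ` {1..d}. L w c r) = (\<Sum>c\<in>col ` {1..d}. L t c r)" for r
    by (simp add: total)
  \<comment> \<open>If column c of t reaches row r, it meets all r rows above it, the maximum for
    distinct rows; otherwise the count for t comprises the whole column.\<close>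
  have le: "L w c r \<le> L t c r" for c r
  proof (cases "\<exists>i\<in>{1..d}. col i = c \<and> r \<le> t i")
    case True
    then obtain i where i: "i \<in> {1..d}" "col i = c" "r \<le> t i" by blast
    have "{..<r} \<subseteq> t ` {i\<in>{1..d}. t i < r \<and> col i = c}"
    proof
      fix s assume "s \<in> {..<r}"
      then obtain j where "j \<in> {1..d}" "col j = c" "t j = s"
        using columns_initial[of i s] i by auto
      then show "s \<in> t ` {i\<in>{1..d}. t i < r \<and> col i = c}" using \<open>s \<in> {..<r}\<close> by auto
    qed
    then have "card {..<r} \<le> card (t ` {i\<in>{1..d}. t i < r \<and> col i = c})"
      by (intro card_mono) auto
    also have "\<dots> \<le> L t c r" unfolding L_def by (rule card_image_le) auto
    finally have "r \<le> L t c r" by simp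
    moreover have "card (w ` {i\<in>{1..d}. w i < r \<and> col i = c}) \<le> card {..<r}"
      by (intro card_mono) auto
    moreover have "inj_on w {i\<in>{1..d}. w i < r \<and> col i = c}"
      using inj by (auto simp: inj_on_def)
    ultimately show ?thesis by (simp add: L_def card_image)
  next
    case False
    then show ?thesis unfolding L_def by (intro card_mono) auto
  qed
  have eq: "L w c r = L t c r" if "c \<in> col ` {1..d}" for c r
    using sum_mono_inv[OF sums, of r c] le that by simp
  have ex: "\<exists>j\<in>{1..d}. col j = col i \<and> t j = w i" if i: "i \<in> {1..d}" for i
  proof (rule ccontr)
    assume *: "\<not> ?thesis"
    \<comment> \<open>Raising the bound from w i to w i + 1 would leave the count for t unchanged,
      while the count for w gains i.\<close>
    have "{j\<in>{1..d}. t j < Suc (w i) \<and> col j = col i} = {j\<in>{1..d}. t j < w i \<and> col j = col i}"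
      using * by (auto simp: less_Suc_eq)
    then have "L w (col i) (Suc (w i)) = L w (col i) (w i)"
      using eq[of "col i"] i by (simp add: L_def)
    moreover have "L w (col i) (w i) < L w (col i) (Suc (w i))"
      unfolding L_def using i by (intro psubset_card_mono) auto
    ultimately show False by simp
  qed
  define \<sigma> where "\<sigma> i = (if i \<in> {1..d} then SOME j. j \<in> {1..d} \<and> col j = col i \<and> t j = w i else i)" for i
  have \<sigma>: "\<sigma> i \<in> {1..d} \<and> col (\<sigma> i) = col i \<and> t (\<sigma> i) = w i" if "i \<in> {1..d}" for i
    unfolding \<sigma>_def if_P[OF that]
    by (rule someI_ex) (use ex[OF that] in blast)
  have "inj_on \<sigma> {1..d}" using \<sigma> inj by (metis (no_types, lifting) inj_onI)
  moreover have "\<sigma> ` {1..d} \<subseteq> {1..d}" using \<sigma> by blast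
  ultimately have "bij_betw \<sigma> {1..d} {1..d}"
    by (simp add: bij_betw_def endo_inj_surj)
  then have "\<sigma> permutes {1..d}" by (rule bij_imp_permutes) (simp only: \<sigma>_def if_False)
  then have "\<sigma> \<in> C" using \<sigma> by (simp add: column_group_def perms_def)
  moreover have "w = t \<circ> \<sigma>"
  proof
    fix i show "w i = (t \<circ> \<sigma>) i"
    proof (cases "i \<in> {1..d}")
      case False
      then have "\<rho> i = i" "\<sigma> i = i" using \<rho> by (auto simp: perms_def permutes_def \<sigma>_def)
      then show ?thesis using \<rho> by simp
    qed (use \<sigma> in auto)
  qed
  ultimately show ?thesis by blast
qed

text \<open>Antisymmetry kills the value at a tabloid having two entries of one column in one row;
  every other tabloid is t moved by C. So the value at t determines g.\<close>

lemma column_antisymmetric_zero: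
  assumes g: "g \<in> supported (tabloids d t)" "g t = 0"
    and anti: "\<And>\<sigma>. \<sigma> \<in> C \<Longrightarrow> act M \<sigma> g = cscale (of_int (sign \<sigma>)) g"
  shows "g = 0"
proof
  fix w
  have val: "g (w \<circ> \<sigma>) = of_int (sign \<sigma>) * g w" if "\<sigma> \<in> C" for \<sigma> w
    using fun_cong[OF anti[OF that], of w] by (simp add: act_M cscale_def)
  consider "w \<notin> tabloids d t" | \<sigma> where "\<sigma> \<in> C" "w = t \<circ> \<sigma>"
    | i j where "i \<in> {1..d}" "j \<in> {1..d}" "w i = w j" "col i = col j" "i \<noteq> j"
    using column_injective_tabloid by blast
  then show "g w = 0 w"
  proof cases
    case 3
    have "transpose i j \<in> C"
      using 3 permutes_swap_id[of i "{1..d}" j]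
      by (auto simp: column_group_def perms_def transpose_def)
    moreover have "w \<circ> transpose i j = w"
      using 3 by (auto simp: fun_eq_iff transpose_def)
    ultimately have "g w = - g w" using val[of "transpose i j" w] 3 by (simp add: sign_swap_id)
    then show ?thesis by simp
  qed (use g val in \<open>auto simp: supported_def\<close>)
qed

lemma delta_t_supported: "delta t \<in> rep_space M"
  using t_in by (auto simp: tabloid_rep_def supported_def delta_def)

lemma e_in_M: "e \<in> rep_space M"
  unfolding spechtgen_def colsum_def
  by (rule gsum_in_subrep[OF M.space_subrep column_group_perms delta_t_supported])

lemma e_t: "e t = 1"
proof -
  have "\<sigma> = id" if "\<sigma> \<in> C" "t \<circ> \<sigma> = t" for \<sigma>
  proof
    fix i show "\<sigma> i = id i"
    proof (cases "i \<in> {1..d}")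
      case True
      then have "\<sigma> i \<in> {1..d}"
        using that(1) permutes_in_image[of \<sigma> "{1..d}" i] by (simp add: column_group_def perms_def)
      moreover have "t (\<sigma> i) = t i" using fun_cong[OF that(2), of i] by simp
      ultimately show ?thesis using row_col_inj[of "\<sigma> i" i] True that(1) by (simp add: column_group_def)
    next
      case False
      then show ?thesis
        using that(1) permutes_not_in[of \<sigma> "{1..d}" i] by (simp add: column_group_def perms_def)
    qed
  qed
  moreover have "id \<in> C" by (simp add: column_group_def id_perms)
  ultimately have *: "{\<sigma>\<in>C. t \<circ> \<sigma> = t} = {id}" by auto
  have "e t = (\<Sum>\<sigma>\<in>C. if t \<circ> \<sigma> = t then of_int (sign \<sigma>) else 0)"
    unfolding spechtgen_def colsum_def gsum_apply
    by (intro sum.cong) (auto simp: delta_def tabloid_rep_def)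
  also have "\<dots> = (\<Sum>\<sigma>\<in>{\<sigma>\<in>C. t \<circ> \<sigma> = t}. of_int (sign \<sigma>))"
    using finite_subset[OF column_group_perms finite_perms] by (simp add: sum.inter_filter)
  finally show ?thesis by (simp add: *)
qed

text \<open>The difference of the two sides is column antisymmetric and vanishes at t because
  \<open>e t = 1\<close>.\<close>

lemma colsum_M:
  assumes "f \<in> rep_space M"
  shows "colsum C M f = cscale (colsum C M f t) e"
proof -
  let ?g = "colsum C M f - cscale (colsum C M f t) e"
  have f: "colsum C M f \<in> rep_space M"
    unfolding colsum_def by (rule gsum_in_subrep[OF M.space_subrep column_group_perms assms])
  have sub: "cfun.subspace (rep_space M)"
    using M.space_subrep by (simp add: subrep_def)
  have "?g = 0"
  proof (rule column_antisymmetric_zero)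
    show "?g \<in> supported (tabloids d t)"
      by (rule subsetD[OF M.space_supported subspaceD(4)[OF sub f subspaceD(3)[OF sub e_in_M]]])
    show "?g t = 0" by (simp add: cscale_def e_t)
    fix \<sigma> assume "\<sigma> \<in> C"
    then show "act M \<sigma> ?g = cscale (of_int (sign \<sigma>)) ?g"
      unfolding clinearD(4)[OF M.clinear_act] clinearD(2)[OF M.clinear_act] spechtgen_def
      using M.act_colsum[of \<sigma> col] by (simp add: cfun.scale_right_diff_distrib mult.commute)
  qed
  then show ?thesis by simp
qed

lemma act_e_in_S: "\<sigma> \<in> perms d \<Longrightarrow> act M \<sigma> e \<in> S"
  unfolding specht_space_def by (auto intro: cfun.span_base)

lemma e_in_S: "e \<in> S"
  using act_e_in_S[OF id_perms] by (simp add: M.act_id)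

lemma subrep_S: "subrep d M S"
  unfolding specht_space_def
proof (rule M.span_subrep)
  show "(\<lambda>\<sigma>. act M \<sigma> e) ` perms d \<subseteq> rep_space M"
    using e_in_M M.space_subrep by (auto simp: subrep_def perms_def)
qed (use act_e_in_S perms_compose in \<open>auto simp: M.perms_actD specht_space_def\<close>)

lemma S_minimal: "subrep d M W \<Longrightarrow> e \<in> W \<Longrightarrow> S \<subseteq> W"
  unfolding specht_space_def
  by (rule cfun.span_minimal) (auto simp: subrep_def perms_def)

text \<open>James's submodule theorem. A nonzero column sum of some w in W is a multiple of e, so W
  contains e and with it S. If all column sums vanish, self-adjointness makes W orthogonal to e and
  its translates, hence to S, hence to itself.\<close>

lemma irreducible_S:
  assumes W: "subrep d M W" "W \<subseteq> S"
  shows "W = {0} \<or> W = S"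
proof (cases "\<exists>w\<in>W. colsum C M w \<noteq> 0")
  case True
  then obtain w where w: "w \<in> W" "colsum C M w \<noteq> 0" by blast
  then have eq: "colsum C M w = cscale (colsum C M w t) e"
    using colsum_M W by (auto simp: subrep_def)
  then have nz: "colsum C M w t \<noteq> 0" using w by (metis cfun.scale_zero_left)
  have "colsum C M w \<in> W"
    unfolding colsum_def by (rule gsum_in_subrep[OF W(1) column_group_perms w(1)])
  then have "cscale (inverse (colsum C M w t)) (colsum C M w) \<in> W"
    using W subspaceD(3) by (auto simp: subrep_def)
  also have "cscale (inverse (colsum C M w t)) (colsum C M w) = e"
    using nz by (subst eq) simp
  finally show ?thesis using S_minimal[OF W(1)] W by blast
next
  case False
  have "w = 0" if w: "w \<in> W" for w
  proof -
    have orth: "cinner (tabloids d t) v e = 0" if "v \<in> W" for v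
    proof -
      have "cinner (tabloids d t) v e = cinner (tabloids d t) (colsum C M v) (delta t)"
        unfolding spechtgen_def by (rule M.cinner_colsum[symmetric])
      then show ?thesis using that False by (simp add: cinner_simps)
    qed
    have "cinner (tabloids d t) w s = 0" if "s \<in> S" for s
    proof -
      have "S \<subseteq> {s. cinner (tabloids d t) w s = 0}"
        unfolding specht_space_def
      proof (rule cfun.span_minimal)
        show "(\<lambda>\<sigma>. act M \<sigma> e) ` perms d \<subseteq> {s. cinner (tabloids d t) w s = 0}"
        proof (safe)
          fix \<sigma> assume \<sigma>: "\<sigma> \<in> perms d"
          have "cinner (tabloids d t) w (act M \<sigma> e) = cnj (cinner (tabloids d t) e (act M (inv \<sigma>) w))"
            using \<sigma> M.cinner_act_left[of \<sigma> e w] by (subst cinner_commute) (simp add: perms_def)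
          moreover have "act M (inv \<sigma>) w \<in> W"
            using w W \<sigma> perms_inv by (auto simp: subrep_def perms_def)
          ultimately show "cinner (tabloids d t) w (act M \<sigma> e) = 0"
            using orth cinner_commute by (metis complex_cnj_zero)
        qed
      qed (auto simp: cfun.subspace_def cinner_simps)
      then show ?thesis using that by blast
    qed
    then show ?thesis
      using supported_cinner_0[OF M.finite_points] w W M.subrep_supported by blast
  qed
  then show ?thesis using W subspaceD(1) by (auto simp: subrep_def)
qed

text \<open>The tabloid t, on which the symmetrizer is easy to evaluate, need not lie in S, but its
  projection s to S has the same image. For the remainder is orthogonal to S, and the adjoint
  operator, row sum after column sum, maps e into S; so the image of the remainder is a multiple of
  e orthogonal to e.\<close>

lemma symmetrizer_S: "symmetrizer C G M ` S = cfun.span {e}"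
proof -
  have in_span: "symmetrizer C G M f \<in> cfun.span {e}" if "f \<in> rep_space M" for f
    using colsum_M[of "rowsum G M f"] gsum_in_subrep[OF M.space_subrep row_group_perms that]
    unfolding symmetrizer_def rowsum_def cfun.span_singleton by blast
  obtain s where s: "s \<in> S" "\<And>b. b \<in> S \<Longrightarrow> cinner (tabloids d t) (delta t - s) b = 0"
    using projection[OF M.finite_points M.subrep_supported[OF subrep_S], of "delta t"] subrep_S
    by (metis subrep_def)
  have sM: "s \<in> rep_space M" using s subrep_S by (auto simp: subrep_def)
  have diff: "delta t - s \<in> rep_space M"
    using sM delta_t_supported M.space_subrep subspaceD(4) by (auto simp: subrep_def)
  obtain k where k: "symmetrizer C G M (delta t - s) = cscale k e"
    using in_span[OF diff] by (auto simp: cfun.span_singleton)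
  have "cinner (tabloids d t) (cscale k e) e =
      cinner (tabloids d t) (delta t - s) (rowsum G M (colsum C M e))"
    unfolding k[symmetric] symmetrizer_def by (simp add: M.cinner_colsum M.cinner_rowsum)
  also have "\<dots> = 0"
    unfolding rowsum_def colsum_def
    by (intro s gsum_in_subrep[OF subrep_S] row_group_perms column_group_perms e_in_S)
  finally have "k = 0 \<or> cinner (tabloids d t) e e = 0" by (simp add: cinner_simps)
  moreover have "cinner (tabloids d t) e e \<noteq> 0"
    using bexI[of "\<lambda>w. e w \<noteq> 0", OF _ t_in] e_t by (simp add: cinner_self_eq_0[OF M.finite_points])
  ultimately have "symmetrizer C G M (delta t - s) = 0" using k by simp
  then have "symmetrizer C G M s = symmetrizer C G M (delta t)"
    by (simp add: clinearD[OF clinear_symmetrizer])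
  also have "rowsum G M (delta t) = cscale (of_nat (card G)) (delta t)"
  proof
    fix w
    have "w \<circ> \<sigma> = t \<longleftrightarrow> w = t" if "\<sigma> \<in> G" for \<sigma>
      using that perms_cancel(5)[of \<sigma> d w] row_group_inv[OF that]
      by (auto simp: row_group_def)
    then have "rowsum G M (delta t) w = (\<Sum>\<sigma>\<in>G. delta t w)"
      unfolding rowsum_def gsum_apply by (intro sum.cong) (auto simp: tabloid_rep_def delta_def)
    then show "rowsum G M (delta t) w = cscale (of_nat (card G)) (delta t) w"
      by (simp add: cscale_def)
  qed
  then have "symmetrizer C G M (delta t) = cscale (of_nat (card G)) e"
    unfolding symmetrizer_def spechtgen_def by (simp add: colsum_def clinearD[OF clinear_gsum])
  finally have s_eq: "symmetrizer C G M s = cscale (of_nat (card G)) e" .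
  have "card G \<noteq> 0"
    using finite_subset[OF row_group_perms finite_perms, of d t] id_perms
    by (auto simp: row_group_def intro!: exI[of _ id])
  then have "cscale c e = symmetrizer C G M (cscale (c / of_nat (card G)) s)" for c
    by (simp add: clinearD[OF clinear_symmetrizer] s_eq)
  moreover have "cscale (c / of_nat (card G)) s \<in> S" for c
    using s subrep_S subspaceD(3) by (auto simp: subrep_def)
  ultimately have "cscale c e \<in> symmetrizer C G M ` S" for c by (metis imageI)
  then have "cfun.span {e} \<subseteq> symmetrizer C G M ` S"
    by (simp add: cfun.span_singleton image_subset_iff)
  moreover have "symmetrizer C G M ` S \<subseteq> cfun.span {e}"
    using in_span subrep_S unfolding subrep_def by blast
  ultimately show ?thesis by (rule subset_antisym[rotated])
qed

lemma rep_iso_symmetrizer_image: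
  assumes "rep_iso d (M\<lparr>rep_space := S\<rparr>) (R\<lparr>rep_space := U\<rparr>)"
  shows "\<exists>y\<in>U. y \<noteq> 0 \<and> symmetrizer C G R ` U = cfun.span {y}"
proof -
  obtain \<phi> where bij: "bij_betw \<phi> S U" and
    "intertwines d S (M\<lparr>rep_space := S\<rparr>) (R\<lparr>rep_space := U\<rparr>) \<phi>"
    using assms by (auto simp: rep_iso_def intertwines_def perms_def)
  then have \<phi>: "intertwines d S M R \<phi>"
    by (auto simp: intertwines_def act_def)
  have scale: "\<phi> (cscale c u) = cscale c (\<phi> u)" if "u \<in> S" for c u
    using \<phi> that by (simp add: intertwines_def)
  have zero: "\<phi> 0 = 0"
    using scale[OF e_in_S, of 0] unfolding cfun.scale_zero_left .
  have "e \<noteq> 0" using e_t by (metis zero_fun_apply zero_neq_one)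
  moreover have "0 \<in> S" using subrep_S subspaceD(1) by (auto simp: subrep_def)
  ultimately have "\<phi> e \<noteq> 0"
    using bij e_in_S zero by (metis bij_betw_inv_into_left)
  moreover have "\<phi> e \<in> U" using bij e_in_S by (auto simp: bij_betw_def)
  moreover have "symmetrizer C G R ` U = \<phi> ` symmetrizer C G M ` S"
  proof -
    have "symmetrizer C G R ` U = (\<lambda>u. symmetrizer C G R (\<phi> u)) ` S"
      using bij by (auto simp: bij_betw_def)
    also have "\<dots> = (\<lambda>u. \<phi> (symmetrizer C G M u)) ` S"
      using symmetrizer_intertwines[OF \<phi> subrep_S column_group_perms row_group_perms]
      by (intro image_cong) auto
    finally show ?thesis by (simp add: image_image)
  qed
  then have "symmetrizer C G R ` U = cfun.span {\<phi> e}"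
    unfolding symmetrizer_S by (simp add: cfun.span_singleton image_image scale[OF e_in_S])
  ultimately show ?thesis by blast
qed

text \<open>A vector not killed by the symmetrizer is the image of the generator under a homomorphism
  from the tabloid module, which Schur's lemma turns into an isomorphism on the Specht module.\<close>

lemma symmetrizer_nonzero_imp_iso:
  assumes R: "function_rep d R X" and U: "irreducible_subrep d R U"
    and u: "u \<in> U" "symmetrizer C G R u \<noteq> 0"
  shows "rep_iso d (M\<lparr>rep_space := S\<rparr>) (R\<lparr>rep_space := U\<rparr>)"
proof -
  interpret R: function_rep d R X by fact
  have Us: "subrep d R U" "cfun.subspace U" using U by (auto simp: irreducible_subrep_def subrep_def)
  \<comment> \<open>Each tabloid is met once for every element of a coset of the row group, so the
    tabloid t goes to the row sum of u, and translates of t to translates of that row sum.\<close>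
  define \<phi> where "\<phi> f = (\<Sum>\<tau>\<in>perms d. cscale (f (t \<circ> inv \<tau>)) (act R \<tau> u))" for f
  have lin: "clinear \<phi>"
    by (rule clinearI)
      (auto simp: \<phi>_def fun_eq_iff sum_fun_apply cscale_def algebra_simps sum.distrib sum_distrib_left)
  have \<phi>U: "\<phi> f \<in> U" for f
    unfolding \<phi>_def using Us u
    by (intro cfun.subspace_sum subspaceD) (auto simp: subrep_def perms_def)
  have equi: "\<phi> (act M \<sigma> f) = act R \<sigma> (\<phi> f)" if \<sigma>: "\<sigma> \<in> perms d" for \<sigma> f
  proof -
    have "\<phi> (act M \<sigma> f) = (\<Sum>\<tau>\<in>perms d. cscale (f (t \<circ> inv \<tau> \<circ> \<sigma>)) (act R \<tau> u))"
      by (simp add: \<phi>_def act_M)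
    also have "\<dots> = (\<Sum>\<tau>\<in>perms d. cscale (f (t \<circ> inv (\<sigma> \<circ> \<tau>) \<circ> \<sigma>)) (act R (\<sigma> \<circ> \<tau>) u))"
      by (rule sum.reindex_bij_betw[OF bij_betw_perms_compose[OF \<sigma> subset_refl], symmetric])
        (use \<sigma> perms_compose perms_inv in auto)
    also have "\<dots> = (\<Sum>\<tau>\<in>perms d. cscale (f (t \<circ> inv \<tau>)) (act R \<sigma> (act R \<tau> u)))"
    proof (rule sum.cong[OF refl])
      fix \<tau> assume \<tau>: "\<tau> \<in> perms d"
      have "inv (\<sigma> \<circ> \<tau>) = inv \<tau> \<circ> inv \<sigma>"
        using \<sigma> \<tau> by (intro o_inv_distrib permutes_bij) (auto simp: perms_def)
      then have "t \<circ> inv (\<sigma> \<circ> \<tau>) \<circ> \<sigma> = t \<circ> inv \<tau>"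
        using perms_cancel(6)[OF \<sigma>, of "t \<circ> inv \<tau>"] by (simp add: comp_assoc)
      then show "cscale (f (t \<circ> inv (\<sigma> \<circ> \<tau>) \<circ> \<sigma>)) (act R (\<sigma> \<circ> \<tau>) u) =
          cscale (f (t \<circ> inv \<tau>)) (act R \<sigma> (act R \<tau> u))"
        using R.perms_actD[OF \<sigma> \<tau>] by simp
    qed
    finally show ?thesis by (simp add: \<phi>_def clinearD[OF R.clinear_act])
  qed
  have "\<phi> (delta t) = (\<Sum>\<tau>\<in>perms d. if t \<circ> \<tau> = t then act R \<tau> u else 0)"
    unfolding \<phi>_def
  proof (rule sum.cong[OF refl])
    fix \<tau> assume \<tau>: "\<tau> \<in> perms d"
    have "t \<circ> inv \<tau> = t \<longleftrightarrow> t \<circ> \<tau> = t"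
      using perms_cancel(5)[OF \<tau>, of t] perms_cancel(6)[OF \<tau>, of t] by metis
    then show "cscale (delta t (t \<circ> inv \<tau>)) (act R \<tau> u) = (if t \<circ> \<tau> = t then act R \<tau> u else 0)"
      by (simp add: delta_def)
  qed
  also have "\<dots> = rowsum G R u"
    unfolding rowsum_def gsum_def row_group_def
    by (simp add: finite_perms sum.inter_filter)
  finally have \<phi>t: "\<phi> (delta t) = rowsum G R u" .
  have inter: "intertwines d W M R \<phi>" for W
    using clinear_intertwines[OF lin equi] .
  have "\<phi> e = symmetrizer C G R u"
    unfolding spechtgen_def symmetrizer_def colsum_def
    using gsum_intertwines[OF inter M.space_subrep column_group_perms delta_t_supported] \<phi>t by simp
  then have \<phi>e: "\<phi> e \<noteq> 0" using u by simp
  \<comment> \<open>Schur's lemma, first half: the kernel on S is a subrepresentation that misses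
    e.\<close>
  define K where "K = {s\<in>S. \<phi> s = 0}"
  have "subrep d M K"
    unfolding subrep_def
  proof (intro conjI allI impI ballI)
    show "cfun.subspace K"
      using subrep_S unfolding subrep_def
      by (auto simp: cfun.subspace_def K_def clinearD[OF lin])
    show "K \<subseteq> rep_space M" using subrep_S by (auto simp: subrep_def K_def)
    fix \<sigma> k assume "\<sigma> permutes {1..d}" "k \<in> K"
    then show "act M \<sigma> k \<in> K"
      using subrep_S equi[of \<sigma> k] clinearD(3)[OF R.clinear_act, of \<sigma>]
      by (auto simp: K_def perms_def subrep_def)
  qed
  then have "K = {0}" using irreducible_S[of K] \<phi>e e_in_S by (auto simp: K_def)
  then have ker: "s = 0" if "s \<in> S" "\<phi> s = 0" for s using that by (auto simp: K_def)
  have sub_S: "cfun.subspace S" using subrep_S by (simp add: subrep_def)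
  have inj: "inj_on \<phi> S"
    by (rule clinear_inj_on[OF lin sub_S ker])
  have "subrep d R (\<phi> ` S)"
    unfolding subrep_def
  proof (intro conjI allI impI)
    show "cfun.subspace (\<phi> ` S)" using clinear_subspace_image[OF lin sub_S] .
    show "\<phi> ` S \<subseteq> rep_space R" using \<phi>U Us by (auto simp: subrep_def)
    fix \<sigma> assume "\<sigma> permutes {1..d}"
    then show "\<forall>u\<in>\<phi> ` S. act R \<sigma> u \<in> \<phi> ` S"
      using subrep_S by (auto simp: subrep_def perms_def equi[symmetric])
  qed
  moreover have "\<phi> ` S \<subseteq> U" using \<phi>U by blast
  moreover have "\<phi> ` S \<noteq> {0}" using \<phi>e e_in_S by blast
  ultimately have "\<phi> ` S = U" using U unfolding irreducible_subrep_def by blast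
  with inj have "bij_betw \<phi> S U" by (simp add: bij_betw_def)
  then show ?thesis
    using inter[of S] unfolding rep_iso_def
    by (intro exI[of _ \<phi>]) (auto simp: intertwines_def perms_def act_def)
qed

text \<open>The symmetrizer maps each summand isomorphic to S onto a line and kills the others; in a
  direct sum these lines are independent, and together they span the image. The dimension does not
  mention the decomposition, so the \<open>THE\<close> in \<open>multiplicity_in\<close> is
  justified at the same time.\<close>

theorem multiplicity_eq_dim:
  assumes R: "function_rep d R X"
  shows "multiplicity_in d (M\<lparr>rep_space := S\<rparr>) R = cfun.dim (symmetrizer C G R ` rep_space R)"
proof -
  interpret R: function_rep d R X by fact
  let ?Y = "symmetrizer C G R"
  have main: "card {U \<in> \<U>. rep_iso d (M\<lparr>rep_space := S\<rparr>) (R\<lparr>rep_space := U\<rparr>)} =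
      cfun.dim (?Y ` rep_space R)" if \<U>: "irreducible_decomposition d R \<U>" for \<U>
  proof -
    define I where "I = {U \<in> \<U>. rep_iso d (M\<lparr>rep_space := S\<rparr>) (R\<lparr>rep_space := U\<rparr>)}"
    have fin: "finite \<U>" "finite I" using \<U> by (auto simp: irreducible_decomposition_def I_def)
    have irr: "irreducible_subrep d R U" if "U \<in> \<U>" for U
      using \<U> that by (simp add: irreducible_decomposition_def)
    have sub: "subrep d R U" "cfun.subspace U" "U \<subseteq> rep_space R" if "U \<in> \<U>" for U
      using irr[OF that] by (auto simp: irreducible_subrep_def subrep_def)
    have spaceR: "cfun.subspace (rep_space R)" using R.space_subrep by (simp add: subrep_def)
    have ex: "\<exists>f. (\<forall>U\<in>\<U>. f U \<in> U) \<and> v = (\<Sum>U\<in>\<U>. f U)" if "v \<in> rep_space R" for v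
    proof -
      obtain f where "f \<in> (\<Pi>\<^sub>E U\<in>\<U>. U)" "v = (\<Sum>U\<in>\<U>. f U)"
        using \<U> \<open>v \<in> rep_space R\<close> unfolding irreducible_decomposition_def by metis
      then show ?thesis by (intro exI[of _ f]) auto
    qed
    have uniq: "f U = 0" if f: "\<forall>U\<in>\<U>. f U \<in> U" "(\<Sum>U\<in>\<U>. f U) = 0" and "U \<in> \<U>" for f U
    proof -
      let ?f = "restrict f \<U>" and ?z = "restrict (\<lambda>_. 0) \<U>"
      have "?f \<in> (\<Pi>\<^sub>E U\<in>\<U>. U)" "0 = (\<Sum>U\<in>\<U>. ?f U)" using f by auto
      moreover have "?z \<in> (\<Pi>\<^sub>E U\<in>\<U>. U)" "0 = (\<Sum>U\<in>\<U>. ?z U)"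
        using subspaceD(1)[OF sub(2)] by auto
      moreover have "\<exists>!f. f \<in> (\<Pi>\<^sub>E U\<in>\<U>. U) \<and> 0 = (\<Sum>U\<in>\<U>. f U)"
        using \<U> subspaceD(1)[OF spaceR] unfolding irreducible_decomposition_def by blast
      ultimately have "?f = ?z" by blast
      from fun_cong[OF this, of U] show ?thesis using \<open>U \<in> \<U>\<close> by simp
    qed
    have "\<forall>U\<in>I. \<exists>y. y \<in> U \<and> y \<noteq> 0 \<and> ?Y ` U = cfun.span {y}"
    proof
      fix U assume "U \<in> I"
      then have "rep_iso d (M\<lparr>rep_space := S\<rparr>) (R\<lparr>rep_space := U\<rparr>)" by (simp add: I_def)
      from rep_iso_symmetrizer_image[OF this]
      show "\<exists>y. y \<in> U \<and> y \<noteq> 0 \<and> ?Y ` U = cfun.span {y}" by (simp add: Bex_def)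
    qed
    then obtain y where y: "\<And>U. U \<in> I \<Longrightarrow> y U \<in> U \<and> y U \<noteq> 0 \<and> ?Y ` U = cfun.span {y U}"
      by metis
    have killed: "?Y u = 0" if "u \<in> U" "U \<in> \<U>" "U \<notin> I" for u U
      using symmetrizer_nonzero_imp_iso[OF R irr that(1)] that by (auto simp: I_def)
    have coeffs: "c U = 0" if "(\<Sum>U\<in>I. cscale (c U) (y U)) = 0" "U \<in> I" for c U
    proof -
      \<comment> \<open>A relation among the vectors y U is extended by 0 to all summands, where
        uniqueness of components applies.\<close>
      let ?f = "\<lambda>U. if U \<in> I then cscale (c U) (y U) else 0"
      have "(\<Sum>U\<in>\<U>. ?f U) = (\<Sum>U\<in>I. cscale (c U) (y U))"
        using fin by (simp add: sum.If_cases I_def Int_def conj_ac cong: if_cong)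
      moreover have "\<forall>U\<in>\<U>. ?f U \<in> U"
        using y subspaceD(1,3)[OF sub(2)] by auto
      ultimately have "?f U = 0" using uniq[of ?f U] that by (auto simp: I_def)
      then show ?thesis using y that by simp
    qed
    have inj: "inj_on y I"
    proof (rule inj_onI, rule ccontr)
      fix U V assume UV: "U \<in> I" "V \<in> I" "y U = y V" "U \<noteq> V"
      \<comment> \<open>Coinciding vectors would satisfy a relation with coefficients 1 and -1;
        excluding this lets the dimension count summands.\<close>
      let ?c = "\<lambda>W. if W = U then 1 else if W = V then -1 else (0::complex)"
      have "(\<Sum>W\<in>I. cscale (?c W) (y W)) =
          (\<Sum>W\<in>I. (if W = U then y U else 0) - (if W = V then y V else 0))"
        using UV by (intro sum.cong) auto
      also have "\<dots> = 0" using fin UV by (simp add: sum_subtractf)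
      finally show False using coeffs[of ?c U] UV by simp
    qed
    have "cfun.independent (y ` I)"
    proof (rule cfun.independent_if_scalars_zero)
      show "finite (y ` I)" using fin by simp
      fix c v assume "(\<Sum>v\<in>y ` I. cscale (c v) v) = 0" "v \<in> y ` I"
      then show "c v = 0"
        using coeffs[of "\<lambda>U. c (y U)"] by (auto simp: sum.reindex[OF inj])
    qed
    moreover have "cfun.span (y ` I) = ?Y ` rep_space R"
    proof (rule subset_antisym)
      have "y U \<in> ?Y ` rep_space R" if "U \<in> I" for U
      proof -
        have "y U \<in> ?Y ` U" using y[OF that] cfun.span_base[of "y U" "{y U}"] by simp
        moreover have "U \<subseteq> rep_space R" using that sub(3) by (simp add: I_def)
        ultimately show ?thesis by blast
      qed
      then show "cfun.span (y ` I) \<subseteq> ?Y ` rep_space R"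
        by (intro cfun.span_minimal clinear_subspace_image[OF clinear_symmetrizer spaceR]) blast
      show "?Y ` rep_space R \<subseteq> cfun.span (y ` I)"
      proof safe
        fix v assume "v \<in> rep_space R"
        then obtain f where f: "\<forall>U\<in>\<U>. f U \<in> U" "v = (\<Sum>U\<in>\<U>. f U)" using ex by blast
        have "?Y (f U) \<in> cfun.span (y ` I)" if "U \<in> \<U>" for U
        proof (cases "U \<in> I")
          case True
          then have "?Y (f U) \<in> cfun.span {y U}" using y f that by blast
          also have "\<dots> \<subseteq> cfun.span (y ` I)" using True by (intro cfun.span_mono) auto
          finally show ?thesis .
        next
          case False
          then show ?thesis using killed[OF bspec[OF f(1) that] that] cfun.span_zero by simp
        qed
        then show "?Y v \<in> cfun.span (y ` I)"
          unfolding f(2) clinearD(5)[OF clinear_symmetrizer] by (rule cfun.span_sum)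
      qed
    qed
    ultimately have "cfun.dim (?Y ` rep_space R) = card (y ` I)"
      by (metis cfun.dim_span_eq_card_independent)
    then show ?thesis using card_image[OF inj] by (simp add: I_def)
  qed
  obtain \<U> where "irreducible_decomposition d R \<U>" using R.ex_irreducible_decomposition by blast
  then show ?thesis
    unfolding multiplicity_in_def using main
    by (intro the_equality) (auto intro!: exI[of _ \<U>])
qed

end

section \<open>Specht modules of partitions\<close>

lemma young_diagram_Sigma: "young_diagram \<alpha> = (SIGMA r:{..<length \<alpha>}. {..<\<alpha> ! r})"
  by (auto simp: young_diagram_def)

lemma finite_young_diagram: "finite (young_diagram \<alpha>)"
  by (simp add: young_diagram_Sigma)

lemma card_young_diagram: "card (young_diagram \<alpha>) = sum_list \<alpha>"
  by (simp add: young_diagram_Sigma sum_list_sum_nth atLeast0LessThan)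

lemma ex_tableau: "\<exists>T. T \<in> tableaux \<alpha>"
  using finite_same_card_bij[OF finite_young_diagram[of \<alpha>], of "{1..sum_list \<alpha>}"]
  by (auto simp: tableaux_def card_young_diagram)

text \<open>\<open>sorted_wrt\<close> in place of \<open>is_partition\<close> admits zero parts:
  \<open>padded [] 0\<close> is \<open>[0]\<close>, and it occurs as the smallest padded shape of
  the empty partition.\<close>

locale tableau =
  fixes \<alpha> :: "nat list" and T :: "nat \<times> nat \<Rightarrow> nat"
  assumes sorted: "sorted_wrt (\<ge>) \<alpha>" and T: "T \<in> tableaux \<alpha>"
begin

abbreviation "d \<equiv> sum_list \<alpha>"
abbreviation "D \<equiv> young_diagram \<alpha>"
definition "pos i = the_inv_into D T i"
definition "col i = snd (pos i)"
abbreviation "t \<equiv> tabloid \<alpha> T"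

lemma bij: "bij_betw T D {1..d}"
  using T by (simp add: tableaux_def)

lemma pos_T: "x \<in> D \<Longrightarrow> pos (T x) = x"
  using bij by (simp add: pos_def bij_betw_def the_inv_into_f_f)

lemma T_in: "x \<in> D \<Longrightarrow> T x \<in> {1..d}"
  using bij by (auto simp: bij_betw_def)

lemma pos_in: "i \<in> {1..d} \<Longrightarrow> pos i \<in> D \<and> T (pos i) = i"
  using bij unfolding bij_betw_def
  by (metis f_the_inv_into_f pos_def the_inv_into_into order_refl)

lemma t_eq: "t i = (if i \<in> {1..d} then fst (pos i) else 0)"
  by (simp add: tabloid_def pos_def)

lemma t_col_T: "(r, c) \<in> D \<Longrightarrow> t (T (r, c)) = r \<and> col (T (r, c)) = c"
  using T_in[of "(r, c)"] pos_T[of "(r, c)"] unfolding t_eq col_def by simp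

sublocale young d t col
proof
  show "t i = 0" if "i \<notin> {1..d}" for i using that unfolding t_eq by (simp only: if_False)
  show "i = j" if "i \<in> {1..d}" "j \<in> {1..d}" "t i = t j" "col i = col j" for i j
    using that pos_in[of i] pos_in[of j] unfolding t_eq col_def by (metis prod_eqI)
  fix i r assume i: "i \<in> {1..d}" and r: "r < t i"
  obtain r0 c where p: "pos i = (r0, c)" by force
  then have "(r0, c) \<in> D" "r < r0" "col i = c" using pos_in[OF i] r i unfolding t_eq col_def by auto
  then have "(r, c) \<in> D"
    using sorted_wrt_nth_less[OF sorted, of r r0] by (auto simp: young_diagram_def)
  then show "\<exists>j\<in>{1..d}. col j = col i \<and> t j = r"
    using t_col_T[of r c] T_in \<open>col i = c\<close> by blast
qed

lemma tabloid_compose: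
  assumes "\<sigma> \<in> perms d"
  shows "tabloid \<alpha> (\<sigma> \<circ> T) = t \<circ> inv \<sigma>"
proof
  fix i
  have \<sigma>: "\<sigma> permutes {1..d}" using assms by (simp add: perms_def)
  have iff: "inv \<sigma> i \<in> {1..d} \<longleftrightarrow> i \<in> {1..d}" for i
    using permutes_in_image[OF permutes_inv[OF \<sigma>]] .
  have "the_inv_into D (\<sigma> \<circ> T) i = pos (inv \<sigma> i)" if "i \<in> {1..d}"
  proof (rule the_inv_into_f_eq)
    show "inj_on (\<sigma> \<circ> T) D"
      using bij permutes_inj_on[OF \<sigma>] by (auto simp: bij_betw_def intro: comp_inj_on)
    show "(\<sigma> \<circ> T) (pos (inv \<sigma> i)) = i" "pos (inv \<sigma> i) \<in> D"
      using pos_in[of "inv \<sigma> i"] iff[of i] that perms_cancel(1)[OF assms] by auto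
  qed
  then show "tabloid \<alpha> (\<sigma> \<circ> T) i = (t \<circ> inv \<sigma>) i"
    using iff[of i] unfolding comp_apply t_eq by (simp add: tabloid_def comp_def)
qed

lemma column_stabilizer_eq: "column_stabilizer \<alpha> T = C"
proof -
  have "(\<forall>(r, c)\<in>D. \<exists>r'. (r', c) \<in> D \<and> \<sigma> (T (r, c)) = T (r', c)) \<longleftrightarrow>
      (\<forall>i\<in>{1..d}. col (\<sigma> i) = col i)" if "\<sigma> permutes {1..d}" for \<sigma>
  proof (intro iffI ballI)
    fix i assume *: "\<forall>(r, c)\<in>D. \<exists>r'. (r', c) \<in> D \<and> \<sigma> (T (r, c)) = T (r', c)" and i: "i \<in> {1..d}"
    obtain r c where "pos i = (r, c)" by force
    then have "(r, c) \<in> D" "T (r, c) = i" using pos_in[OF i] by auto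
    then obtain r' where "(r', c) \<in> D" "\<sigma> i = T (r', c)" using * by blast
    then show "col (\<sigma> i) = col i" using t_col_T \<open>(r, c) \<in> D\<close> \<open>T (r, c) = i\<close> by metis
  next
    fix x assume *: "\<forall>i\<in>{1..d}. col (\<sigma> i) = col i" and x: "x \<in> D"
    obtain r c where rc: "x = (r, c)" by force
    have \<sigma>: "\<sigma> (T x) \<in> {1..d}" using T_in[OF x] permutes_in_image[OF that] by blast
    obtain r' c' where rc': "pos (\<sigma> (T x)) = (r', c')" by force
    have "col (\<sigma> (T x)) = col (T x)" using * T_in[OF x] by (rule bspec)
    also have "\<dots> = c" using t_col_T x unfolding rc by blast
    finally have "c' = c" unfolding col_def rc' by simp
    then have "(r', c) \<in> D \<and> \<sigma> (T (r, c)) = T (r', c)" using pos_in[OF \<sigma>] unfolding rc'[unfolded rc] rc by simp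
    then show "case x of (r, c) \<Rightarrow> \<exists>r'. (r', c) \<in> D \<and> \<sigma> (T (r, c)) = T (r', c)"
      unfolding rc prod.case by (rule exI)
  qed
  then show ?thesis
    unfolding column_stabilizer_def column_group_def perms_def by blast
qed

text \<open>The column stabilizer of the moved tableau is a conjugate of that of T, and conjugation
  preserves signs. So every polytabloid is a translate of the generator e.\<close>

lemma polytabloid_apply:
  assumes "\<sigma> \<in> perms d"
  shows "polytabloid \<alpha> (\<sigma> \<circ> T) = act M \<sigma> e"
proof
  fix w
  have "inv \<sigma> y = b \<longleftrightarrow> y = \<sigma> b" for y b using perms_cancel(1,2)[OF assms] by metis
  moreover have "inv \<sigma> \<circ> \<tau> \<circ> \<sigma> \<in> perms d \<longleftrightarrow> \<tau> \<in> perms d" for \<tau>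
  proof
    assume "inv \<sigma> \<circ> \<tau> \<circ> \<sigma> \<in> perms d"
    then have "\<sigma> \<circ> (inv \<sigma> \<circ> \<tau> \<circ> \<sigma>) \<circ> inv \<sigma> \<in> perms d"
      using assms perms_compose perms_inv by blast
    also have "\<sigma> \<circ> (inv \<sigma> \<circ> \<tau> \<circ> \<sigma>) \<circ> inv \<sigma> = \<tau>" by (simp add: fun_eq_iff perms_cancel[OF assms])
    finally show "\<tau> \<in> perms d" .
  qed (use assms perms_compose perms_inv in blast)
  ultimately have mem: "\<tau> \<in> column_stabilizer \<alpha> (\<sigma> \<circ> T) \<longleftrightarrow> inv \<sigma> \<circ> \<tau> \<circ> \<sigma> \<in> C" for \<tau>
    unfolding column_stabilizer_eq[symmetric] by (simp add: column_stabilizer_def perms_def)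
  have conj: "bij_betw (\<lambda>\<tau>. \<sigma> \<circ> \<tau> \<circ> inv \<sigma>) C (column_stabilizer \<alpha> (\<sigma> \<circ> T))"
  proof (rule bij_betwI[of _ _ _ "\<lambda>\<tau>. inv \<sigma> \<circ> \<tau> \<circ> \<sigma>"])
    have "inv \<sigma> \<circ> (\<sigma> \<circ> \<tau> \<circ> inv \<sigma>) \<circ> \<sigma> = \<tau>" for \<tau> :: "nat \<Rightarrow> nat"
      by (simp add: fun_eq_iff perms_cancel[OF assms])
    then show "(\<lambda>\<tau>. \<sigma> \<circ> \<tau> \<circ> inv \<sigma>) \<in> C \<rightarrow> column_stabilizer \<alpha> (\<sigma> \<circ> T)" by (simp add: mem)
  qed (auto simp: fun_eq_iff perms_cancel[OF assms] mem)
  have "polytabloid \<alpha> (\<sigma> \<circ> T) w = (\<Sum>\<tau>\<in>C. of_int (sign (\<sigma> \<circ> \<tau> \<circ> inv \<sigma>)) *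
      (if w = tabloid \<alpha> (\<sigma> \<circ> \<tau> \<circ> inv \<sigma> \<circ> (\<sigma> \<circ> T)) then 1 else 0))"
    unfolding polytabloid_def
    by (rule sum.reindex_bij_betw[OF conj, symmetric])
  also have "\<dots> = (\<Sum>\<tau>\<in>C. of_int (sign \<tau>) * delta t (w \<circ> \<sigma> \<circ> \<tau>))"
  proof (rule sum.cong[OF refl])
    fix \<tau> assume "\<tau> \<in> C"
    then have \<tau>: "\<tau> \<in> perms d" using column_group_perms by blast
    have "sign (\<sigma> \<circ> \<tau> \<circ> inv \<sigma>) = sign \<sigma> * sign \<tau> * sign \<sigma>"
      using perms_sign(1)[OF perms_compose[OF assms \<tau>] perms_inv[OF assms]]
        perms_sign(1)[OF assms \<tau>] perms_sign(2)[OF assms] by simp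
    then have sgn: "sign (\<sigma> \<circ> \<tau> \<circ> inv \<sigma>) = sign \<tau>"
      by (simp add: mult.commute mult.left_commute)
    have "\<sigma> \<circ> \<tau> \<circ> inv \<sigma> \<circ> (\<sigma> \<circ> T) = \<sigma> \<circ> \<tau> \<circ> T" by (simp add: comp_assoc perms_cancel[OF assms])
    then have "tabloid \<alpha> (\<sigma> \<circ> \<tau> \<circ> inv \<sigma> \<circ> (\<sigma> \<circ> T)) = t \<circ> inv (\<sigma> \<circ> \<tau>)"
      using tabloid_compose[OF perms_compose[OF assms \<tau>]] by simp
    moreover have "w = t \<circ> inv (\<sigma> \<circ> \<tau>) \<longleftrightarrow> w \<circ> \<sigma> \<circ> \<tau> = t"
      using perms_cancel(5,6)[OF perms_compose[OF assms \<tau>]] by (metis comp_assoc)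
    ultimately show "of_int (sign (\<sigma> \<circ> \<tau> \<circ> inv \<sigma>)) *
        (if w = tabloid \<alpha> (\<sigma> \<circ> \<tau> \<circ> inv \<sigma> \<circ> (\<sigma> \<circ> T)) then 1 else 0) =
        complex_of_int (sign \<tau>) * delta t (w \<circ> \<sigma> \<circ> \<tau>)"
      using sgn by (simp add: delta_def)
  qed
  also have "\<dots> = act M \<sigma> e w"
    by (simp add: act_M spechtgen_def colsum_def gsum_apply) (simp add: tabloid_rep_def)
  finally show "polytabloid \<alpha> (\<sigma> \<circ> T) w = act M \<sigma> e w" .
qed

text \<open>Tableaux are total functions constrained on the diagram only; an arbitrary tableau
  agrees there with T followed by a permutation, but perhaps not elsewhere.\<close>

lemma polytabloid_cong:
  assumes "\<And>x. x \<in> D \<Longrightarrow> T' x = T'' x"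
  shows "polytabloid \<alpha> T' = polytabloid \<alpha> T''"
proof -
  have "the_inv_into D (\<sigma> \<circ> T') = the_inv_into D (\<sigma> \<circ> T'')" for \<sigma> :: "nat \<Rightarrow> nat"
    unfolding the_inv_into_def fun_eq_iff comp_def
    by (intro allI arg_cong[where f = The] ext) (use assms in auto)
  then have "tabloid \<alpha> (\<sigma> \<circ> T') = tabloid \<alpha> (\<sigma> \<circ> T'')" for \<sigma> :: "nat \<Rightarrow> nat"
    unfolding tabloid_def by (simp only:)
  moreover have "column_stabilizer \<alpha> T' = column_stabilizer \<alpha> T''"
    using assms unfolding column_stabilizer_def by fastforce
  ultimately show ?thesis by (simp add: polytabloid_def)
qed

lemma specht_eq: "specht \<alpha> = M\<lparr>rep_space := S\<rparr>"
proof -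
  have "polytabloid \<alpha> ` tableaux \<alpha> = (\<lambda>\<sigma>. act M \<sigma> e) ` perms d"
  proof (intro subset_antisym subsetI)
    fix f assume "f \<in> polytabloid \<alpha> ` tableaux \<alpha>"
    then obtain T' where T': "bij_betw T' D {1..d}" "f = polytabloid \<alpha> T'"
      by (auto simp: tableaux_def)
    \<comment> \<open>The permutation carrying T to T': find the cell of i in T and take the entry
      of T' there.\<close>
    define \<sigma> where "\<sigma> i = (if i \<in> {1..d} then T' (pos i) else i)" for i
    have "bij_betw pos {1..d} D"
      using bij by (simp add: pos_def[abs_def] bij_betw_the_inv_into)
    then have "bij_betw (T' \<circ> pos) {1..d} {1..d}" using T' bij_betw_trans by blast
    then have "bij_betw \<sigma> {1..d} {1..d}"
      by (rule bij_betw_cong[THEN iffD1, rotated]) (simp add: \<sigma>_def)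
    then have \<sigma>: "\<sigma> \<in> perms d"
      unfolding perms_def mem_Collect_eq by (rule bij_imp_permutes) (simp only: \<sigma>_def if_False)
    have "T' x = (\<sigma> \<circ> T) x" if "x \<in> D" for x
      using T_in[OF that] pos_T[OF that] by (simp add: \<sigma>_def)
    then have "f = act M \<sigma> e"
      using polytabloid_cong polytabloid_apply[OF \<sigma>] T' by metis
    then show "f \<in> (\<lambda>\<sigma>. act M \<sigma> e) ` perms d" using \<sigma> by blast
  next
    fix f assume "f \<in> (\<lambda>\<sigma>. act M \<sigma> e) ` perms d"
    then obtain \<sigma> where \<sigma>: "\<sigma> \<in> perms d" "f = polytabloid \<alpha> (\<sigma> \<circ> T)"
      using polytabloid_apply by auto
    moreover have "bij_betw (\<sigma> \<circ> T) D {1..d}"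
      using bij \<sigma> by (intro bij_betw_trans[OF bij] permutes_imp_bij) (simp add: perms_def)
    ultimately show "f \<in> polytabloid \<alpha> ` tableaux \<alpha>" by (auto simp: tableaux_def)
  qed
  then show ?thesis by (simp add: specht_def specht_space_def tabloid_rep_def)
qed

lemma function_rep_specht: "function_rep d (specht \<alpha>) (tabloids d t)"
  unfolding specht_eq by (rule M.restrict_space[OF subrep_S])

end

section \<open>Tensor products\<close>

definition tensor_fun :: "('x \<Rightarrow> complex) \<Rightarrow> ('y \<Rightarrow> complex) \<Rightarrow> 'x \<times> 'y \<Rightarrow> complex" where
  "tensor_fun f g = (\<lambda>(x, y). f x * g y)"

lemma clinear_tensor_fun: "clinear (tensor_fun f)" "clinear (\<lambda>f. tensor_fun f g)"
  by (auto simp: clinear_def tensor_fun_def cscale_def fun_eq_iff algebra_simps)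

lemma tensor_rep_space:
  "rep_space (tensor_rep R S) =
    cfun.span {tensor_fun f g | f g. f \<in> rep_space R \<and> g \<in> rep_space S}"
  by (simp add: tensor_rep_def tensor_fun_def)

text \<open>Bilinearity, used one variable at a time; it describes a tensor product of hook modules
  by pairs of polytabloids.\<close>

lemma tensor_span:
  "cfun.span {tensor_fun f g | f g. f \<in> cfun.span A \<and> g \<in> cfun.span B} =
    cfun.span {tensor_fun f g | f g. f \<in> A \<and> g \<in> B}" (is "?L = ?R")
proof
  have "tensor_fun f g \<in> ?R" if f: "f \<in> cfun.span A" and g: "g \<in> cfun.span B" for f g
  proof -
    have A: "tensor_fun f b \<in> ?R" if b: "b \<in> B" for b
    proof -
      have "tensor_fun f b \<in> cfun.span ((\<lambda>f. tensor_fun f b) ` A)"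
        using clinear_span_image[OF clinear_tensor_fun(2), of b A] f by blast
      also have "\<dots> \<subseteq> ?R" using b by (intro cfun.span_mono) auto
      finally show ?thesis .
    qed
    have "tensor_fun f g \<in> cfun.span (tensor_fun f ` B)"
      using clinear_span_image[OF clinear_tensor_fun(1), of f B] g by blast
    also have "\<dots> \<subseteq> ?R" using A by (intro cfun.span_minimal) auto
    finally show ?thesis .
  qed
  then show "?L \<subseteq> ?R" by (intro cfun.span_minimal) auto
  show "?R \<subseteq> ?L" by (intro cfun.span_mono) (auto intro: cfun.span_base)
qed

lemma function_rep_tensor:
  assumes "function_rep d R X" "function_rep d S Y"
  shows "function_rep d (tensor_rep R S) (X \<times> Y)"
proof -
  interpret R: function_rep d R X by fact
  interpret S: function_rep d S Y by fact
  let ?B = "{tensor_fun f g | f g. f \<in> rep_space R \<and> g \<in> rep_space S}"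
  have act: "act (tensor_rep R S) \<sigma> (tensor_fun f g) = tensor_fun (act R \<sigma> f) (act S \<sigma> g)" for \<sigma> f g
    by (auto simp: act_def tensor_rep_def tensor_fun_def)
  have lin: "clinear (act (tensor_rep R S) \<sigma>)" for \<sigma>
    by (auto simp: clinear_def act_def cscale_def)
  show ?thesis
  proof
    show "subrep d (tensor_rep R S) (rep_space (tensor_rep R S))"
      unfolding subrep_def
    proof (intro conjI allI impI ballI)
      fix \<sigma> u assume \<sigma>: "\<sigma> permutes {1..d}" and u: "u \<in> rep_space (tensor_rep R S)"
      have "act (tensor_rep R S) \<sigma> ` ?B \<subseteq> ?B"
        using \<sigma> R.space_subrep S.space_subrep by (fastforce simp: act subrep_def)
      then have "cfun.span (act (tensor_rep R S) \<sigma> ` ?B) \<subseteq> cfun.span ?B" by (rule cfun.span_mono)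
      moreover have "act (tensor_rep R S) \<sigma> u \<in> cfun.span (act (tensor_rep R S) \<sigma> ` ?B)"
        using u unfolding tensor_rep_space clinear_span_image[OF lin, symmetric] by blast
      ultimately show "act (tensor_rep R S) \<sigma> u \<in> rep_space (tensor_rep R S)"
        unfolding tensor_rep_space by blast
    qed (auto simp: tensor_rep_space)
    show "rep_space (tensor_rep R S) \<subseteq> supported (X \<times> Y)"
      unfolding tensor_rep_space
      using R.space_supported S.space_supported
      by (intro cfun.span_minimal subspace_supported) (fastforce simp: supported_def tensor_fun_def)
  qed (use R.finite_points S.finite_points R.move_closed S.move_closed R.move_id S.move_id
      R.move_comp S.move_comp in \<open>auto simp: tensor_rep_def\<close>)
qed

lemma kronecker_eq_dim:
  assumes "tableau \<gamma> T" "sorted_wrt (\<ge>) \<alpha>" "sorted_wrt (\<ge>) \<beta>"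
    "sum_list \<alpha> = sum_list \<gamma>" "sum_list \<beta> = sum_list \<gamma>"
  shows "kronecker \<alpha> \<beta> \<gamma> = cfun.dim (symmetrizer (column_group (sum_list \<gamma>) (tableau.col \<gamma> T))
    (row_group (sum_list \<gamma>) (tabloid \<gamma> T)) (tensor_rep (specht \<alpha>) (specht \<beta>)) `
    rep_space (tensor_rep (specht \<alpha>) (specht \<beta>)))"
proof -
  interpret T: tableau \<gamma> T by fact
  obtain A B where "A \<in> tableaux \<alpha>" "B \<in> tableaux \<beta>" using ex_tableau by blast
  then interpret A: tableau \<alpha> A + B: tableau \<beta> B
    using assms by (simp_all add: tableau_def)
  show ?thesis
    unfolding kronecker_def T.specht_eq
    by (rule T.multiplicity_eq_dim)
      (use function_rep_tensor A.function_rep_specht B.function_rep_specht assms in fastforce)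
qed

section \<open>Antisymmetrization\<close>

text \<open>Permutations act on the positions of the tuple z, whereas the represented group acts on
  its values, so the two commute. The sum is not normalized; factorials are divided out
  later.\<close>

definition alt_sum :: "nat set \<Rightarrow> ((nat \<Rightarrow> nat) \<Rightarrow> complex) \<Rightarrow> (nat \<Rightarrow> nat) \<Rightarrow> complex" where
  "alt_sum A f z = (\<Sum>\<pi> | \<pi> permutes A. of_int (sign \<pi>) * f (z \<circ> \<pi>))"

definition alternating :: "nat set \<Rightarrow> ((nat \<Rightarrow> nat) \<Rightarrow> complex) \<Rightarrow> bool" where
  "alternating A f \<longleftrightarrow> (\<forall>\<pi> z. \<pi> permutes A \<longrightarrow> f (z \<circ> \<pi>) = of_int (sign \<pi>) * f z)"

lemma alternatingD: "alternating A f \<Longrightarrow> \<pi> permutes A \<Longrightarrow> f (z \<circ> \<pi>) = of_int (sign \<pi>) * f z"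
  by (simp add: alternating_def)

lemma alternating_transpose:
  assumes "alternating A f" "p \<in> A" "q \<in> A" "p \<noteq> q"
  shows "f (z \<circ> transpose p q) = - f z"
  using alternatingD[OF assms(1) permutes_swap_id[OF assms(2,3)]] assms(4)
  by (simp add: sign_swap_id)

lemma alternating_eq_0:
  assumes "alternating A f" "p \<in> A" "q \<in> A" "p \<noteq> q" "z p = z q"
  shows "f z = 0"
proof -
  have "z \<circ> transpose p q = z" using assms(5) by (auto simp: fun_eq_iff transpose_def)
  then have "f z = - f z" using alternating_transpose[OF assms(1-4), of z] by simp
  then show ?thesis by simp
qed

lemma of_int_sign_sq: "of_int (sign \<pi>) * (of_int (sign \<pi>) * c) = (c :: complex)"
  by (metis mult.assoc mult_1 of_int_1 of_int_mult sign_idempotent)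

lemma bij_betw_permutes_compose:
  assumes "\<tau> permutes A"
  shows "bij_betw (\<lambda>\<pi>. \<tau> \<circ> \<pi>) {\<pi>. \<pi> permutes A} {\<pi>. \<pi> permutes A}"
    "bij_betw (\<lambda>\<pi>. \<pi> \<circ> \<tau>) {\<pi>. \<pi> permutes A} {\<pi>. \<pi> permutes A}"
proof -
  have 1: "\<tau> \<circ> (inv \<tau> \<circ> \<pi>) = \<pi>" "inv \<tau> \<circ> (\<tau> \<circ> \<pi>) = \<pi>" for \<pi>
    using permutes_inv_o[OF assms] by (simp_all add: o_assoc)
  show "bij_betw (\<lambda>\<pi>. \<tau> \<circ> \<pi>) {\<pi>. \<pi> permutes A} {\<pi>. \<pi> permutes A}"
    by (rule bij_betwI[of _ _ _ "\<lambda>\<pi>. inv \<tau> \<circ> \<pi>"])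
      (use assms in \<open>auto simp: permutes_compose permutes_inv 1\<close>)
  have 2: "\<pi> \<circ> inv \<tau> \<circ> \<tau> = \<pi>" "\<pi> \<circ> \<tau> \<circ> inv \<tau> = \<pi>" for \<pi>
    using permutes_inv_o[OF assms] by (simp_all add: comp_assoc)
  show "bij_betw (\<lambda>\<pi>. \<pi> \<circ> \<tau>) {\<pi>. \<pi> permutes A} {\<pi>. \<pi> permutes A}"
    by (rule bij_betwI[of _ _ _ "\<lambda>\<pi>. \<pi> \<circ> inv \<tau>"])
      (use assms in \<open>auto simp: permutes_compose permutes_inv 2\<close>)
qed

lemma sign_comp_permutes:
  assumes "finite A" "\<pi> permutes A" "\<rho> permutes A"
  shows "sign (\<pi> \<circ> \<rho>) = sign \<pi> * sign \<rho>"
  using assms by (simp add: sign_compose permutes_imp_permutation)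

lemma alternating_alt_sum:
  assumes "finite A"
  shows "alternating A (alt_sum A f)"
  unfolding alternating_def
proof (intro allI impI)
  fix \<pi> z assume \<pi>: "\<pi> permutes A"
  have "of_int (sign \<pi>) * alt_sum A f z = of_int (sign \<pi>) *
      (\<Sum>\<rho> | \<rho> permutes A. of_int (sign (\<pi> \<circ> \<rho>)) * f (z \<circ> (\<pi> \<circ> \<rho>)))"
    unfolding alt_sum_def by (subst sum.reindex_bij_betw[OF bij_betw_permutes_compose(1)[OF \<pi>]]) simp
  also have "\<dots> = (\<Sum>\<rho> | \<rho> permutes A. of_int (sign \<rho>) * f (z \<circ> \<pi> \<circ> \<rho>))"
    unfolding sum_distrib_left
    by (intro sum.cong refl)
      (simp add: sign_comp_permutes[OF assms \<pi>] mult.assoc of_int_sign_sq comp_assoc)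
  finally show "alt_sum A f (z \<circ> \<pi>) = of_int (sign \<pi>) * alt_sum A f z"
    by (simp add: alt_sum_def)
qed

lemma alt_sum_alternating:
  assumes "finite A" "alternating A f"
  shows "alt_sum A f z = of_nat (fact (card A)) * f z"
proof -
  have "alt_sum A f z = (\<Sum>\<pi> | \<pi> permutes A. f z)"
    unfolding alt_sum_def
    by (intro sum.cong refl) (simp add: alternatingD[OF assms(2)] of_int_sign_sq)
  also have "\<dots> = of_nat (fact (card A)) * f z"
    by (simp add: card_permutations[OF refl assms(1)])
  finally show ?thesis .
qed

text \<open>The transpositions of m with the elements of \<open>insert m A\<close>, the trivial one
  included, represent the cosets of the permutations of A, and all nontrivial ones are odd. This
  expansion is the source of both the cocycle identity and the exchange operator.\<close>

lemma alt_sum_insert: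
  assumes "finite A" "m \<notin> A"
  shows "alt_sum (insert m A) f z = alt_sum A f z - (\<Sum>s\<in>A. alt_sum A f (z \<circ> transpose m s))"
proof -
  have "alt_sum (insert m A) f z = (\<Sum>b\<in>insert m A. \<Sum>\<pi> | \<pi> permutes A.
      of_int (sign (transpose m b \<circ> \<pi>)) * f (z \<circ> (transpose m b \<circ> \<pi>)))"
    unfolding alt_sum_def by (rule sum_over_permutations_insert[OF assms])
  also have "\<dots> = (\<Sum>b\<in>insert m A. of_int (sign (transpose m b)) * alt_sum A f (z \<circ> transpose m b))"
  proof (rule sum.cong[OF refl])
    fix b
    have "sign (transpose m b \<circ> \<pi>) = sign (transpose m b) * sign \<pi>" if "\<pi> permutes A" for \<pi>
      using permutes_imp_permutation[OF assms(1) that] by (simp add: sign_compose permutation_swap_id)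
    then show "(\<Sum>\<pi> | \<pi> permutes A. of_int (sign (transpose m b \<circ> \<pi>)) * f (z \<circ> (transpose m b \<circ> \<pi>))) =
        of_int (sign (transpose m b)) * alt_sum A f (z \<circ> transpose m b)"
      by (simp add: alt_sum_def sum_distrib_left mult.assoc comp_assoc)
  qed
  also have "\<dots> = alt_sum A f z + (\<Sum>s\<in>A. - alt_sum A f (z \<circ> transpose m s))"
  proof -
    have "of_int (sign (transpose m s)) = (- 1 :: complex)" if "s \<in> A" for s
      using that assms(2) by (auto simp: sign_swap_id)
    then show ?thesis using assms by simp
  qed
  finally show ?thesis by (simp add: sum_negf)
qed

lemma alt_sum_eq_0:
  assumes "finite A" "p \<in> A" "q \<in> A" "p \<noteq> q" "\<And>z. f (z \<circ> transpose p q) = f z"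
  shows "alt_sum A f z = 0"
proof -
  have t: "transpose p q permutes A" using assms by (simp add: permutes_swap_id)
  have "alt_sum A f z = (\<Sum>\<pi> | \<pi> permutes A.
      of_int (sign (\<pi> \<circ> transpose p q)) * f (z \<circ> (\<pi> \<circ> transpose p q)))"
    unfolding alt_sum_def
    by (rule sum.reindex_bij_betw[OF bij_betw_permutes_compose(2)[OF t], symmetric])
  also have "\<dots> = (\<Sum>\<pi> | \<pi> permutes A. - (of_int (sign \<pi>) * f (z \<circ> \<pi>)))"
    using assms t by (intro sum.cong refl) (simp add: sign_comp_permutes sign_swap_id o_assoc)
  finally show ?thesis by (simp add: sum_negf alt_sum_def)
qed

lemma permutes_disjoint_commute:
  assumes "\<pi> permutes A" "\<rho> permutes B" "A \<inter> B = {}"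
  shows "\<pi> \<circ> \<rho> = \<rho> \<circ> \<pi>"
proof
  fix p
  have A: "\<pi> q \<in> A \<longleftrightarrow> q \<in> A" and B: "\<rho> q \<in> B \<longleftrightarrow> q \<in> B" for q
    using assms permutes_in_image by metis+
  have "\<pi> q = q" if "q \<notin> A" for q using permutes_not_in[OF assms(1) that] .
  moreover have "\<rho> q = q" if "q \<notin> B" for q using permutes_not_in[OF assms(2) that] .
  ultimately show "(\<pi> \<circ> \<rho>) p = (\<rho> \<circ> \<pi>) p"
    using A[of p] B[of p] assms(3) by (metis comp_apply disjoint_iff)
qed

lemma alt_sum_commute:
  assumes "A \<inter> B = {}"
  shows "alt_sum A (alt_sum B f) = alt_sum B (alt_sum A f)"
proof
  fix z
  have "alt_sum A (alt_sum B f) z = (\<Sum>\<pi> | \<pi> permutes A. \<Sum>\<rho> | \<rho> permutes B.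
      of_int (sign \<pi>) * (of_int (sign \<rho>) * f (z \<circ> \<pi> \<circ> \<rho>)))"
    by (simp add: alt_sum_def sum_distrib_left)
  also have "\<dots> = (\<Sum>\<rho> | \<rho> permutes B. \<Sum>\<pi> | \<pi> permutes A.
      of_int (sign \<pi>) * (of_int (sign \<rho>) * f (z \<circ> \<pi> \<circ> \<rho>)))"
    by (rule sum.swap)
  also have "\<dots> = (\<Sum>\<rho> | \<rho> permutes B. \<Sum>\<pi> | \<pi> permutes A.
      of_int (sign \<rho>) * (of_int (sign \<pi>) * f (z \<circ> \<rho> \<circ> \<pi>)))"
    by (intro sum.cong refl)
      (use permutes_disjoint_commute[OF _ _ assms] in \<open>auto simp: comp_assoc mult.left_commute\<close>)
  finally show "alt_sum A (alt_sum B f) z = alt_sum B (alt_sum A f) z"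
    by (simp add: alt_sum_def sum_distrib_left)
qed

lemma update_compose_perm:
  assumes "\<pi> permutes A" "m \<notin> A"
  shows "(z(m := x)) \<circ> \<pi> = (z \<circ> \<pi>)(m := x)"
proof -
  have "\<pi> p = m \<longleftrightarrow> p = m" for p
    using assms permutes_not_in[OF assms] permutes_inj[OF assms(1)] by (metis injD)
  then show ?thesis by (auto simp: fun_eq_iff)
qed

lemma alt_sum_ignores:
  assumes "\<And>z. f (z(m := x)) = f z" "m \<notin> A"
  shows "alt_sum A f (z(m := x)) = alt_sum A f z"
  unfolding alt_sum_def
  by (intro sum.cong refl) (simp add: update_compose_perm[OF _ assms(2)] assms(1))

text \<open>Antisymmetrizing over \<open>A\<close> and one fresh position \<open>m\<close> holding \<open>x\<close> gives \<open>0\<close>, since \<open>f\<close> ignores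
  both \<open>p\<close> and \<open>m\<close>; expanding along \<open>m\<close> is the cocycle identity.\<close>

lemma alt_sum_cocycle:
  assumes "finite A" "p \<in> A" "m \<notin> A" "\<And>z x. f (z(p := x)) = f z" "\<And>z x. f (z(m := x)) = f z"
  shows "alt_sum A f z = (\<Sum>s\<in>A. alt_sum A f (z(s := x)))"
proof -
  let ?z = "z(m := x)"
  have ign: "alt_sum A f (y(m := v)) = alt_sum A f y" for y v
    by (intro alt_sum_ignores assms(5,3))
  have "f (y \<circ> transpose p m) = f y" for y
  proof -
    have "y \<circ> transpose p m = y(p := y m, m := y p)" using assms(2,3) by (auto simp: fun_eq_iff transpose_def)
    then show ?thesis by (simp add: assms(4,5))
  qed
  then have "0 = alt_sum (insert m A) f ?z"
    using assms by (intro alt_sum_eq_0[of _ p m, symmetric]) auto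
  also have "\<dots> = alt_sum A f ?z - (\<Sum>s\<in>A. alt_sum A f (?z \<circ> transpose m s))"
    by (rule alt_sum_insert[OF assms(1,3)])
  also have "(\<Sum>s\<in>A. alt_sum A f (?z \<circ> transpose m s)) = (\<Sum>s\<in>A. alt_sum A f (z(s := x)))"
  proof (rule sum.cong[OF refl])
    fix s assume "s \<in> A"
    then have "?z \<circ> transpose m s = z(s := x, m := z s)"
      using assms(3) by (auto simp: fun_eq_iff transpose_def)
    then show "alt_sum A f (?z \<circ> transpose m s) = alt_sum A f (z(s := x))" by (simp add: ign)
  qed
  finally show ?thesis unfolding ign by simp
qed

text \<open>Group the permutations \<pi> of A by b = \<pi> p. Filling p after \<pi> amounts to
  filling b before it, so by alternation each of the (|A| - 1)! permutations with this b contributes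
  the same term. With the cocycle identity this recovers a cocycle from its values with x filled
  in.\<close>

lemma alt_sum_fill:
  assumes "finite A" "p \<in> A" "alternating A f"
  shows "alt_sum A (\<lambda>y. f (y(p := x))) z = of_nat (fact (card A - 1)) * (\<Sum>s\<in>A. f (z(s := x)))"
proof -
  define A' where "A' = A - {p}"
  have A: "A = insert p A'" "p \<notin> A'" "finite A'" using assms by (auto simp: A'_def)
  have "alt_sum A (\<lambda>y. f (y(p := x))) z = (\<Sum>b\<in>A. \<Sum>q | q permutes A'.
      of_int (sign (transpose p b \<circ> q)) * f ((z \<circ> (transpose p b \<circ> q))(p := x)))"
    unfolding alt_sum_def by (subst (1 2) A(1)) (rule sum_over_permutations_insert[OF A(3,2)])
  also have "\<dots> = (\<Sum>b\<in>A. \<Sum>q | q permutes A'. f (z(b := x)))"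
  proof (intro sum.cong refl)
    fix b q assume b: "b \<in> A" and "q \<in> {q. q permutes A'}"
    then have q: "q permutes A'" by simp
    have perm: "transpose p b \<circ> q permutes A"
      using b q A by (intro permutes_compose permutes_swap_id permutes_subset[OF q]) auto
    have "(z \<circ> (transpose p b \<circ> q))(p := x) = (z(b := x)) \<circ> (transpose p b \<circ> q)"
    proof
      fix r
      have "q r = p \<longleftrightarrow> r = p"
        using permutes_not_in[OF q A(2)] permutes_inj[OF q] by (metis injD)
      then show "((z \<circ> (transpose p b \<circ> q))(p := x)) r = ((z(b := x)) \<circ> (transpose p b \<circ> q)) r"
        by (auto simp: transpose_def)
    qed
    then show "of_int (sign (transpose p b \<circ> q)) * f ((z \<circ> (transpose p b \<circ> q))(p := x)) = f (z(b := x))"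
      by (simp add: alternatingD[OF assms(3) perm] of_int_sign_sq)
  qed
  also have "\<dots> = of_nat (fact (card A - 1)) * (\<Sum>s\<in>A. f (z(s := x)))"
    using A by (simp add: card_permutations[OF refl A(3)] sum_distrib_left distrib_left)
  finally show ?thesis .
qed

section \<open>Hook shapes\<close>

text \<open>The word z lists the first column of a hook at positions k, ..., k + a: the entry at k +
  s with s > 0 has row s, every other entry row 0. The corner entry at k is never read, which is
  what makes alternating sums of hook tabloids cocycles. \<open>LEAST\<close> gives repeated entries
  a definite row; the offset k lets two columns share one word.\<close>

definition hook_tabloid :: "nat \<Rightarrow> nat \<Rightarrow> (nat \<Rightarrow> nat) \<Rightarrow> nat \<Rightarrow> nat" where
  "hook_tabloid k a z i = (if \<exists>s\<in>{1..a}. z (k + s) = i then LEAST s. s \<in> {1..a} \<and> z (k + s) = i else 0)"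

lemma hook_tabloid_cong:
  assumes "\<And>p. p \<in> {k<..k + a} \<Longrightarrow> z p = z' p"
  shows "hook_tabloid k a z = hook_tabloid k a z'"
proof -
  have "s \<in> {1..a} \<and> z (k + s) = i \<longleftrightarrow> s \<in> {1..a} \<and> z' (k + s) = i" for s i
    using assms[of "k + s"] by auto
  then show ?thesis unfolding hook_tabloid_def fun_eq_iff Bex_def by presburger
qed

lemma hook_tabloid_compose:
  assumes "bij \<sigma>"
  shows "hook_tabloid k a (\<sigma> \<circ> z) = hook_tabloid k a z \<circ> inv \<sigma>"
proof -
  have "(\<sigma> \<circ> z) p = i \<longleftrightarrow> z p = inv \<sigma> i" for p i
    using assms by (metis bij_inv_eq_iff comp_apply)
  then show ?thesis by (simp add: hook_tabloid_def fun_eq_iff)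
qed

lemma hook_tabloid_eqD:
  assumes "hook_tabloid k a z i = s" "s \<noteq> 0"
  shows "s \<in> {1..a} \<and> z (k + s) = i"
proof -
  have "\<exists>s. s \<in> {1..a} \<and> z (k + s) = i"
    using assms by (auto simp: hook_tabloid_def split: if_splits)
  from LeastI_ex[OF this] show ?thesis
    using assms \<open>\<exists>s. s \<in> {1..a} \<and> z (k + s) = i\<close>
    unfolding hook_tabloid_def Bex_def by (simp only: if_True)
qed

lemma hook_tabloid_inj:
  assumes "inj_on z {k..k + a}" "s \<le> a"
  shows "hook_tabloid k a z (z (k + s)) = s"
proof -
  have *: "z (k + s') = z (k + s) \<longleftrightarrow> s' = s" if "s' \<le> a" for s'
    using assms that inj_on_eq_iff[OF assms(1), of "k + s'" "k + s"] by auto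
  show ?thesis
  proof (cases "s = 0")
    case False
    then have "(LEAST s'. s' \<in> {1..a} \<and> z (k + s') = z (k + s)) = s"
      using assms * by (intro Least_equality) auto
    then show ?thesis using False assms * by (auto simp: hook_tabloid_def)
  qed (use * in \<open>auto simp: hook_tabloid_def\<close>)
qed

text \<open>For injective z this is the polytabloid with first column z, the other columns of a hook
  having one cell each. Repeated entries give 0, so z may range over all words.\<close>

definition hook_polytabloid :: "nat \<Rightarrow> nat \<Rightarrow> (nat \<Rightarrow> nat) \<Rightarrow> (nat \<Rightarrow> nat) \<Rightarrow> complex" where
  "hook_polytabloid k a z w = alt_sum {k..k + a} (\<lambda>y. if w = hook_tabloid k a y then 1 else 0) z"

text \<open>Send x p to y p and match the complements, which have equal size, arbitrarily.\<close>

lemma ex_perm_extending: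
  assumes "finite A" "inj_on x A" "inj_on y A" "x ` A \<subseteq> {1..d}" "y ` A \<subseteq> {1..d}"
  shows "\<exists>\<sigma>\<in>perms d. \<forall>p\<in>A. y p = \<sigma> (x p)"
proof -
  have "card ({1..d} - x ` A) = card ({1..d} - y ` A)"
    using assms by (simp add: card_Diff_subset card_image)
  then obtain h where h: "bij_betw h ({1..d} - x ` A) ({1..d} - y ` A)"
    using finite_same_card_bij by blast
  define f where "f = y \<circ> the_inv_into A x"
  have f: "bij_betw f (x ` A) (y ` A)"
    unfolding f_def using assms
    by (intro bij_betw_trans[of _ _ A] bij_betw_the_inv_into) (auto simp: bij_betw_def)
  define \<sigma> where "\<sigma> i = (if i \<in> {1..d} then if i \<in> x ` A then f i else h i else i)" for i
  have "bij_betw \<sigma> (x ` A \<union> ({1..d} - x ` A)) (y ` A \<union> ({1..d} - y ` A))"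
  proof (rule bij_betw_combine)
    show "bij_betw \<sigma> (x ` A) (y ` A)"
      using f by (rule bij_betw_cong[THEN iffD1, rotated]) (use assms in \<open>auto simp: \<sigma>_def\<close>)
    show "bij_betw \<sigma> ({1..d} - x ` A) ({1..d} - y ` A)"
      using h by (rule bij_betw_cong[THEN iffD1, rotated]) (auto simp: \<sigma>_def)
  qed auto
  then have "bij_betw \<sigma> {1..d} {1..d}" using assms by (simp add: Un_absorb1)
  then have "\<sigma> \<in> perms d"
    unfolding perms_def mem_Collect_eq by (rule bij_imp_permutes) (simp only: \<sigma>_def if_False)
  moreover have "y p = \<sigma> (x p)" if "p \<in> A" for p
    using that assms by (auto simp: \<sigma>_def f_def the_inv_into_f_f)
  ultimately show ?thesis by blast
qed

lemma hook_polytabloid_compose: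
  assumes "\<sigma> \<in> perms d"
  shows "hook_polytabloid k a z (w \<circ> \<sigma>) = hook_polytabloid k a (\<sigma> \<circ> z) w"
proof -
  have "bij \<sigma>" using assms by (simp add: perms_def permutes_bij)
  then have "hook_tabloid k a (\<sigma> \<circ> z \<circ> \<pi>) = hook_tabloid k a (z \<circ> \<pi>) \<circ> inv \<sigma>" for \<pi>
    by (simp add: comp_assoc hook_tabloid_compose)
  moreover have "w \<circ> \<sigma> = u \<longleftrightarrow> w = u \<circ> inv \<sigma>" for u
    using perms_cancel(5,6)[OF assms] by metis
  ultimately show ?thesis by (simp add: hook_polytabloid_def alt_sum_def comp_assoc)
qed

lemma hook_polytabloid_cong:
  assumes "\<And>p. p \<in> {k..k + a} \<Longrightarrow> z p = z' p"
  shows "hook_polytabloid k a z = hook_polytabloid k a z'"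
proof
  fix w
  have "hook_tabloid k a (z \<circ> \<pi>) = hook_tabloid k a (z' \<circ> \<pi>)" if "\<pi> permutes {k..k + a}" for \<pi>
  proof (rule hook_tabloid_cong)
    fix p assume "p \<in> {k<..k + a}"
    then have "\<pi> p \<in> {k..k + a}" using permutes_in_image[OF that, of p] by auto
    then show "(z \<circ> \<pi>) p = (z' \<circ> \<pi>) p" using assms by simp
  qed
  then show "hook_polytabloid k a z w = hook_polytabloid k a z' w"
    by (simp add: hook_polytabloid_def alt_sum_def)
qed

lemma hook_polytabloid_not_inj:
  assumes "\<not> inj_on z {k..k + a}"
  shows "hook_polytabloid k a z = 0"
proof
  fix w
  obtain p q where "p \<in> {k..k + a}" "q \<in> {k..k + a}" "p \<noteq> q" "z p = z q"
    using assms by (auto simp: inj_on_def)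
  then show "hook_polytabloid k a z w = 0 w"
    unfolding hook_polytabloid_def zero_fun_apply
    by (rule alternating_eq_0[OF alternating_alt_sum[OF finite_atLeastAtMost]])
qed

definition hook :: "nat \<Rightarrow> nat \<Rightarrow> nat list" where
  "hook d a = padded (column a) d"

lemma sum_list_hook: "a < d \<Longrightarrow> sum_list (hook d a) = d"
  by (simp add: hook_def padded_def column_def sum_list_replicate)

lemma sorted_hook: "a < d \<Longrightarrow> sorted_wrt (\<ge>) (hook d a)"
  by (auto simp: hook_def padded_def column_def sum_list_replicate sorted_wrt_iff_nth_less nth_Cons'
      set_replicate_conv_if)

lemma diagram_hook:
  "a < d \<Longrightarrow> young_diagram (hook d a) = {(r, c). r = 0 \<and> c < d - a \<or> 1 \<le> r \<and> r \<le> a \<and> c = 0}"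
  by (auto simp: young_diagram_def hook_def padded_def column_def sum_list_replicate nth_Cons'
      split: if_splits)

text \<open>Beyond the first column every column of a hook is a single cell, so the column group is
  the symmetric group of the first column. Transitivity of the symmetric group on injective words
  then produces all polytabloids, and words with repetitions add only zeros.\<close>

lemma hook_specht:
  assumes "a < d"
  obtains X where "function_rep d (specht (hook d a)) X"
    "\<And>z. inj_on z {k..k + a} \<Longrightarrow> z ` {k..k + a} \<subseteq> {1..d} \<Longrightarrow> hook_tabloid k a z \<in> X"
    "rep_space (specht (hook d a)) = cfun.span (hook_polytabloid k a ` {z. z ` {k..k + a} \<subseteq> {1..d}})"
proof -
  obtain T where "T \<in> tableaux (hook d a)" using ex_tableau by blast
  then interpret T: tableau "hook d a" T using sorted_hook[OF assms] by (simp add: tableau_def)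
  note d = sum_list_hook[OF assms]
  let ?t = "tabloid (hook d a) T" and ?A = "{k..k + a}"
  \<comment> \<open>The first column of T from top to bottom, placed at positions k, ..., k +
    a.\<close>
  define x where "x p = T (p - k, 0)" for p
  have xD: "(p - k, 0) \<in> T.D" if "p \<in> ?A" for p
    using that assms by (auto simp: diagram_hook)
  have x_in: "x ` ?A \<subseteq> {1..d}" using T.T_in[OF xD] d unfolding x_def by auto
  have x_row: "?t (x p) = p - k" "T.col (x p) = 0" if "p \<in> ?A" for p
    using T.t_col_T[OF xD[OF that]] by (simp_all add: x_def)
  have x_inj: "inj_on x ?A"
    by (rule inj_onI) (metis x_row(1) atLeastAtMost_iff le_add_diff_inverse)
  have col0: "i \<in> x ` ?A" if "i \<in> {1..d}" "T.col i = 0 \<or> ?t i \<noteq> 0" for i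
  proof -
    obtain r c where rc: "T.pos i = (r, c)" by force
    then have D: "(r, c) \<in> T.D" "T (r, c) = i" using T.pos_in[of i] that d by auto
    have "?t i = r \<and> T.col i = c" using T.t_col_T[OF D(1)] D(2) by simp
    then have "c = 0" using that D(1) assms by (auto simp: diagram_hook)
    moreover have "r \<le> a" using D assms by (auto simp: diagram_hook)
    ultimately show ?thesis using D by (intro image_eqI[of _ _ "k + r"]) (auto simp: x_def)
  qed
  have col_inj: "i = j" if "i \<in> {1..d}" "j \<in> {1..d}" "T.col i = T.col j" "T.col i \<noteq> 0" for i j
  proof -
    have "?t i = 0" if "i \<in> {1..d}" "T.col i \<noteq> 0" for i
      using col0[OF that(1)] that(2) x_row(2) by (cases "?t i = 0") auto
    then show ?thesis using that T.row_col_inj[of i j] d by simp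
  qed
  have t_x: "?t = hook_tabloid k a x"
  proof
    fix i
    show "?t i = hook_tabloid k a x i"
    proof (cases "i \<in> x ` ?A")
      case True
      then obtain p where p: "p \<in> ?A" "i = x p" by blast
      then have "hook_tabloid k a x i = p - k"
        using hook_tabloid_inj[OF x_inj, of "p - k"] by auto
      then show ?thesis using x_row(1)[OF p(1)] p by simp
    next
      case False
      then have "?t i = 0" using col0[of i] T.row_outside[of i] d by auto
      moreover have "hook_tabloid k a x i = 0"
      proof (rule ccontr)
        assume "hook_tabloid k a x i \<noteq> 0"
        from hook_tabloid_eqD[OF refl this] have "i = x (k + hook_tabloid k a x i)"
          "k + hook_tabloid k a x i \<in> ?A" by auto
        then show False using False by blast
      qed
      ultimately show ?thesis by simp
    qed
  qed
  have C_eq: "T.C = {\<sigma>. \<sigma> permutes x ` ?A}"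
  proof (intro subset_antisym subsetI)
    fix \<sigma> assume \<sigma>: "\<sigma> \<in> T.C"
    then have perm: "\<sigma> permutes {1..d}" and col: "\<And>i. i \<in> {1..d} \<Longrightarrow> T.col (\<sigma> i) = T.col i"
      using d by (auto simp: column_group_def perms_def)
    have "\<sigma> i = i" if "i \<in> {1..d}" "i \<notin> x ` ?A" for i
    proof (rule col_inj)
      show "\<sigma> i \<in> {1..d}" using permutes_in_image[OF perm] that by blast
      show "T.col (\<sigma> i) = T.col i" using col that by blast
      show "T.col (\<sigma> i) \<noteq> 0" using col[OF that(1)] col0[OF that(1)] that(2) by auto
    qed (use that in auto)
    then have "\<sigma> permutes x ` ?A" by (intro permutes_superset[OF perm]) auto
    then show "\<sigma> \<in> {\<sigma>. \<sigma> permutes x ` ?A}" by simp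
  next
    fix \<sigma> assume "\<sigma> \<in> {\<sigma>. \<sigma> permutes x ` ?A}"
    then have perm: "\<sigma> permutes x ` ?A" by simp
    have "T.col (\<sigma> i) = T.col i" for i
    proof (cases "i \<in> x ` ?A")
      case True
      then have "\<sigma> i \<in> x ` ?A" using permutes_in_image[OF perm] by blast
      then show ?thesis using True x_row(2) by auto
    qed (use perm in \<open>simp add: permutes_not_in\<close>)
    moreover have "\<sigma> permutes {1..d}" using permutes_subset[OF perm x_in] .
    ultimately show "\<sigma> \<in> T.C" using d by (simp add: column_group_def perms_def)
  qed
  have x_bij: "bij_betw x ?A (x ` ?A)" using x_inj by (simp add: bij_betw_def)
  \<comment> \<open>Permutations of positions and of the entries at these positions correspond
    through x with equal signs; this turns the column sum into an \<open>alt_sum\<close>.\<close>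
  have C_bij: "bij_betw (map_permutation ?A x) {\<pi>. \<pi> permutes ?A} T.C"
    unfolding C_eq
  proof (rule bij_betwI[of _ _ _ "map_permutation (x ` ?A) (inv_into ?A x)"])
    show "map_permutation ?A x \<in> {\<pi>. \<pi> permutes ?A} \<rightarrow> {\<sigma>. \<sigma> permutes x ` ?A}"
      using map_permutation_permutes[OF x_bij] by auto
    show "map_permutation (x ` ?A) (inv_into ?A x) \<in> {\<sigma>. \<sigma> permutes x ` ?A} \<rightarrow> {\<pi>. \<pi> permutes ?A}"
      using map_permutation_permutes[OF bij_betw_inv_into[OF x_bij]] by auto
    show "map_permutation (x ` ?A) (inv_into ?A x) (map_permutation ?A x \<pi>) = \<pi>"
      if "\<pi> \<in> {\<pi>. \<pi> permutes ?A}" for \<pi>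
      by (rule map_permutation_compose_inv[OF x_bij]) (use that x_inj in auto)
    show "map_permutation ?A x (map_permutation (x ` ?A) (inv_into ?A x) \<sigma>) = \<sigma>"
      if "\<sigma> \<in> {\<sigma>. \<sigma> permutes x ` ?A}" for \<sigma>
      by (rule map_permutation_compose_inv[OF bij_betw_inv_into[OF x_bij]])
        (use that x_inj in \<open>auto intro: f_inv_into_f\<close>)
  qed
  have gen: "T.e = hook_polytabloid k a x"
  proof
    fix w
    have "T.e w = (\<Sum>\<sigma>\<in>T.C. of_int (sign \<sigma>) * delta ?t (w \<circ> \<sigma>))"
      by (simp add: spechtgen_def colsum_def gsum_apply) (simp add: tabloid_rep_def)
    also have "\<dots> = (\<Sum>\<pi> | \<pi> permutes ?A. of_int (sign (map_permutation ?A x \<pi>)) *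
        delta ?t (w \<circ> map_permutation ?A x \<pi>))"
      by (rule sum.reindex_bij_betw[OF C_bij, symmetric])
    also have "\<dots> = hook_polytabloid k a x w"
      unfolding hook_polytabloid_def alt_sum_def
    proof (rule sum.cong[OF refl])
      fix \<pi> assume "\<pi> \<in> {\<pi>. \<pi> permutes ?A}"
      then have \<pi>: "\<pi> permutes ?A" by simp
      let ?s = "map_permutation ?A x \<pi>"
      have s: "?s permutes x ` ?A" using map_permutation_permutes[OF x_bij \<pi>] .
      have "hook_tabloid k a (x \<circ> \<pi>) = hook_tabloid k a (?s \<circ> x)"
        by (rule hook_tabloid_cong) (use x_inj in \<open>simp add: map_permutation_apply\<close>)
      also have "\<dots> = ?t \<circ> inv ?s"
        unfolding t_x by (rule hook_tabloid_compose[OF permutes_bij[OF s]])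
      finally have "w = hook_tabloid k a (x \<circ> \<pi>) \<longleftrightarrow> w \<circ> ?s = ?t"
        using permutes_inv_o[OF s] by (metis comp_assoc comp_id)
      moreover have "sign ?s = sign \<pi>"
        by (rule sign_map_permutation) (use x_inj \<pi> in auto)
      ultimately show "of_int (sign ?s) * delta ?t (w \<circ> ?s) =
          complex_of_int (sign \<pi>) * (if w = hook_tabloid k a (x \<circ> \<pi>) then 1 else 0)"
        by (simp add: delta_def)
    qed
    finally show "T.e w = hook_polytabloid k a x w" .
  qed
  have act_gen: "act T.M \<sigma> T.e = hook_polytabloid k a (\<sigma> \<circ> x)" if "\<sigma> \<in> perms d" for \<sigma>
    unfolding gen using hook_polytabloid_compose[OF that] by (simp add: fun_eq_iff T.act_M)
  show thesis
  proof
    show "function_rep d (specht (hook d a)) (tabloids d ?t)"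
      using T.function_rep_specht d by simp
    fix z assume z: "inj_on z ?A" "z ` ?A \<subseteq> {1..d}"
    obtain \<sigma> where \<sigma>: "\<sigma> \<in> perms d" "\<And>p. p \<in> ?A \<Longrightarrow> z p = \<sigma> (x p)"
      using ex_perm_extending[OF _ x_inj z(1) x_in z(2)] by auto
    then have "hook_tabloid k a z = hook_tabloid k a (\<sigma> \<circ> x)" by (intro hook_tabloid_cong) auto
    also have "\<dots> = ?t \<circ> inv \<sigma>"
      using \<sigma> by (simp add: t_x hook_tabloid_compose perms_def permutes_bij)
    finally show "hook_tabloid k a z \<in> tabloids d ?t"
      using perms_inv[OF \<sigma>(1)] by (auto simp: tabloids_def)
  next
    have "rep_space (specht (hook d a)) = T.S" unfolding T.specht_eq by simp
    also have "\<dots> = cfun.span (hook_polytabloid k a ` {z. z ` ?A \<subseteq> {1..d}})" (is "_ = ?H")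
    proof (intro subset_antisym)
      show "T.S \<subseteq> ?H"
        unfolding specht_space_def d
      proof (intro cfun.span_mono image_subsetI)
        fix \<sigma> assume \<sigma>: "\<sigma> \<in> perms d"
        then have "(\<sigma> \<circ> x) ` ?A \<subseteq> {1..d}"
          using x_in permutes_in_image[of \<sigma> "{1..d}"] by (force simp: perms_def)
        then show "act (tabloid_rep d ?t) \<sigma> (spechtgen d ?t T.col) \<in>
            hook_polytabloid k a ` {z. z ` ?A \<subseteq> {1..d}}"
          using act_gen[OF \<sigma>] d by auto
      qed
      show "?H \<subseteq> T.S"
      proof (rule cfun.span_minimal)
        have "hook_polytabloid k a z \<in> T.S" if z: "z ` ?A \<subseteq> {1..d}" for z
        proof (cases "inj_on z ?A")
          case True
          obtain \<sigma> where \<sigma>: "\<sigma> \<in> perms d" "\<And>p. p \<in> ?A \<Longrightarrow> z p = \<sigma> (x p)"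
            using ex_perm_extending[OF _ x_inj True x_in z] by auto
          then have "hook_polytabloid k a z = act T.M \<sigma> T.e"
            unfolding act_gen[OF \<sigma>(1)] by (intro hook_polytabloid_cong) auto
          then show ?thesis using T.act_e_in_S[of \<sigma>] \<sigma>(1) d by simp
        next
          case False
          then show ?thesis
            using hook_polytabloid_not_inj subspaceD(1) T.subrep_S by (auto simp: subrep_def)
        qed
        then show "hook_polytabloid k a ` {z. z ` ?A \<subseteq> {1..d}} \<subseteq> T.S" by auto
        show "cfun.subspace T.S" using T.subrep_S by (simp add: subrep_def)
      qed
    qed
    finally show "rep_space (specht (hook d a)) = ?H" .
  qed
qed

section \<open>Alternating functions on words\<close>

text \<open>The value 0 marks positions beyond the word. It is no point of {1..d} and is fixed by
  the group, so tuples of length n become a finite invariant set of functions.\<close>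

definition words :: "nat \<Rightarrow> nat \<Rightarrow> (nat \<Rightarrow> nat) set" where
  "words d n = {z. (\<forall>p<n. z p \<in> {1..d}) \<and> (\<forall>p\<ge>n. z p = 0)}"

lemma finite_words: "finite (words d n)"
proof -
  have "words d n = {z. \<forall>p. (p \<in> {..<n} \<longrightarrow> z p \<in> {1..d}) \<and> (p \<notin> {..<n} \<longrightarrow> z p = 0)}"
    by (simp add: words_def not_less all_conj_distrib del: atLeastAtMost_iff)
  then show ?thesis using finite_set_of_finite_funs[of "{..<n}" "{1..d}" 0] by simp
qed

lemma words_update: "z \<in> words d n \<Longrightarrow> s < n \<Longrightarrow> x \<in> {1..d} \<Longrightarrow> z(s := x) \<in> words d n"
  by (auto simp: words_def)

lemma words_permute:
  assumes "\<pi> permutes A" "A \<subseteq> {..<n}"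
  shows "z \<circ> \<pi> \<in> words d n \<longleftrightarrow> z \<in> words d n"
proof -
  have \<pi>: "\<pi> permutes {..<n}" using permutes_subset[OF assms] .
  have *: "z \<circ> \<pi> \<in> words d n" if "z \<in> words d n" "\<pi> permutes {..<n}" for z \<pi>
  proof -
    have "\<pi> p < n \<longleftrightarrow> p < n" for p using permutes_in_image[OF that(2)] by simp
    then show ?thesis using that(1) by (auto simp: words_def not_less[symmetric])
  qed
  have "z \<circ> \<pi> \<circ> inv \<pi> = z" using permutes_inv_o(1)[OF \<pi>] by (simp add: comp_assoc)
  then show ?thesis using *[OF _ \<pi>, of z] *[OF _ permutes_inv[OF \<pi>], of "z \<circ> \<pi>"] by auto
qed

lemma words_act:
  assumes "\<sigma> \<in> perms d"
  shows "\<sigma> \<circ> z \<in> words d n \<longleftrightarrow> z \<in> words d n"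
proof -
  have "\<sigma> i \<in> {1..d} \<longleftrightarrow> i \<in> {1..d}" "\<sigma> i = 0 \<longleftrightarrow> i = 0" for i
  proof -
    have \<sigma>: "\<sigma> permutes {1..d}" using assms by (simp add: perms_def)
    show "\<sigma> i \<in> {1..d} \<longleftrightarrow> i \<in> {1..d}" by (rule permutes_in_image[OF \<sigma>])
    have "\<sigma> 0 = 0" using permutes_not_in[OF \<sigma>, of 0] by simp
    then show "\<sigma> i = 0 \<longleftrightarrow> i = 0" using permutes_inj[OF \<sigma>] by (metis injD)
  qed
  then show ?thesis by (simp add: words_def del: atLeastAtMost_iff)
qed

text \<open>For alternating f the coboundary at (x, z) equals f z minus the sum of all
  \<open>f (z(s := x))\<close>: carrying x from the front to position s absorbs the sign of the
  face. So the identity expresses that the coboundary is zero.\<close>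

definition cocycle :: "nat \<Rightarrow> nat \<Rightarrow> nat set \<Rightarrow> ((nat \<Rightarrow> nat) \<Rightarrow> complex) \<Rightarrow> bool" where
  "cocycle d n A f \<longleftrightarrow> (\<forall>z\<in>words d n. \<forall>x\<in>{1..d}. f z = (\<Sum>s\<in>A. f (z(s := x))))"

text \<open>Functions of an \<open>n\<close>-tuple of points of \<open>{1..d}\<close> that are alternating cocycles in the positions
  \<open>A\<close> and in the positions \<open>B\<close>. For \<open>\<bar>A\<bar> = a + 1\<close> and \<open>\<bar>B\<bar> = b + 1\<close> this is a model of
  \<open>\<Lambda>\<^sup>a W \<otimes> \<Lambda>\<^sup>b W\<close> with \<open>W\<close> the standard representation.\<close>

definition cocycles :: "nat \<Rightarrow> nat \<Rightarrow> nat set \<Rightarrow> nat set \<Rightarrow> ((nat \<Rightarrow> nat) \<Rightarrow> complex) set" where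
  "cocycles d n A B = {f \<in> supported (words d n).
     alternating A f \<and> alternating B f \<and> cocycle d n A f \<and> cocycle d n B f}"

text \<open>The group acts on the values of a word; \<open>inv \<sigma>\<close> converts this left
  action on points into the right action expected of \<open>rep_move\<close>.\<close>

definition word_rep :: "((nat \<Rightarrow> nat) \<Rightarrow> complex) set \<Rightarrow> (nat \<Rightarrow> nat) rep" where
  "word_rep U = \<lparr>rep_space = U, rep_move = (\<lambda>\<sigma> z. inv \<sigma> \<circ> z)\<rparr>"

lemma act_word: "act (word_rep U) \<sigma> f z = f (inv \<sigma> \<circ> z)"
  by (simp add: act_def word_rep_def)

lemma subspace_cocycles: "cfun.subspace (cocycles d n A B)"
proof -
  have "cocycle d n A' 0" "cocycle d n A' f \<Longrightarrow> cocycle d n A' g \<Longrightarrow> cocycle d n A' (f + g)"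
    "cocycle d n A' f \<Longrightarrow> cocycle d n A' (cscale c f)" for A' f g c
    by (simp_all add: cocycle_def sum.distrib cscale_def sum_distrib_left[symmetric])
  moreover have "alternating A' 0" "alternating A' f \<Longrightarrow> alternating A' g \<Longrightarrow> alternating A' (f + g)"
    "alternating A' f \<Longrightarrow> alternating A' (cscale c f)" for A' f g c
    by (simp_all add: alternating_def cscale_def distrib_left mult.left_commute)
  ultimately show ?thesis
    using subspace_supported[of "words d n"] by (simp add: cocycles_def cfun.subspace_def)
qed

lemma act_cocycles:
  assumes "\<sigma> \<in> perms d" "f \<in> cocycles d n A B"
  shows "act (word_rep U) \<sigma> f \<in> cocycles d n A B"
proof -
  have inv: "inv \<sigma> \<in> perms d" using perms_inv[OF assms(1)] .
  have "inv \<sigma> \<circ> z(s := x) = (inv \<sigma> \<circ> z)(s := inv \<sigma> x)" for z :: "nat \<Rightarrow> nat" and s x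
    by (auto simp: fun_eq_iff)
  have "inv \<sigma> x \<in> {1..d}" if "x \<in> {1..d}" for x
    using inv permutes_in_image[of "inv \<sigma>" "{1..d}" x] that by (simp add: perms_def)
  have "cocycle d n A' (act (word_rep U) \<sigma> f)" if f: "cocycle d n A' f" for A'
    unfolding cocycle_def act_word
  proof (intro ballI)
    fix z x assume "z \<in> words d n" "x \<in> {1..d}"
    then have "inv \<sigma> \<circ> z \<in> words d n" "inv \<sigma> x \<in> {1..d}"
      using words_act[OF inv] \<open>\<And>x. x \<in> {1..d} \<Longrightarrow> inv \<sigma> x \<in> {1..d}\<close> by blast+
    then have "f (inv \<sigma> \<circ> z) = (\<Sum>s\<in>A'. f ((inv \<sigma> \<circ> z)(s := inv \<sigma> x)))"
      using f unfolding cocycle_def by blast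
    then show "f (inv \<sigma> \<circ> z) = (\<Sum>s\<in>A'. f (inv \<sigma> \<circ> z(s := x)))"
      by (simp only: \<open>\<And>z s x. inv \<sigma> \<circ> z(s := x) = (inv \<sigma> \<circ> z)(s := inv \<sigma> x)\<close>)
  qed
  then show ?thesis
    using assms(2) words_act[OF inv]
    by (auto simp: cocycles_def supported_def alternating_def act_word o_assoc)
qed

lemma function_rep_cocycles: "function_rep d (word_rep (cocycles d n A B)) (words d n)"
proof
  fix \<sigma> \<tau> :: "nat \<Rightarrow> nat" and z
  assume "\<sigma> permutes {1..d}" "\<tau> permutes {1..d}"
  then have "inv (\<sigma> \<circ> \<tau>) = inv \<tau> \<circ> inv \<sigma>"
    by (intro o_inv_distrib permutes_bij)
  then show "rep_move (word_rep (cocycles d n A B)) (\<sigma> \<circ> \<tau>) z =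
      rep_move (word_rep (cocycles d n A B)) \<tau> (rep_move (word_rep (cocycles d n A B)) \<sigma> z)"
    by (simp add: word_rep_def comp_assoc)
next
  fix \<sigma> z assume \<sigma>: "\<sigma> permutes {1..d}" and z: "z \<in> words d n"
  have "inv \<sigma> \<in> perms d" using permutes_inv[OF \<sigma>] by (simp add: perms_def)
  from words_act[OF this] z show "rep_move (word_rep (cocycles d n A B)) \<sigma> z \<in> words d n"
    by (simp add: word_rep_def)
next
  show "subrep d (word_rep (cocycles d n A B)) (rep_space (word_rep (cocycles d n A B)))"
    using subspace_cocycles act_cocycles unfolding subrep_def
    by (simp add: word_rep_def[of "cocycles d n A B", THEN arg_cong[of _ _ rep_space]] perms_def)
next
  show "rep_space (word_rep (cocycles d n A B)) \<subseteq> supported (words d n)"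
    by (auto simp: word_rep_def cocycles_def)
qed (simp_all add: finite_words word_rep_def)

section \<open>The exchange operator\<close>

text \<open>On functions alternating in A this is, up to the factor |A|!, antisymmetrization over A
  and m: one tensor factor is split off the exterior power of the other block and multiplied into
  that of A.\<close>

definition exchange :: "nat set \<Rightarrow> nat \<Rightarrow> ((nat \<Rightarrow> nat) \<Rightarrow> complex) \<Rightarrow> (nat \<Rightarrow> nat) \<Rightarrow> complex" where
  "exchange A m f z = f z - (\<Sum>s\<in>A. f (z \<circ> transpose m s))"

lemma clinear_exchange: "clinear (exchange A m)"
  by (rule clinearI)
    (auto simp: exchange_def fun_eq_iff cscale_def sum.distrib algebra_simps sum_distrib_left)

lemma exchange_act: "exchange A m (act (word_rep U) \<sigma> f) = act (word_rep V) \<sigma> (exchange A m f)"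
  by (simp add: fun_eq_iff exchange_def act_word o_assoc)

lemma exchange_alt_sum:
  assumes "finite A" "m \<notin> A" "alternating A f"
  shows "alt_sum (insert m A) f z = of_nat (fact (card A)) * exchange A m f z"
  unfolding alt_sum_insert[OF assms(1,2)] exchange_def
  by (simp add: alt_sum_alternating[OF assms(1,3)] right_diff_distrib sum_distrib_left)

lemma exchange_alternating:
  assumes "finite A" "m \<notin> A" "alternating A f"
  shows "alternating (insert m A) (exchange A m f)"
proof -
  have eq: "exchange A m f z = alt_sum (insert m A) f z / of_nat (fact (card A))" for z
    using exchange_alt_sum[OF assms, of z] by simp
  show ?thesis
    using alternating_alt_sum[of "insert m A" f] assms(1) unfolding alternating_def eq by simp
qed

text \<open>In both cocycle sums the terms caused by the loss or gain of m cancel against transposed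
  terms, through the A-cocycle identity of f with x at position m.\<close>

lemma exchange_cocycles:
  assumes AB: "A \<inter> B = {}" "A \<union> B \<subseteq> {..<n}" and m: "m \<in> B" and f: "f \<in> cocycles d n A B"
  shows "exchange A m f \<in> cocycles d n (insert m A) (B - {m})"
proof -
  have fin: "finite A" "finite B" using AB finite_subset by auto
  have mA: "m \<notin> A" using AB m by auto
  have lt: "p < n" if "p \<in> A \<or> p \<in> B" for p using that AB by auto
  have alt: "alternating A f" "alternating B f" and coc: "cocycle d n A f" "cocycle d n B f"
    and supp: "\<And>z. z \<notin> words d n \<Longrightarrow> f z = 0"
    using f by (auto simp: cocycles_def supported_def)
  have tw: "z \<circ> transpose m s \<in> words d n \<longleftrightarrow> z \<in> words d n" if "s \<in> A" for z s
    by (rule words_permute[of _ "{m, s}"]) (use lt m that in \<open>auto simp: permutes_swap_id\<close>)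
  have "exchange A m f \<in> supported (words d n)"
    using supp tw by (simp add: supported_def exchange_def)
  moreover have "alternating (insert m A) (exchange A m f)"
    using exchange_alternating fin mA alt by blast
  moreover have "alternating (B - {m}) (exchange A m f)"
    unfolding alternating_def
  proof (intro allI impI)
    fix \<pi> and z :: "nat \<Rightarrow> nat" assume \<pi>: "\<pi> permutes B - {m}"
    then have \<pi>B: "\<pi> permutes B" using permutes_subset by blast
    have "z \<circ> \<pi> \<circ> transpose m s = z \<circ> transpose m s \<circ> \<pi>" if "s \<in> A" for s :: nat and z :: "nat \<Rightarrow> nat"
    proof -
      have "(B - {m}) \<inter> {m, s} = {}" using AB that by auto
      from permutes_disjoint_commute[OF \<pi> permutes_swap_id[of m "{m, s}" s] this]
      show ?thesis by (simp add: comp_assoc)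
    qed
    then show "exchange A m f (z \<circ> \<pi>) = of_int (sign \<pi>) * exchange A m f z"
      by (simp add: exchange_def alternatingD[OF alt(2) \<pi>B] right_diff_distrib sum_distrib_left)
  qed
  \<comment> \<open>The A-cocycle identity at z(m := x), inserting the value z m that x has
    displaced.\<close>
  moreover have key: "f (z(m := x)) = (\<Sum>s\<in>A. f (z(m := x, s := z m)))"
    if "z \<in> words d n" "x \<in> {1..d}" for z x
  proof -
    have "z m \<in> {1..d}" using that(1) lt[of m] m by (simp add: words_def)
    moreover have "z(m := x) \<in> words d n" using words_update[OF that(1) _ that(2), of m] lt[of m] m by simp
    ultimately show ?thesis using coc(1) unfolding cocycle_def by blast
  qed
  have fA: "(\<Sum>s\<in>A. f (z(s := x))) = f z" and fB: "(\<Sum>s\<in>B. f (z(s := x))) = f z"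
    if "z \<in> words d n" "x \<in> {1..d}" for z x
    using coc that by (simp_all add: cocycle_def)
  have fB': "(\<Sum>s\<in>B - {m}. f (z(s := x))) = f z - f (z(m := x))"
    if "z \<in> words d n" "x \<in> {1..d}" for z x
    using fB[OF that] sum.remove[OF fin(2) m, of "\<lambda>s. f (z(s := x))"] by (simp add: algebra_simps)
  have last: "(z \<circ> transpose m s)(m := x) = z(m := x, s := z m)" if "s \<in> A" for z :: "nat \<Rightarrow> nat" and s x
    using that mA by (auto simp: fun_eq_iff transpose_def)
  moreover have "cocycle d n (B - {m}) (exchange A m f)"
    unfolding cocycle_def
  proof (intro ballI)
    fix z x assume z: "z \<in> words d n" and x: "x \<in> {1..d}"
    have tr: "z(r := x) \<circ> transpose m s = (z \<circ> transpose m s)(r := x)" if "s \<in> A" "r \<in> B - {m}" for r s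
      using that AB by (auto simp: fun_eq_iff transpose_def)
    have "(\<Sum>r\<in>B - {m}. exchange A m f (z(r := x))) = (\<Sum>r\<in>B - {m}. f (z(r := x))) -
        (\<Sum>r\<in>B - {m}. \<Sum>s\<in>A. f ((z \<circ> transpose m s)(r := x)))"
      unfolding exchange_def sum_subtractf
      by (intro arg_cong2[where f = minus] refl sum.cong) (simp only: tr)
    also have "(\<Sum>r\<in>B - {m}. \<Sum>s\<in>A. f ((z \<circ> transpose m s)(r := x))) =
        (\<Sum>s\<in>A. \<Sum>r\<in>B - {m}. f ((z \<circ> transpose m s)(r := x)))" by (rule sum.swap)
    also have "\<dots> = (\<Sum>s\<in>A. f (z \<circ> transpose m s) - f (z(m := x, s := z m)))"
      by (intro sum.cong refl) (simp add: fB' tw z x last del: atLeastAtMost_iff)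
    also have "\<dots> = (\<Sum>s\<in>A. f (z \<circ> transpose m s)) - f (z(m := x))"
      by (simp add: sum_subtractf key[OF z x])
    finally have eq: "(\<Sum>r\<in>B - {m}. exchange A m f (z(r := x))) = (\<Sum>r\<in>B - {m}. f (z(r := x))) -
        ((\<Sum>s\<in>A. f (z \<circ> transpose m s)) - f (z(m := x)))" .
    show "exchange A m f z = (\<Sum>r\<in>B - {m}. exchange A m f (z(r := x)))"
      unfolding eq fB'[OF z x] by (simp add: exchange_def)
  qed
  moreover have "cocycle d n (insert m A) (exchange A m f)"
    unfolding cocycle_def
  proof (intro ballI)
    fix z x assume z: "z \<in> words d n" and x: "x \<in> {1..d}"
    \<comment> \<open>Transposing m and s only renames the position that receives x. So this is a
      sum of substitutions into the transposed word, and its A-part is again a cocycle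
      identity.\<close>
    have swap: "(\<Sum>r\<in>insert m A. f (z(r := x) \<circ> transpose m s)) =
        f (z \<circ> transpose m s) + f (z(m := x, s := z m))" if s: "s \<in> A" for s
    proof -
      have 1: "z(r := x) \<circ> transpose m s =
          (z \<circ> transpose m s)((if r = m then s else if r = s then m else r) := x)" for r
        by (auto simp: fun_eq_iff transpose_def)
      have "(\<Sum>r\<in>insert m A. f (z(r := x) \<circ> transpose m s)) =
          (\<Sum>r\<in>insert m A. f ((z \<circ> transpose m s)(r := x)))"
        unfolding 1
        by (rule sum.reindex_bij_witness[of _ "\<lambda>r. if r = m then s else if r = s then m else r"
              "\<lambda>r. if r = m then s else if r = s then m else r"]) (use s in auto)
      also have "\<dots> = f ((z \<circ> transpose m s)(m := x)) + f (z \<circ> transpose m s)"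
        using fin mA fA[of "z \<circ> transpose m s" x] tw[OF s] z x by simp
      finally show ?thesis by (simp add: last[OF s])
    qed
    have "(\<Sum>r\<in>insert m A. exchange A m f (z(r := x))) = (\<Sum>r\<in>insert m A. f (z(r := x))) -
        (\<Sum>s\<in>A. \<Sum>r\<in>insert m A. f (z(r := x) \<circ> transpose m s))"
      unfolding exchange_def sum_subtractf by (subst sum.swap) simp
    also have "(\<Sum>s\<in>A. \<Sum>r\<in>insert m A. f (z(r := x) \<circ> transpose m s)) =
        (\<Sum>s\<in>A. f (z \<circ> transpose m s)) + f (z(m := x))"
      by (simp add: swap sum.distrib key[OF z x] cong: sum.cong)
    also have "(\<Sum>r\<in>insert m A. f (z(r := x))) = f (z(m := x)) + f z"
      using fin mA fA[OF z x] by simp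
    finally have eq: "(\<Sum>r\<in>insert m A. exchange A m f (z(r := x))) =
        f (z(m := x)) + f z - ((\<Sum>s\<in>A. f (z \<circ> transpose m s)) + f (z(m := x)))" .
    show "exchange A m f z = (\<Sum>r\<in>insert m A. exchange A m f (z(r := x)))"
      unfolding eq by (simp add: exchange_def)
  qed
  ultimately show ?thesis by (simp add: cocycles_def)
qed

text \<open>The antisymmetrizer is self-adjoint and its square is |A|! times itself, so the pairing
  is the square norm of \<open>alt_sum A f\<close> divided by |A|!.\<close>

lemma cinner_alt_sum_nonneg:
  assumes "A \<subseteq> {..<n}"
  shows "0 \<le> Re (cinner (words d n) f (alt_sum A f))"
proof -
  have fin: "finite A" using assms finite_subset by auto
  let ?X = "words d n"
  have move: "cinner ?X f (\<lambda>z. g (z \<circ> \<pi>)) = cinner ?X (\<lambda>z. f (z \<circ> inv \<pi>)) g" if \<pi>: "\<pi> permutes A" for f g \<pi>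
  proof -
    have id: "z \<circ> \<pi> \<circ> inv \<pi> = z" "z \<circ> inv \<pi> \<circ> \<pi> = z" for z :: "nat \<Rightarrow> nat"
      using permutes_inv_o[OF \<pi>] by (simp_all add: comp_assoc)
    have "bij_betw (\<lambda>z. z \<circ> \<pi>) ?X ?X"
      by (rule bij_betwI[of _ _ _ "\<lambda>z. z \<circ> inv \<pi>"])
        (auto simp: id words_permute[OF \<pi> assms] words_permute[OF permutes_inv[OF \<pi>] assms])
    from sum.reindex_bij_betw[OF this, of "\<lambda>z. f (z \<circ> inv \<pi>) * cnj (g z)"] show ?thesis
      by (simp add: cinner_def id)
  qed
  have alt: "alt_sum A f = (\<Sum>\<pi> | \<pi> permutes A. cscale (of_int (sign \<pi>)) (\<lambda>z. f (z \<circ> \<pi>)))" for f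
    by (simp add: fun_eq_iff sum_fun_apply alt_sum_def cscale_def)
  let ?g = "alt_sum A f"
  have "cinner ?X f (alt_sum A ?g) = (\<Sum>\<pi> | \<pi> permutes A. of_int (sign \<pi>) * cinner ?X (\<lambda>z. f (z \<circ> inv \<pi>)) ?g)"
    by (simp only: alt[of ?g] cinner_sum cinner_simps) (simp add: move)
  also have "\<dots> = (\<Sum>\<pi> | \<pi> permutes A. of_int (sign (inv \<pi>)) * cinner ?X (\<lambda>z. f (z \<circ> inv \<pi>)) ?g)"
    using permutes_imp_permutation[OF fin] by (intro sum.cong refl) (simp add: sign_inverse)
  also have "\<dots> = (\<Sum>\<pi> | \<pi> permutes A. of_int (sign \<pi>) * cinner ?X (\<lambda>z. f (z \<circ> \<pi>)) ?g)"
    by (rule sum.reindex_bij_witness[of _ inv inv]) (auto simp: permutes_inv permutes_inv_inv)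
  also have "\<dots> = cinner ?X ?g ?g"
  proof -
    have "cinner ?X ?g h = (\<Sum>\<pi> | \<pi> permutes A. of_int (sign \<pi>) * cinner ?X (\<lambda>z. f (z \<circ> \<pi>)) h)" for h
      by (simp only: alt[of f] cinner_sum cinner_simps)
    then show ?thesis by simp
  qed
  finally have eq: "cinner ?X f (alt_sum A ?g) = cinner ?X ?g ?g" .
  have "alt_sum A ?g = cscale (of_nat (fact (card A))) ?g"
    using alt_sum_alternating[OF fin alternating_alt_sum[OF fin]] by (simp add: fun_eq_iff cscale_def)
  with eq have "of_nat (fact (card A)) * cinner ?X f ?g = cinner ?X ?g ?g"
    by (simp add: cinner_simps)
  then have "Re (of_nat (fact (card A)) * cinner ?X f ?g) = (\<Sum>x\<in>?X. (cmod (?g x))\<^sup>2)"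
    by (simp add: cinner_self)
  then have "fact (card A) * Re (cinner ?X f ?g) = (\<Sum>x\<in>?X. (cmod (?g x))\<^sup>2)" by simp
  moreover have "0 \<le> (\<Sum>x\<in>?X. (cmod (?g x))\<^sup>2)" by (simp add: sum_nonneg)
  ultimately show ?thesis
    by (metis fact_gt_zero zero_le_mult_iff not_less order.strict_implies_order)
qed

text \<open>If \<open>f\<close> is killed, then exchanging any fixed position of \<open>B\<close> with the positions of \<open>A\<close> reproduces
  \<open>f\<close>, so the operators \<open>exchange B s\<close> with \<open>s \<in> A\<close> add up to the scalar \<open>\<bar>A\<bar> - \<bar>B\<bar>\<close> on \<open>f\<close>. But each
  of them is a positive multiple of an orthogonal projection.\<close>

lemma exchange_injective:
  assumes AB: "A \<inter> B = {}" "A \<union> B \<subseteq> {..<n}" and m: "m \<in> B" and f: "f \<in> cocycles d n A B"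
    and less: "card A < card B" and zero: "exchange A m f = 0"
  shows "f = 0"
proof -
  let ?X = "words d n"
  have fin: "finite A" "finite B" using AB finite_subset by auto
  have alt: "alternating A f" "alternating B f" and supp: "f \<in> supported ?X"
    using f by (auto simp: cocycles_def)
  have m_eq: "f z = (\<Sum>s\<in>A. f (z \<circ> transpose m s))" for z
    using fun_cong[OF zero, of z] by (simp add: exchange_def)
  \<comment> \<open>The relation at m passes to any other t in B by conjugation with the
    transposition of m and t, which changes the sign of f on both sides.\<close>
  have t_eq: "f z = (\<Sum>s\<in>A. f (z \<circ> transpose s t))" if t: "t \<in> B" for t z
  proof (cases "t = m")
    case True
    then show ?thesis using m_eq[of z] by (simp add: transpose_commute)
  next
    case False
    have "- f z = f (z \<circ> transpose m t)"
      using alternating_transpose[OF alt(2) m t] False by simp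
    also have "\<dots> = (\<Sum>s\<in>A. f (z \<circ> transpose m t \<circ> transpose m s))" by (rule m_eq)
    also have "\<dots> = (\<Sum>s\<in>A. - f (z \<circ> transpose s t))"
    proof (rule sum.cong[OF refl])
      fix s assume "s \<in> A"
      then have "s \<noteq> m" "s \<noteq> t" using AB m t by auto
      then have "transpose m t \<circ> transpose m s = transpose s t \<circ> transpose m t"
        using False by (auto simp: fun_eq_iff transpose_def)
      then have "z \<circ> transpose m t \<circ> transpose m s = z \<circ> transpose s t \<circ> transpose m t"
        by (simp add: comp_assoc)
      then show "f (z \<circ> transpose m t \<circ> transpose m s) = - f (z \<circ> transpose s t)"
        using alternating_transpose[OF alt(2) m t] False by simp
    qed
    finally show ?thesis by (simp add: sum_negf)
  qed
  \<comment> \<open>Adding up the relations for all t in B and swapping the sums regroups the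
    transpositions into exchanges of single s in A with all of B.\<close>
  have "(\<Sum>s\<in>A. exchange B s f) = cscale (of_nat (card A) - of_nat (card B)) f"
  proof
    fix z
    have "of_nat (card B) * f z = (\<Sum>t\<in>B. f z)" by simp
    also have "\<dots> = (\<Sum>t\<in>B. \<Sum>s\<in>A. f (z \<circ> transpose s t))" by (intro sum.cong refl t_eq)
    also have "\<dots> = (\<Sum>s\<in>A. \<Sum>t\<in>B. f (z \<circ> transpose s t))" by (rule sum.swap)
    finally show "(\<Sum>s\<in>A. exchange B s f) z = cscale (of_nat (card A) - of_nat (card B)) f z"
      by (simp add: sum_fun_apply exchange_def sum_subtractf cscale_def left_diff_distrib)
  qed
  then have "(\<Sum>s\<in>A. cinner ?X f (exchange B s f)) =
      cnj (of_nat (card A) - of_nat (card B)) * cinner ?X f f"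
    by (simp add: cinner_sum(2)[symmetric] cinner_simps)
  then have "(\<Sum>s\<in>A. Re (cinner ?X f (exchange B s f))) =
      (real (card A) - real (card B)) * (\<Sum>x\<in>?X. (cmod (f x))\<^sup>2)"
  proof -
    assume "(\<Sum>s\<in>A. cinner ?X f (exchange B s f)) =
      cnj (of_nat (card A) - of_nat (card B)) * cinner ?X f f"
    from arg_cong[OF this, of Re] show ?thesis
      unfolding cinner_self by (simp add: Re_sum del: of_real_sum)
  qed
  moreover have "0 \<le> Re (cinner ?X f (exchange B s f))" if s: "s \<in> A" for s
  proof -
    have "s \<notin> B" using s AB by auto
    then have "alt_sum (insert s B) f = cscale (of_nat (fact (card B))) (exchange B s f)"
      using exchange_alt_sum[OF fin(2) _ alt(2)] by (simp add: fun_eq_iff cscale_def)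
    moreover have "0 \<le> Re (cinner ?X f (alt_sum (insert s B) f))"
      by (rule cinner_alt_sum_nonneg) (use AB s in auto)
    ultimately have "0 \<le> fact (card B) * Re (cinner ?X f (exchange B s f))"
      by (simp add: cinner_simps)
    then show ?thesis
      by (metis fact_gt_zero zero_le_mult_iff not_less order.strict_implies_order)
  qed
  \<comment> \<open>A sum of nonnegative terms equals a negative multiple of the square norm of f,
    which must therefore be 0.\<close>
  ultimately have "0 \<le> (real (card A) - real (card B)) * (\<Sum>x\<in>?X. (cmod (f x))\<^sup>2)"
    by (metis sum_nonneg)
  then have "(\<Sum>x\<in>?X. (cmod (f x))\<^sup>2) \<le> 0"
    using less by (simp add: zero_le_mult_iff)
  moreover have "0 \<le> (\<Sum>x\<in>?X. (cmod (f x))\<^sup>2)" by (simp add: sum_nonneg)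
  ultimately have "cinner ?X f f = 0" by (simp add: cinner_self)
  then show ?thesis using supported_cinner_0[OF finite_words supp] by blast
qed

section \<open>Tensor products of hook Specht modules as cocycles\<close>

text \<open>The blocks keep the form {k..k + a}, with k = 0 and k = Suc a, to match the positions
  occurring in \<open>hook_polytabloid\<close>.\<close>

definition hook_cocycles :: "nat \<Rightarrow> nat \<Rightarrow> nat \<Rightarrow> ((nat \<Rightarrow> nat) \<Rightarrow> complex) set" where
  "hook_cocycles d a b = cocycles d (a + b + 2) {0..0 + a} {Suc a..Suc a + b}"

text \<open>At a word z this is the pairing of F with the tensor product of the two polytabloids of
  z. Among functions on pairs of tabloids its kernel is the orthogonal complement of the tensor
  product of the two Specht modules.\<close>

definition theta :: "nat \<Rightarrow> nat \<Rightarrow> nat \<Rightarrow> ((nat \<Rightarrow> nat) \<times> (nat \<Rightarrow> nat) \<Rightarrow> complex) \<Rightarrow>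
    (nat \<Rightarrow> nat) \<Rightarrow> complex" where
  "theta d a b F z = (if z \<in> words d (a + b + 2) then alt_sum {0..0 + a} (alt_sum {Suc a..Suc a + b}
     (\<lambda>y. F (hook_tabloid 0 a y, hook_tabloid (Suc a) b y))) z else 0)"

lemma cocycleD:
  "cocycle d n A f \<Longrightarrow> z \<in> words d n \<Longrightarrow> x \<in> {1..d} \<Longrightarrow> f z = (\<Sum>s\<in>A. f (z(s := x)))"
  by (simp add: cocycle_def)

lemma clinear_alt_sum: "clinear (alt_sum A)"
  by (rule clinearI)
    (auto simp: alt_sum_def fun_eq_iff cscale_def sum.distrib algebra_simps sum_distrib_left)

lemma clinear_theta: "clinear (theta d a b)"
proof -
  let ?P = "\<lambda>F. alt_sum {0..0 + a} (alt_sum {Suc a..Suc a + b}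
    (\<lambda>y. F (hook_tabloid 0 a y, hook_tabloid (Suc a) b y)))"
  have "clinear (\<lambda>F y. F (hook_tabloid 0 a y, hook_tabloid (Suc a) b y) :: complex)"
    by (rule clinearI) (auto simp: fun_eq_iff cscale_def)
  then have "clinear ?P"
    by (intro clinear_compose[OF clinear_alt_sum] clinear_compose[OF clinear_alt_sum])
  then have "?P (F + G) = ?P F + ?P G" "?P (cscale c F) = cscale c (?P F)" for F G c
    unfolding clinear_def by blast+
  then show ?thesis
    by (intro clinearI ext) (simp_all only: theta_def plus_fun_apply cscale_def split: if_split, simp_all)
qed

lemma theta_act:
  assumes "\<sigma> \<in> perms d"
  shows "theta d a b (act (tensor_rep (specht \<alpha>) (specht \<beta>)) \<sigma> F) = act (word_rep U) \<sigma> (theta d a b F)"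
proof
  fix z
  have inv: "inv \<sigma> \<in> perms d" "inv (inv \<sigma>) = \<sigma>"
    using assms perms_inv by (auto simp: perms_def permutes_inv_inv)
  have "bij (inv \<sigma>)" using inv by (simp add: perms_def permutes_bij)
  then have tab: "hook_tabloid k c (inv \<sigma> \<circ> y) = hook_tabloid k c y \<circ> \<sigma>" for k c y
    using hook_tabloid_compose[of "inv \<sigma>"] inv by simp
  have alt: "alt_sum A (\<lambda>y. f (inv \<sigma> \<circ> y)) = (\<lambda>y. alt_sum A f (inv \<sigma> \<circ> y))" for A f
    by (simp add: alt_sum_def fun_eq_iff o_assoc)
  show "theta d a b (act (tensor_rep (specht \<alpha>) (specht \<beta>)) \<sigma> F) z =
      act (word_rep U) \<sigma> (theta d a b F) z"
    unfolding theta_def act_word words_act[OF inv(1)]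
    by (simp add: act_def tensor_rep_def specht_def tab[symmetric])
      (simp add: alt alt[of _ "\<lambda>y. F (hook_tabloid 0 a y, hook_tabloid (Suc a) b y)"]
        alt[of _ "alt_sum _ (\<lambda>y. F (hook_tabloid 0 a y, hook_tabloid (Suc a) b y))"])
qed

lemma theta_in_cocycles: "theta d a b F \<in> hook_cocycles d a b"
proof -
  let ?A = "{0..0 + a}" and ?B = "{Suc a..Suc a + b}" and ?n = "a + b + 2"
  let ?h = "\<lambda>y. F (hook_tabloid 0 a y, hook_tabloid (Suc a) b y)"
  have sub: "?A \<subseteq> {..<?n}" "?B \<subseteq> {..<?n}" by auto
  let ?g = "alt_sum ?A (alt_sum ?B ?h)"
  have comm: "?g = alt_sum ?B (alt_sum ?A ?h)" by (rule alt_sum_commute) auto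
  \<comment> \<open>The two corner positions and the first position beyond the word are invisible to
    both tabloids; they serve as the ignored positions p and m in
    \<open>alt_sum_cocycle\<close>.\<close>
  have ign: "?h (y(p := x)) = ?h y" if "p = 0 \<or> p = Suc a \<or> p = ?n" for y p x
    using that by (intro arg_cong[of _ _ F] arg_cong2[of _ _ _ _ Pair] hook_tabloid_cong) auto
  have alt: "alternating A (theta d a b F)" if "alternating A ?g" "A \<subseteq> {..<?n}" for A
    using that(1) words_permute[OF _ that(2)] unfolding alternating_def theta_def by simp
  have coc: "cocycle d ?n A (theta d a b F)"
    if A: "A \<subseteq> {..<?n}" and g: "\<And>z x. ?g z = (\<Sum>s\<in>A. ?g (z(s := x)))" for A
    unfolding cocycle_def
  proof (intro ballI)
    fix z x assume z: "z \<in> words d ?n" "x \<in> {1..d}"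
    then have "theta d a b F z = (\<Sum>s\<in>A. ?g (z(s := x)))"
      unfolding theta_def using g by simp
    also have "\<dots> = (\<Sum>s\<in>A. theta d a b F (z(s := x)))"
      by (intro sum.cong refl) (use words_update[OF z(1) _ z(2)] A in \<open>auto simp: theta_def\<close>)
    finally show "theta d a b F z = (\<Sum>s\<in>A. theta d a b F (z(s := x)))" .
  qed
  have "alternating ?A ?g" by (rule alternating_alt_sum) simp
  moreover have "alternating ?B ?g" unfolding comm by (rule alternating_alt_sum) simp
  moreover have "?g z = (\<Sum>s\<in>?A. ?g (z(s := x)))" for z x
    by (rule alt_sum_cocycle[of _ 0 ?n]) (auto intro!: alt_sum_ignores ign)
  moreover have "?g z = (\<Sum>s\<in>?B. ?g (z(s := x)))" for z x
    unfolding comm by (rule alt_sum_cocycle[of _ "Suc a" ?n]) (auto intro!: alt_sum_ignores ign)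
  ultimately show ?thesis
    unfolding hook_cocycles_def cocycles_def
    using alt sub coc by (simp add: supported_def theta_def)
qed

lemma hook_polytabloid_delta:
  "hook_polytabloid k a z =
    (\<Sum>\<pi> | \<pi> permutes {k..k + a}. cscale (of_int (sign \<pi>)) (delta (hook_tabloid k a (z \<circ> \<pi>))))"
  by (simp add: fun_eq_iff sum_fun_apply hook_polytabloid_def alt_sum_def cscale_def delta_def)

lemma theta_cinner:
  assumes "finite X" "F \<in> supported X" "z \<in> words d (a + b + 2)"
  shows "theta d a b F z =
    cinner X F (tensor_fun (hook_polytabloid 0 a z) (hook_polytabloid (Suc a) b z))"
proof -
  let ?A = "{0..0 + a}" and ?B = "{Suc a..Suc a + b}"
  have del: "cinner X F (delta x) = F x" for x
  proof -
    have "cinner X F (delta x) = (\<Sum>y\<in>X. if y = x then F y else 0)"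
      unfolding cinner_def delta_def by (intro sum.cong) auto
    then show ?thesis using assms(1,2) unfolding supported_def by (cases x) simp
  qed
  have tens: "tensor_fun (delta x) (delta y) = delta (x, y)" for x y :: "nat \<Rightarrow> nat"
    by (auto simp: tensor_fun_def delta_def fun_eq_iff)
  have tab: "hook_tabloid 0 a (z \<circ> \<pi> \<circ> \<rho>) = hook_tabloid 0 a (z \<circ> \<pi>) \<and>
      hook_tabloid (Suc a) b (z \<circ> \<pi> \<circ> \<rho>) = hook_tabloid (Suc a) b (z \<circ> \<rho>)"
    if \<pi>: "\<pi> permutes ?A" and \<rho>: "\<rho> permutes ?B" for \<pi> \<rho>
  proof (intro conjI hook_tabloid_cong)
    fix p assume "p \<in> {0<..0 + a}"
    then have "\<rho> p = p" using permutes_not_in[OF \<rho>, of p] by auto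
    then show "(z \<circ> \<pi> \<circ> \<rho>) p = (z \<circ> \<pi>) p" by simp
  next
    fix p assume "p \<in> {Suc a<..Suc a + b}"
    then have "\<rho> p \<in> ?B" using permutes_in_image[OF \<rho>, of p] by auto
    then have "\<pi> (\<rho> p) = \<rho> p" using permutes_not_in[OF \<pi>, of "\<rho> p"] by auto
    then show "(z \<circ> \<pi> \<circ> \<rho>) p = (z \<circ> \<rho>) p" by simp
  qed
  have "theta d a b F z = (\<Sum>\<pi> | \<pi> permutes ?A. \<Sum>\<rho> | \<rho> permutes ?B. of_int (sign \<pi>) *
      (of_int (sign \<rho>) * F (hook_tabloid 0 a (z \<circ> \<pi>), hook_tabloid (Suc a) b (z \<circ> \<rho>))))"
    using assms(3) unfolding theta_def alt_sum_def sum_distrib_left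
    by (simp only: if_True) (intro sum.cong refl, use tab in simp)
  also have "\<dots> = cinner X F (tensor_fun (hook_polytabloid 0 a z) (hook_polytabloid (Suc a) b z))"
    unfolding hook_polytabloid_delta clinearD(5)[OF clinear_tensor_fun(1)]
      clinearD(5)[OF clinear_tensor_fun(2)] clinearD(2)[OF clinear_tensor_fun(1)]
      clinearD(2)[OF clinear_tensor_fun(2)] cinner_sum cinner_simps tens del
    by (subst sum.swap) (simp add: mult.left_commute sum_distrib_left)
  finally show ?thesis .
qed

text \<open>The contracting homotopy at the point 1: F maps a pair of hook tabloids to g at the word
  having their column tails and 1 in both corners. Antisymmetrizing fills each position of a block
  in turn with 1, and the cocycle identity adds this up to g; permutations of the other positions
  account for K.\<close>

lemma theta_surjective:
  assumes g: "g \<in> hook_cocycles d a b" and "finite X" "1 \<le> d"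
    and X: "\<And>z. z \<in> words d (a + b + 2) \<Longrightarrow> inj_on z {0..0 + a} \<Longrightarrow> inj_on z {Suc a..Suc a + b} \<Longrightarrow>
      (hook_tabloid 0 a z, hook_tabloid (Suc a) b z) \<in> X"
  shows "\<exists>F\<in>supported X. theta d a b F = g"
proof -
  let ?A = "{0..0 + a}" and ?B = "{Suc a..Suc a + b}" and ?n = "a + b + 2"
  have sub: "?A \<subseteq> {..<?n}" "?B \<subseteq> {..<?n}" by auto
  have alt: "alternating ?A g" "alternating ?B g" and coc: "cocycle d ?n ?A g" "cocycle d ?n ?B g"
    and supp: "\<And>z. z \<notin> words d ?n \<Longrightarrow> g z = 0"
    using g by (auto simp: hook_cocycles_def cocycles_def supported_def)
  have one: "1 \<in> {1..d}" using assms(3) by simp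
  \<comment> \<open>Reads the tails back from the tabloids. \<open>THE\<close> picks the unique
    entry of a row when the tabloids come from words injective on each block, the case in which the
    value is computed.\<close>
  define word where "word w w' p = (if p = 0 \<or> p = Suc a then 1
     else if p \<le> a then THE i. w i = p
     else if p \<le> Suc a + b then THE i. w' i = p - Suc a else 0)" for w w' :: "nat \<Rightarrow> nat" and p :: nat
  define K :: complex where "K = of_nat (fact a) * of_nat (fact b)"
  have K: "K \<noteq> 0" by (simp add: K_def)
  define F where "F = (\<lambda>(w, w'). if (w, w') \<in> X then g (word w w') / K else 0)"
  have F: "F (hook_tabloid 0 a y, hook_tabloid (Suc a) b y) = g (y(0 := 1, Suc a := 1)) / K"
    if y: "y \<in> words d ?n" "inj_on y ?A" "inj_on y ?B" for y
  proof -
    have the: "(THE i. hook_tabloid k c y i = s) = y (k + s)"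
      if "inj_on y {k..k + c}" "s \<in> {1..c}" for k c s
    proof (rule the_equality)
      show "hook_tabloid k c y (y (k + s)) = s" using hook_tabloid_inj that by simp
      show "i = y (k + s)" if "hook_tabloid k c y i = s" for i
        using hook_tabloid_eqD[OF that] \<open>s \<in> {1..c}\<close> by auto
    qed
    have "word (hook_tabloid 0 a y) (hook_tabloid (Suc a) b y) = y(0 := 1, Suc a := 1)"
    proof
      fix p
      show "word (hook_tabloid 0 a y) (hook_tabloid (Suc a) b y) p = (y(0 := 1, Suc a := 1)) p"
      proof -
        consider "p = 0 \<or> p = Suc a" | "p \<in> {1..a}" | "Suc a < p" "p - Suc a \<in> {1..b}" | "?n \<le> p"
          by atomize_elim (simp, arith)
        then show ?thesis
          using the[OF y(2), of p] the[OF y(3), of "p - Suc a"] y(1)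
          by cases (auto simp: word_def words_def)
      qed
    qed
    then show ?thesis using X[OF y] by (simp add: F_def)
  qed
  have "theta d a b F z = g z" for z
  proof -
    \<comment> \<open>On words with a repetition inside a block both sides vanish by
      alternation.\<close>
    consider "z \<notin> words d ?n" | S where "S = ?A \<or> S = ?B" "\<not> inj_on z S"
      | "z \<in> words d ?n" "inj_on z ?A" "inj_on z ?B" by blast
    then show ?thesis
    proof cases
      case 1
      then show ?thesis using supp by (simp add: theta_def)
    next
      case 2
      then obtain p q where "p \<in> S" "q \<in> S" "p \<noteq> q" "z p = z q" by (auto simp: inj_on_def)
      moreover have "alternating S (theta d a b F)" "alternating S g"
        using 2(1) alt theta_in_cocycles[of d a b F] by (auto simp: hook_cocycles_def cocycles_def)
      ultimately show ?thesis
        using alternating_eq_0[of S "theta d a b F" p q z] alternating_eq_0[of S g p q z] by simp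
    next
      case 3
      have perm: "z \<circ> \<pi> \<in> words d ?n \<and> inj_on (z \<circ> \<pi>) ?A \<and> inj_on (z \<circ> \<pi>) ?B"
        if z: "z \<in> words d ?n" "inj_on z ?A" "inj_on z ?B" and \<pi>: "\<pi> permutes ?A \<or> \<pi> permutes ?B" for z \<pi>
      proof -
        have "\<pi> ` ?A = ?A \<and> \<pi> ` ?B = ?B"
        proof (rule disjE[OF \<pi>])
          assume \<pi>: "\<pi> permutes ?A"
          then have "\<pi> p = p" if "p \<in> ?B" for p using permutes_not_in[OF \<pi>, of p] that by auto
          then show ?thesis using permutes_image[OF \<pi>] by (auto simp: image_iff)
        next
          assume \<pi>: "\<pi> permutes ?B"
          then have "\<pi> p = p" if "p \<in> ?A" for p using permutes_not_in[OF \<pi>, of p] that by auto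
          then show ?thesis using permutes_image[OF \<pi>] by (auto simp: image_iff)
        qed
        moreover have "inj \<pi>" using \<pi> permutes_inj by blast
        ultimately have "inj_on (z \<circ> \<pi>) ?A" "inj_on (z \<circ> \<pi>) ?B"
          using z by (auto intro!: comp_inj_on intro: inj_on_subset)
        then show ?thesis using words_permute[of \<pi>] z \<pi> sub by blast
      qed
      have inner: "alt_sum ?B (\<lambda>u. F (hook_tabloid 0 a u, hook_tabloid (Suc a) b u)) y =
          of_nat (fact b) * g (y(0 := 1)) / K" if y: "y \<in> words d ?n" "inj_on y ?A" "inj_on y ?B" for y
      proof -
        have "alt_sum ?B (\<lambda>u. F (hook_tabloid 0 a u, hook_tabloid (Suc a) b u)) y =
            (\<Sum>\<rho> | \<rho> permutes ?B. of_int (sign \<rho>) * g ((y(0 := 1) \<circ> \<rho>)(Suc a := 1)) / K)"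
          unfolding alt_sum_def
        proof (intro sum.cong refl)
          fix \<rho> assume "\<rho> \<in> {\<rho>. \<rho> permutes ?B}"
          then have \<rho>: "\<rho> permutes ?B" by simp
          have "y \<circ> \<rho> \<in> words d ?n" "inj_on (y \<circ> \<rho>) ?A" "inj_on (y \<circ> \<rho>) ?B"
            using perm[OF y disjI2[OF \<rho>]] by simp_all
          moreover have "(y \<circ> \<rho>)(0 := 1) = y(0 := 1) \<circ> \<rho>"
            by (rule update_compose_perm[OF \<rho>, symmetric]) simp
          ultimately show "of_int (sign \<rho>) * F (hook_tabloid 0 a (y \<circ> \<rho>), hook_tabloid (Suc a) b (y \<circ> \<rho>)) =
              of_int (sign \<rho>) * g ((y(0 := 1) \<circ> \<rho>)(Suc a := 1)) / K"
            by (simp add: F)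
        qed
        also have "\<dots> = alt_sum ?B (\<lambda>u. g (u(Suc a := 1))) (y(0 := 1)) / K"
          by (simp add: alt_sum_def sum_divide_distrib)
        also have "alt_sum ?B (\<lambda>u. g (u(Suc a := 1))) (y(0 := 1)) =
            of_nat (fact b) * (\<Sum>s\<in>?B. g (y(0 := 1, s := 1)))"
          using alt_sum_fill[OF _ _ alt(2), of "Suc a"] by simp
        also have "(\<Sum>s\<in>?B. g (y(0 := 1, s := 1))) = g (y(0 := 1))"
        proof -
          have "y(0 := 1) \<in> words d ?n" by (rule words_update[OF y(1) _ one]) simp
          from cocycleD[OF coc(2) this one] show ?thesis by simp
        qed
        finally show ?thesis .
      qed
      have "theta d a b F z = (\<Sum>\<pi> | \<pi> permutes ?A. of_int (sign \<pi>) *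
          (of_nat (fact b) * g ((z \<circ> \<pi>)(0 := 1)) / K))"
        using 3(1) unfolding theta_def
        by (simp only: if_True alt_sum_def[of ?A]) (intro sum.cong refl, use perm[OF 3] inner in simp)
      also have "\<dots> = of_nat (fact b) / K * alt_sum ?A (\<lambda>u. g (u(0 := 1))) z"
        by (simp add: alt_sum_def sum_distrib_left mult_ac)
      also have "alt_sum ?A (\<lambda>u. g (u(0 := 1))) z = of_nat (fact a) * (\<Sum>s\<in>?A. g (z(s := 1)))"
        using alt_sum_fill[OF _ _ alt(1), of 0] by simp
      also have "(\<Sum>s\<in>?A. g (z(s := 1))) = g z"
        by (rule cocycleD[OF coc(1) 3(1) one, symmetric])
      finally show ?thesis using K by (simp add: K_def)
    qed
  qed
  then have "theta d a b F = g" by (rule ext)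
  moreover have "F \<in> supported X" by (auto simp: F_def supported_def)
  ultimately show ?thesis by blast
qed

section \<open>Dimensions of symmetrizer images on cocycles\<close>

lemma dim_symmetrizer_image:
  assumes "clinear \<phi>" "inj_on \<phi> U" "function_rep d R X" "rep_space R = U"
    "\<And>\<sigma> u. \<sigma> \<in> perms d \<Longrightarrow> \<phi> (act R \<sigma> u) = act S \<sigma> (\<phi> u)" "C \<subseteq> perms d" "G \<subseteq> perms d"
  shows "cfun.dim (symmetrizer C G S ` \<phi> ` U) = cfun.dim (symmetrizer C G R ` U)"
proof -
  interpret function_rep d R X by fact
  have U: "subrep d R U" "cfun.subspace U" using assms(4) space_subrep by (auto simp: subrep_def)
  have inter: "intertwines d U R S \<phi>" by (rule clinear_intertwines[OF assms(1,5)])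
  have "symmetrizer C G S ` \<phi> ` U = \<phi> ` symmetrizer C G R ` U"
    unfolding image_image
    by (intro image_cong refl) (simp add: symmetrizer_intertwines[OF inter U(1) assms(6,7)])
  moreover have sub: "symmetrizer C G R ` U \<subseteq> U"
    using symmetrizer_in_subrep[OF U(1) assms(6,7)] by blast
  ultimately show ?thesis
    using dim_clinear_image[OF assms(1) inj_on_subset[OF assms(2) sub]
        clinear_subspace_image[OF clinear_symmetrizer U(2)] finite_points]
      subrep_supported[OF U(1)] by auto
qed

lemma symmetrizer_word_rep: "symmetrizer C G (word_rep U) = symmetrizer C G (word_rep V)"
  using symmetrizer_rep_space[of C G V "word_rep U"] by (simp add: word_rep_def)

text \<open>C and t can stay fixed while d varies: the degree enters through the row group and the
  cocycles. The action in \<open>word_rep\<close> is the same formula on every space, hence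
  \<open>UNIV\<close>.\<close>

definition hook_dim :: "(nat \<Rightarrow> nat) set \<Rightarrow> (nat \<Rightarrow> nat) \<Rightarrow> nat \<Rightarrow> nat \<Rightarrow> nat \<Rightarrow> nat" where
  "hook_dim C t d a b =
    cfun.dim (symmetrizer C (row_group d t) (word_rep UNIV) ` hook_cocycles d a b)"

lemma hook_cocycles_supported: "hook_cocycles d a b \<subseteq> supported (words d (a + b + 2))"
  by (auto simp: hook_cocycles_def cocycles_def)

text \<open>\<open>theta\<close> is an equivariant isomorphism from the tensor product onto the
  cocycles. An element of the tensor product in its kernel is orthogonal to the tensor product,
  hence to itself; and projecting a preimage orthogonally into the tensor product does not change
  its image.\<close>

lemma kronecker_hooks:
  assumes "tableau \<gamma> T" "sum_list \<gamma> = d" "a < d" "b < d"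
  shows "kronecker (hook d a) (hook d b) \<gamma> =
    hook_dim (column_group d (tableau.col \<gamma> T)) (tabloid \<gamma> T) d a b"
proof -
  let ?n = "a + b + 2"
  let ?A = "{0..0 + a}" and ?B = "{Suc a..Suc a + b}"
  obtain X where X: "function_rep d (specht (hook d a)) X"
    "\<And>z. inj_on z ?A \<Longrightarrow> z ` ?A \<subseteq> {1..d} \<Longrightarrow> hook_tabloid 0 a z \<in> X"
    "rep_space (specht (hook d a)) = cfun.span (hook_polytabloid 0 a ` {z. z ` ?A \<subseteq> {1..d}})"
    using hook_specht[OF assms(3)] by blast
  obtain Y where Y: "function_rep d (specht (hook d b)) Y"
    "\<And>z. inj_on z ?B \<Longrightarrow> z ` ?B \<subseteq> {1..d} \<Longrightarrow> hook_tabloid (Suc a) b z \<in> Y"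
    "rep_space (specht (hook d b)) = cfun.span (hook_polytabloid (Suc a) b ` {z. z ` ?B \<subseteq> {1..d}})"
    using hook_specht[OF assms(4)] by blast
  let ?R = "tensor_rep (specht (hook d a)) (specht (hook d b))"
  interpret R: function_rep d ?R "X \<times> Y" by (rule function_rep_tensor[OF X(1) Y(1)])
  let ?e = "\<lambda>z. tensor_fun (hook_polytabloid 0 a z) (hook_polytabloid (Suc a) b z)"
  have words_image: "z ` ?A \<subseteq> {1..d}" "z ` ?B \<subseteq> {1..d}" if "z \<in> words d ?n" for z
    using that by (auto simp: words_def)
  have span: "rep_space ?R = cfun.span (?e ` words d ?n)"
    unfolding tensor_rep_space X(3) Y(3) tensor_span
  proof (rule arg_cong[of _ _ cfun.span], intro subset_antisym subsetI)
    fix f assume "f \<in> {tensor_fun f g |f g. f \<in> hook_polytabloid 0 a ` {z. z ` ?A \<subseteq> {1..d}} \<and>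
        g \<in> hook_polytabloid (Suc a) b ` {z. z ` ?B \<subseteq> {1..d}}}"
    then obtain z z' where z: "z ` ?A \<subseteq> {1..d}" "z' ` ?B \<subseteq> {1..d}"
      "f = tensor_fun (hook_polytabloid 0 a z) (hook_polytabloid (Suc a) b z')" by blast
    \<comment> \<open>The two blocks of positions are disjoint, so two independent words merge into
      one.\<close>
    define y where "y p = (if p \<in> ?A then z p else if p \<in> ?B then z' p else 0)" for p
    have "y p \<in> {1..d}" if "p < ?n" for p
    proof (cases "p \<in> ?A")
      case False
      then have "p \<in> ?B" using that by auto
      then show ?thesis using False z(2) by (auto simp: y_def simp del: atLeastAtMost_iff)
    qed (use z(1) in \<open>auto simp: y_def simp del: atLeastAtMost_iff\<close>)
    then have "y \<in> words d ?n" by (simp add: words_def) (simp add: y_def)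
    moreover have "hook_polytabloid 0 a z = hook_polytabloid 0 a y"
      "hook_polytabloid (Suc a) b z' = hook_polytabloid (Suc a) b y"
      by (auto intro!: hook_polytabloid_cong simp: y_def)
    ultimately show "f \<in> ?e ` words d ?n" unfolding z(3) by (intro image_eqI[of _ _ y]) simp_all
  qed (use words_image in blast)
  have th: "theta d a b F z = cinner (X \<times> Y) F (?e z)"
    if "F \<in> supported (X \<times> Y)" "z \<in> words d ?n" for F z
    by (rule theta_cinner[OF R.finite_points that])
  have kernel: "cinner (X \<times> Y) F u = 0"
    if "F \<in> supported (X \<times> Y)" "theta d a b F = 0" "u \<in> rep_space ?R" for F u
  proof -
    have "rep_space ?R \<subseteq> {u. cinner (X \<times> Y) F u = 0}"
      unfolding span
      by (rule cfun.span_minimal)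
        (use th[OF that(1), symmetric] that(2) in \<open>auto simp: cfun.subspace_def cinner_simps\<close>)
    then show ?thesis using that(3) by blast
  qed
  have spaceR: "cfun.subspace (rep_space ?R)" using R.space_subrep by (simp add: subrep_def)
  have inj: "inj_on (theta d a b) (rep_space ?R)"
  proof (rule clinear_inj_on[OF clinear_theta spaceR])
    fix F assume F: "F \<in> rep_space ?R" "theta d a b F = 0"
    then have supp: "F \<in> supported (X \<times> Y)" using R.space_supported by blast
    show "F = 0"
      using supported_cinner_0[OF R.finite_points supp] kernel[OF supp F(2,1)] by blast
  qed
  have image: "theta d a b ` rep_space ?R = hook_cocycles d a b"
  proof (intro subset_antisym subsetI)
    fix g assume g: "g \<in> hook_cocycles d a b"
    have "\<exists>F\<in>supported (X \<times> Y). theta d a b F = g"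
      by (rule theta_surjective[OF g R.finite_points]) (use assms words_image X(2) Y(2) in auto)
    then obtain F where F: "F \<in> supported (X \<times> Y)" "theta d a b F = g" by blast
    obtain u where u: "u \<in> rep_space ?R" "\<And>v. v \<in> rep_space ?R \<Longrightarrow> cinner (X \<times> Y) (F - u) v = 0"
      using projection[OF R.finite_points R.space_supported spaceR, of F] by blast
    have "F - u \<in> supported (X \<times> Y)"
      using F(1) u(1) R.space_supported subspaceD(4)[OF subspace_supported] by blast
    then have "theta d a b (F - u) z = 0" for z
      using th[of "F - u" z] u(2)[of "?e z"] span cfun.span_base[of "?e z" "?e ` words d ?n"]
      by (cases "z \<in> words d ?n") (auto simp: theta_def)
    then have "theta d a b (F - u) = 0" by (simp add: fun_eq_iff)
    then have "theta d a b u = g" using F(2) by (simp add: clinearD[OF clinear_theta])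
    then show "g \<in> theta d a b ` rep_space ?R" using u(1) by blast
  qed (use theta_in_cocycles in blast)
  have "kronecker (hook d a) (hook d b) \<gamma> = cfun.dim (symmetrizer (column_group d (tableau.col \<gamma> T))
      (row_group d (tabloid \<gamma> T)) ?R ` rep_space ?R)"
    using kronecker_eq_dim[OF assms(1) sorted_hook[OF assms(3)] sorted_hook[OF assms(4)]]
      sum_list_hook[OF assms(3)] sum_list_hook[OF assms(4)] assms(2) by simp
  also have "\<dots> = hook_dim (column_group d (tableau.col \<gamma> T)) (tabloid \<gamma> T) d a b"
    unfolding hook_dim_def image[symmetric]
    by (rule dim_symmetrizer_image[symmetric, OF clinear_theta inj R.function_rep_axioms refl theta_act
          column_group_perms row_group_perms])
  finally show ?thesis .
qed

lemma cocycles_commute: "cocycles d n A B = cocycles d n B A"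
  by (auto simp: cocycles_def)

lemma dim_exchange:
  assumes C: "C \<subseteq> perms d" and sets: "A \<inter> B = {}" "A \<union> B \<subseteq> {..<n}" "m \<in> B" "card A < card B"
  shows "cfun.dim (symmetrizer C (row_group d t) (word_rep UNIV) ` cocycles d n A B) \<le>
    cfun.dim (symmetrizer C (row_group d t) (word_rep UNIV) ` cocycles d n (insert m A) (B - {m}))"
proof -
  let ?G = "row_group d t" and ?D = "exchange A m"
  let ?Y = "symmetrizer C ?G (word_rep UNIV)"
  let ?U = "cocycles d n A B" and ?V = "cocycles d n (insert m A) (B - {m})"
  have inj: "inj_on ?D ?U"
    by (rule clinear_inj_on[OF clinear_exchange subspace_cocycles exchange_injective[OF sets(1-3) _ sets(4)]])
  have "cfun.dim (?Y ` ?U) = cfun.dim (?Y ` ?D ` ?U)"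
    unfolding symmetrizer_word_rep[of _ _ UNIV ?U]
    by (rule dim_symmetrizer_image[symmetric, OF clinear_exchange inj function_rep_cocycles _
          exchange_act C row_group_perms]) (simp add: word_rep_def)
  also have "\<dots> \<le> cfun.dim (?Y ` ?V)"
  proof (rule dim_mono_supported[OF finite_words])
    interpret V: function_rep d "word_rep ?V" "words d n" by (rule function_rep_cocycles)
    have "?Y f \<in> ?V" if "f \<in> ?V" for f
      using symmetrizer_in_subrep[OF V.space_subrep C row_group_perms, of f t] that
      unfolding symmetrizer_word_rep[of _ _ UNIV ?V] by (simp add: word_rep_def)
    then show "?Y ` ?V \<subseteq> supported (words d n)"
      using V.space_supported by (auto simp: word_rep_def)
    show "?Y ` ?D ` ?U \<subseteq> ?Y ` ?V"
      using exchange_cocycles[OF sets(1-3)] by (intro image_mono) auto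
  qed
  finally show ?thesis .
qed

text \<open>The moved position is an end of its interval, \<open>Suc a\<close> in the first case and
  a in the second, so that the new blocks are again adjacent intervals. The second case swaps the
  roles of the blocks.\<close>

lemma hook_dim_exchange:
  assumes "C \<subseteq> perms d"
  shows "a < b \<Longrightarrow> hook_dim C t d a b \<le> hook_dim C t d (Suc a) (b - 1)"
    "b < a \<Longrightarrow> hook_dim C t d a b \<le> hook_dim C t d (a - 1) (Suc b)"
proof -
  let ?A = "{0..0 + a}" and ?B = "{Suc a..Suc a + b}" and ?n = "a + b + 2"
  assume "a < b"
  then have "insert (Suc a) ?A = {0..0 + Suc a}" "?B - {Suc a} = {Suc (Suc a)..Suc (Suc a) + (b - 1)}"
    "Suc a + (b - 1) + 2 = ?n" by auto
  moreover have "?A \<inter> ?B = {}" "?A \<union> ?B \<subseteq> {..<?n}" "Suc a \<in> ?B" "card ?A < card ?B"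
    using \<open>a < b\<close> by auto
  ultimately show "hook_dim C t d a b \<le> hook_dim C t d (Suc a) (b - 1)"
    using dim_exchange[OF assms, of ?A ?B ?n "Suc a" t] unfolding hook_dim_def hook_cocycles_def by metis
next
  let ?A = "{0..0 + a}" and ?B = "{Suc a..Suc a + b}" and ?n = "a + b + 2"
  assume "b < a"
  then have "?A - {a} = {0..0 + (a - 1)}" "insert a ?B = {Suc (a - 1)..Suc (a - 1) + Suc b}"
    "a - 1 + Suc b + 2 = ?n" by auto
  moreover have "?B \<inter> ?A = {}" "?B \<union> ?A \<subseteq> {..<?n}" "a \<in> ?A" "card ?B < card ?A"
    using \<open>b < a\<close> by auto
  ultimately show "hook_dim C t d a b \<le> hook_dim C t d (a - 1) (Suc b)"
    using dim_exchange[OF assms, of ?B ?A ?n a t]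
    unfolding hook_dim_def hook_cocycles_def cocycles_commute[of _ _ "{0.._}"] by metis
qed

text \<open>On the path from (i, l) to (j, k) each step starts at a pair whose growing side is
  strictly smaller. The bound \<open>Suc k\<close> instead of k admits a last step from (k, k + 1)
  to (k + 1, k), which occurs when the sum is odd.\<close>

lemma hook_dim_mono:
  assumes "C \<subseteq> perms d" "j + k = i + l" "i \<le> j \<and> j \<le> Suc k \<or> j \<le> i \<and> k \<le> Suc j"
  shows "hook_dim C t d i l \<le> hook_dim C t d j k"
  using assms(3)
proof
  assume "i \<le> j \<and> j \<le> Suc k"
  then show ?thesis using assms(2)
  proof (induction "j - i" arbitrary: i l)
    case (Suc m)
    then have "hook_dim C t d i l \<le> hook_dim C t d (Suc i) (l - 1)"
      by (intro hook_dim_exchange(1)[OF assms(1)]) linarith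
    also have "\<dots> \<le> hook_dim C t d j k" by (rule Suc.hyps(1)) (use Suc in linarith)+
    finally show ?case .
  qed auto
next
  assume "j \<le> i \<and> k \<le> Suc j"
  then show ?thesis using assms(2)
  proof (induction "i - j" arbitrary: i l)
    case (Suc m)
    then have "hook_dim C t d i l \<le> hook_dim C t d (i - 1) (Suc l)"
      by (intro hook_dim_exchange(2)[OF assms(1)]) linarith
    also have "\<dots> \<le> hook_dim C t d j k" by (rule Suc.hyps(1)) (use Suc in linarith)+
    finally show ?case .
  qed auto
qed

section \<open>Stability\<close>

lemma perms_mono: "m \<le> d \<Longrightarrow> perms m \<subseteq> perms d"
  unfolding perms_def using permutes_subset[of _ "{1..m}" "{1..d}"] by auto

lemma (in function_rep) act_rowsum:
  assumes "\<tau> \<in> row_group d t"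
  shows "act R \<tau> (rowsum (row_group d t) R f) = rowsum (row_group d t) R f"
proof -
  let ?G = "row_group d t"
  have \<tau>: "\<tau> \<in> perms d" using assms row_group_perms by blast
  have comp: "\<tau> \<circ> \<sigma> \<in> ?G" "inv \<tau> \<circ> \<sigma> \<in> ?G" if "\<sigma> \<in> ?G" for \<sigma>
    using that assms row_group_inv[OF assms] perms_compose
    by (auto simp: row_group_def comp_assoc[symmetric])
  have "act R \<tau> (rowsum ?G R f) = (\<Sum>\<sigma>\<in>?G. act R (\<tau> \<circ> \<sigma>) f)"
    unfolding rowsum_def gsum_def clinearD(5)[OF clinear_act]
    using \<tau> row_group_perms[of d t] by (intro sum.cong) (auto intro!: perms_actD)
  also have "\<dots> = (\<Sum>\<sigma>\<in>?G. act R \<sigma> f)"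
    by (rule sum.reindex_bij_betw[OF bij_betw_perms_compose[OF \<tau> row_group_perms]]) (use comp in auto)
  finally show ?thesis by (simp add: rowsum_def gsum_def)
qed

definition restrict_words :: "nat \<Rightarrow> nat \<Rightarrow> ((nat \<Rightarrow> nat) \<Rightarrow> complex) \<Rightarrow> (nat \<Rightarrow> nat) \<Rightarrow> complex" where
  "restrict_words d n f z = (if z \<in> words d n then f z else 0)"

lemma clinear_restrict_words: "clinear (restrict_words d n)"
  by (rule clinearI) (auto simp: restrict_words_def cscale_def)

lemma restrict_words_act:
  assumes "\<sigma> \<in> perms d"
  shows "restrict_words d n (act (word_rep U) \<sigma> f) = act (word_rep V) \<sigma> (restrict_words d n f)"
  using words_act[OF perms_inv[OF assms]] by (simp add: fun_eq_iff restrict_words_def act_word)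

lemma restrict_words_cocycles:
  assumes "f \<in> cocycles (Suc d) n A B" "A \<subseteq> {..<n}" "B \<subseteq> {..<n}"
  shows "restrict_words d n f \<in> cocycles d n A B"
proof -
  have mono: "z \<in> words (Suc d) n" if "z \<in> words d n" for z
    using that by (fastforce simp: words_def)
  have "alternating A' (restrict_words d n f)" if "alternating A' f" "A' \<subseteq> {..<n}" for A'
    using that(1) words_permute[OF _ that(2)] by (simp add: alternating_def restrict_words_def)
  moreover have "cocycle d n A' (restrict_words d n f)" if "cocycle (Suc d) n A' f" "A' \<subseteq> {..<n}" for A'
    unfolding cocycle_def
  proof (intro ballI)
    fix z x assume z: "z \<in> words d n" "x \<in> {1..d}"
    then have "f z = (\<Sum>s\<in>A'. f (z(s := x)))"
      using that(1) mono by (simp add: cocycle_def)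
    also have "\<dots> = (\<Sum>s\<in>A'. restrict_words d n f (z(s := x)))"
      by (intro sum.cong refl) (use words_update[OF z(1) _ z(2)] that(2) in \<open>auto simp: restrict_words_def\<close>)
    finally show "restrict_words d n f z = (\<Sum>s\<in>A'. restrict_words d n f (z(s := x)))"
      using z(1) by (simp add: restrict_words_def)
  qed
  ultimately show ?thesis using assms by (auto simp: cocycles_def supported_def restrict_words_def)
qed

text \<open>A word over \<open>{1..d+1}\<close> can be moved into \<open>{1..d}\<close> by a transposition in the row group that
  commutes with \<open>C\<close>, so restricting words is injective on the image of the symmetrizer.\<close>

lemma hook_dim_decreasing:
  assumes C: "C \<subseteq> perms N" and t: "\<And>i. i \<notin> {1..N} \<Longrightarrow> t i = 0" and d: "N + (a + b + 2) \<le> d"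
  shows "hook_dim C t (Suc d) a b \<le> hook_dim C t d a b"
proof -
  let ?n = "a + b + 2"
  let ?Z = "\<lambda>d. hook_cocycles d a b"
  let ?W = "word_rep UNIV" and ?G = "\<lambda>d. row_group d t" and ?res = "restrict_words d ?n"
  have "N \<le> d" "N \<le> Suc d" using d by simp_all
  then have Cd: "C \<subseteq> perms d" "C \<subseteq> perms (Suc d)" using C perms_mono by blast+
  interpret Z: function_rep d "word_rep (?Z d)" "words d ?n"
    unfolding hook_cocycles_def by (rule function_rep_cocycles)
  interpret Z': function_rep "Suc d" "word_rep (?Z (Suc d))" "words (Suc d) ?n"
    unfolding hook_cocycles_def by (rule function_rep_cocycles)
  let ?Y = "symmetrizer C (?G d) ?W" and ?Y' = "symmetrizer C (?G (Suc d)) ?W"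
  have W: "act (word_rep U) = act ?W" for U by (simp add: fun_eq_iff act_word)
  have gsumW: "gsum H c (word_rep U) = gsum H c ?W" for H c U
    unfolding gsum_def fun_eq_iff W[of U] by simp
  have space: "rep_space (word_rep U) = U" for U by (simp add: word_rep_def)
  have cocZ: "cfun.subspace (?Z (Suc d))"
    unfolding hook_cocycles_def by (rule subspace_cocycles)
  have rows: "rowsum (?G (Suc d)) ?W f \<in> ?Z (Suc d)" if "f \<in> ?Z (Suc d)" for f
    using gsum_in_subrep[OF Z'.space_subrep row_group_perms] that
    unfolding rowsum_def space gsumW[of _ _ "?Z (Suc d)"] by blast
  have inj0: "v = 0" if v: "v \<in> ?Y' ` ?Z (Suc d)" "?res v = 0" for v
  proof
    fix z
    obtain f where f: "f \<in> ?Z (Suc d)" "v = ?Y' f" using v(1) by blast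
    define F where "F = rowsum (?G (Suc d)) ?W f"
    have v_eq: "v z = (\<Sum>\<sigma>\<in>C. of_int (sign \<sigma>) * F (inv \<sigma> \<circ> z))" for z
      by (simp add: f(2) symmetrizer_def colsum_def gsum_apply F_def) (simp add: word_rep_def)
    have small: "v y = 0" if "y \<in> words d ?n" for y
      using fun_cong[OF v(2), of y] that by (simp add: restrict_words_def)
    show "v z = 0 z"
    proof (cases "z \<in> words (Suc d) ?n")
      case False
      have "v \<in> supported (words (Suc d) ?n)"
        using symmetrizer_in_subrep[OF Z'.space_subrep Cd(2) row_group_perms, of f t] f
          hook_cocycles_supported[of "Suc d" a b] symmetrizer_word_rep[of _ _ "?Z (Suc d)" UNIV]
        unfolding space by auto
      then show ?thesis using False by (simp add: supported_def)
    next
      case True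
      have "card (z ` {..<?n}) \<le> ?n" using card_image_le[of "{..<?n}" z] by simp
      show ?thesis
      proof (cases "Suc d \<in> z ` {..<?n}")
        case False
        have "z \<in> words d ?n"
          unfolding words_def mem_Collect_eq
        proof (intro conjI allI impI)
          fix p assume p: "p < ?n"
          then have "z p \<in> {1..Suc d}" using True by (simp add: words_def)
          moreover have "z p \<noteq> Suc d" using p False by (metis imageI lessThan_iff)
          ultimately have "z p \<in> {1..Suc d}" "z p \<noteq> Suc d" by simp_all
          then show "z p \<in> {1..d}" by auto
        qed (use True in \<open>auto simp: words_def\<close>)
        then show ?thesis using small by simp
      next
        case in_z: True
        \<comment> \<open>Pigeonhole: {N<..d} has at least a + b + 2 elements, and one of the a + b
          + 2 positions of z is taken by d + 1, so some value e is missing.\<close>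
        have "\<not> {N<..d} \<subseteq> z ` {..<?n}"
        proof
          assume "{N<..d} \<subseteq> z ` {..<?n}"
          then have "insert (Suc d) {N<..d} \<subseteq> z ` {..<?n}" using in_z by blast
          from card_mono[OF finite_imageI[OF finite_lessThan] this]
          have "card (insert (Suc d) {N<..d}) \<le> ?n"
            using \<open>card (z ` {..<?n}) \<le> ?n\<close> by (rule order_trans)
          then show False using d by simp
        qed
        then obtain e where "e \<in> {N<..d}" "e \<notin> z ` {..<?n}" by blast
        then have e: "N < e" "e \<le> d" "e \<notin> z ` {..<?n}" by simp_all
        let ?\<tau> = "transpose e (Suc d)"
        have inv: "inv ?\<tau> = ?\<tau>" by simp
        \<comment> \<open>Both e and d + 1 lie outside {1..N}, hence in row 0.\<close>
        have \<tau>: "?\<tau> \<in> ?G (Suc d)"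
          using e d t[of e] t[of "Suc d"]
          by (auto simp: row_group_def perms_def fun_eq_iff transpose_def intro!: permutes_swap_id)
        have "act ?W ?\<tau> F = F"
          using Z'.act_rowsum[OF \<tau>, of f]
          unfolding F_def rowsum_def W[of "?Z (Suc d)"] gsumW[of _ _ "?Z (Suc d)"] .
        then have F: "F (?\<tau> \<circ> y) = F y" for y
          using act_word[of UNIV ?\<tau> F y] inv by simp
        have "v (?\<tau> \<circ> z) = v z"
          unfolding v_eq
        proof (intro sum.cong refl)
          fix \<sigma> assume "\<sigma> \<in> C"
          then have "inv \<sigma> permutes {1..N}" using C perms_inv by (auto simp: perms_def)
          then have "inv \<sigma> \<circ> ?\<tau> = ?\<tau> \<circ> inv \<sigma>"
            using e d by (intro permutes_disjoint_commute[of _ "{1..N}" _ "{e, Suc d}"])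
              (auto intro!: permutes_swap_id)
          then have "inv \<sigma> \<circ> (?\<tau> \<circ> z) = ?\<tau> \<circ> (inv \<sigma> \<circ> z)" by (simp add: o_assoc)
          then show "of_int (sign \<sigma>) * F (inv \<sigma> \<circ> (?\<tau> \<circ> z)) = of_int (sign \<sigma>) * F (inv \<sigma> \<circ> z)"
            by (simp add: F)
        qed
        moreover have "?\<tau> \<circ> z \<in> words d ?n"
          unfolding words_def mem_Collect_eq
        proof (intro conjI allI impI)
          fix p assume p: "p < ?n"
          then have "z p \<in> {1..Suc d}" using True by (simp add: words_def)
          moreover have "z p \<noteq> e" using p e(3) by (metis imageI lessThan_iff)
          ultimately have "z p \<in> {1..Suc d}" "z p \<noteq> e" by simp_all
          then show "(?\<tau> \<circ> z) p \<in> {1..d}" using e by (auto simp: transpose_def)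
        next
          fix p assume "?n \<le> p"
          then have "z p = 0" using True by (simp add: words_def)
          then show "(?\<tau> \<circ> z) p = 0" using e by (simp add: transpose_def)
        qed
        ultimately show ?thesis using small by simp
      qed
    qed
  qed
  have sub': "cfun.subspace (?Y' ` ?Z (Suc d))"
    by (rule clinear_subspace_image[OF clinear_symmetrizer cocZ])
  have inj: "inj_on ?res (?Y' ` ?Z (Suc d))"
    by (rule clinear_inj_on[OF clinear_restrict_words sub' inj0])
  have supp': "?Y' ` ?Z (Suc d) \<subseteq> supported (words (Suc d) ?n)"
    using symmetrizer_in_subrep[OF Z'.space_subrep Cd(2) row_group_perms]
      hook_cocycles_supported[of "Suc d" a b] symmetrizer_word_rep[of _ _ UNIV "?Z (Suc d)"]
    unfolding space by auto
  have supp: "?Y ` ?Z d \<subseteq> supported (words d ?n)"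
    using symmetrizer_in_subrep[OF Z.space_subrep Cd(1) row_group_perms]
      hook_cocycles_supported[of d a b] symmetrizer_word_rep[of _ _ UNIV "?Z d"]
    unfolding space by auto
  \<comment> \<open>The restricted row sum is invariant under the smaller row group, so after
    division by the order of that group it is a preimage of itself under the row sum in degree
    d.\<close>
  have image: "?res ` ?Y' ` ?Z (Suc d) \<subseteq> ?Y ` ?Z d"
  proof safe
    fix f assume f: "f \<in> ?Z (Suc d)"
    define F where "F = rowsum (?G (Suc d)) ?W f"
    have FZ: "F \<in> ?Z (Suc d)" using rows[OF f] by (simp add: F_def)
    have resF: "?res F \<in> ?Z d"
      using FZ unfolding hook_cocycles_def by (rule restrict_words_cocycles) auto
    have "act ?W \<tau> (?res F) = ?res F" if \<tau>: "\<tau> \<in> ?G d" for \<tau>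
    proof -
      have "\<tau> \<in> ?G (Suc d)" using \<tau> perms_mono[of d "Suc d"] by (auto simp: row_group_def)
      from Z'.act_rowsum[OF this, of f] have "act ?W \<tau> F = F"
        unfolding F_def rowsum_def W[of "?Z (Suc d)"] gsumW[of _ _ "?Z (Suc d)"] .
      moreover have "\<tau> \<in> perms d" using \<tau> row_group_perms by blast
      ultimately show ?thesis using restrict_words_act[of \<tau> d ?n UNIV F UNIV] by simp
    qed
    then have row: "rowsum (?G d) ?W (?res F) = cscale (of_nat (card (?G d))) (?res F)"
      by (simp add: rowsum_def gsum_def fun_eq_iff sum_fun_apply cscale_def)
    have card: "card (?G d) \<noteq> 0"
      using finite_subset[OF row_group_perms finite_perms, of d t] id_perms
      by (auto simp: row_group_def intro!: exI[of _ id])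
    let ?h = "cscale (1 / of_nat (card (?G d))) (?res F)"
    have "?res (?Y' f) = colsum C ?W (?res F)"
      unfolding symmetrizer_def F_def[symmetric] colsum_def gsum_def
        clinearD(5)[OF clinear_restrict_words] clinearD(2)[OF clinear_restrict_words]
      by (intro sum.cong refl) (use Cd restrict_words_act in fastforce)
    also have "?res F = rowsum (?G d) ?W ?h"
    proof -
      have "rowsum (?G d) ?W ?h = cscale (1 / of_nat (card (?G d))) (rowsum (?G d) ?W (?res F))"
        unfolding rowsum_def by (rule clinearD(2)[OF clinear_gsum])
      then show ?thesis using card unfolding row by simp
    qed
    finally have "?res (?Y' f) = ?Y ?h" by (simp add: symmetrizer_def)
    moreover have "?h \<in> ?Z d"
      using resF subspaceD(3)[OF subspace_cocycles] unfolding hook_cocycles_def by blast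
    ultimately show "?res (?Y' f) \<in> ?Y ` ?Z d" by blast
  qed
  have "hook_dim C t (Suc d) a b = cfun.dim (?res ` ?Y' ` ?Z (Suc d))"
    unfolding hook_dim_def
    by (rule dim_clinear_image[symmetric, OF clinear_restrict_words inj sub' finite_words supp'])
  also have "\<dots> \<le> hook_dim C t d a b"
    unfolding hook_dim_def by (rule dim_mono_supported[OF finite_words supp image])
  finally show ?thesis .
qed

lemma decreasing_eventually_const:
  fixes f :: "nat \<Rightarrow> nat"
  assumes "\<And>d. N \<le> d \<Longrightarrow> f (Suc d) \<le> f d"
  shows "\<exists>m. eventually (\<lambda>d. f d = m) sequentially"
proof -
  define m where "m = (LEAST m. \<exists>d\<ge>N. f d = m)"
  obtain e where e: "N \<le> e" "f e = m"
    using LeastI_ex[of "\<lambda>m. \<exists>d\<ge>N. f d = m"] by (auto simp: m_def)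
  have "f d = m" if "e \<le> d" for d
  proof -
    have "f d \<le> m" using that
    proof (induction rule: dec_induct)
      case (step k)
      then show ?case using assms[of k] e(1) by linarith
    qed (use e in simp)
    moreover have "m \<le> f d"
      unfolding m_def by (rule Least_le) (use that e in \<open>auto intro!: exI[of _ d]\<close>)
    ultimately show ?thesis by simp
  qed
  then show ?thesis by (auto simp: eventually_sequentially)
qed

section \<open>Tableaux of padded shapes\<close>

lemma sum_list_padded: "sum_list \<nu> \<le> d \<Longrightarrow> sum_list (padded \<nu> d) = d"
  by (simp add: padded_def)

lemma diagram_padded:
  "young_diagram (padded \<nu> d) =
    {(r, c). r = 0 \<and> c < d - sum_list \<nu> \<or> (\<exists>s<length \<nu>. r = Suc s \<and> c < \<nu> ! s)}"
proof -
  have "(r, c) \<in> young_diagram (padded \<nu> d) \<longleftrightarrow>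
      r = 0 \<and> c < d - sum_list \<nu> \<or> (\<exists>s<length \<nu>. r = Suc s \<and> c < \<nu> ! s)" for r c
    by (cases r) (auto simp: young_diagram_def padded_def)
  then show ?thesis by auto
qed

text \<open>Take a tableau of the smallest padded shape and prolong its first row by N + 1, ..., d.
  The new columns are single cells, so the column group stays the same; the new entries lie in row
  0, which is the value of t outside {1..N}.\<close>

lemma ex_stable_tableaux:
  assumes "is_partition \<nu>"
  obtains N C t where "C \<subseteq> perms N" "\<And>i. i \<notin> {1..N} \<Longrightarrow> t i = 0"
    "\<And>d. N \<le> d \<Longrightarrow> sum_list (padded \<nu> d) = d"
    "\<And>d. N \<le> d \<Longrightarrow> \<exists>T. tableau (padded \<nu> d) T \<and>
      column_group d (tableau.col (padded \<nu> d) T) = C \<and> tabloid (padded \<nu> d) T = t"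
proof -
  \<comment> \<open>The largest part of \<nu>. In degree N = |\<nu>| + w the first row has length w,
    so every column has a number less than w.\<close>
  define w where "w = (if \<nu> = [] then 0 else hd \<nu>)"
  define s where "s = sum_list \<nu>"
  define N where "N = s + w"
  have sortedw: "sorted_wrt (\<ge>) \<nu>" using assms by (simp add: is_partition_def)
  have le_w: "\<nu> ! r \<le> w" if "r < length \<nu>" for r
    using sortedw that unfolding w_def by (cases \<nu>) (auto simp: nth_Cons' dest: nth_mem)
  have sum: "sum_list (padded \<nu> d) = d" if "N \<le> d" for d
    using that by (intro sum_list_padded) (simp add: N_def s_def)
  have sorted: "sorted_wrt (\<ge>) (padded \<nu> d)" if "N \<le> d" for d
  proof -
    have "x \<le> d - s" if "x \<in> set \<nu>" for x
      using that le_w \<open>N \<le> d\<close> by (fastforce simp: in_set_conv_nth N_def)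
    then show ?thesis using sortedw by (simp add: padded_def s_def)
  qed
  let ?D = "\<lambda>d. young_diagram (padded \<nu> d)"
  obtain T0 where "T0 \<in> tableaux (padded \<nu> N)" using ex_tableau by blast
  then have T0: "bij_betw T0 (?D N) {1..N}" by (simp add: tableaux_def sum)
  \<comment> \<open>The first new cell is in column w and receives w + s + 1 = N + 1.\<close>
  define T where "T x = (if fst x = 0 \<and> w \<le> snd x then snd x + s + 1 else T0 x)" for x
  define E where "E d = {x. fst x = (0::nat) \<and> w \<le> snd x \<and> snd x < d - s}" for d
  have D_split: "?D d = ?D N \<union> E d" "?D N \<inter> E d = {}" if "N \<le> d" for d
    using that unfolding diagram_padded E_def N_def s_def[symmetric] by auto
  have bij_N: "bij_betw T (?D N) {1..N}"
    using T0 by (rule bij_betw_cong[THEN iffD1, rotated])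
      (auto simp: T_def diagram_padded N_def s_def)
  have bij_E: "bij_betw T (E d) {N<..d}" if "N \<le> d" for d
  proof (rule bij_betwI[of _ _ _ "\<lambda>i. (0, i - s - 1)"])
    show "T \<in> E d \<rightarrow> {N<..d}" by (auto simp: E_def T_def N_def)
    show "(\<lambda>i. (0, i - s - 1)) \<in> {N<..d} \<rightarrow> E d" using that by (auto simp: E_def N_def)
    show "(0, T x - s - 1) = x" if "x \<in> E d" for x
      using that by (cases x) (auto simp: E_def T_def)
    show "T (0, i - s - 1) = i" if "i \<in> {N<..d}" for i
      using that by (auto simp: T_def N_def)
  qed
  have tab: "tableau (padded \<nu> d) T" if "N \<le> d" for d
  proof -
    have "bij_betw T (?D N \<union> E d) ({1..N} \<union> {N<..d})"
      by (rule bij_betw_combine[OF bij_N bij_E[OF that]]) auto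
    moreover have "{1..N} \<union> {N<..d} = {1..d}" using that by auto
    ultimately show ?thesis
      using D_split[OF that] sorted[OF that] sum[OF that] by (simp add: tableau_def tableaux_def)
  qed
  interpret N: tableau "padded \<nu> N" T by (rule tab) simp
  define t where "t = tabloid (padded \<nu> N) T"
  define C where "C = column_group N N.col"
  have t_out: "t i = 0" if "i \<notin> {1..N}" for i
    using N.row_outside[of i] that sum[OF order_refl] by (simp add: t_def)
  have "column_group d (tableau.col (padded \<nu> d) T) = C \<and> tabloid (padded \<nu> d) T = t" if Nd: "N \<le> d" for d
  proof -
    interpret d: tableau "padded \<nu> d" T by (rule tab[OF Nd])
    have low: "tabloid (padded \<nu> d) T i = t i \<and> d.col i = N.col i \<and> N.col i < w" if i: "i \<in> {1..N}" for i
    proof -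
      have "i \<in> {1..sum_list (padded \<nu> N)}" using i sum[OF order_refl] by simp
      then obtain r c where x: "(r, c) \<in> ?D N" "T (r, c) = i" using N.pos_in[of i] by (metis surj_pair)
      then have "(r, c) \<in> ?D d" using D_split[OF Nd] by blast
      moreover have "c < w" using x(1) le_w unfolding diagram_padded N_def s_def[symmetric] by fastforce
      ultimately show ?thesis using d.t_col_T[of r c] N.t_col_T[OF x(1)] x(2) by (simp add: t_def)
    qed
    have high: "tabloid (padded \<nu> d) T i = 0 \<and> w \<le> d.col i" if i: "i \<in> {N<..d}" for i
    proof -
      have "i \<in> T ` E d" using bij_E[OF Nd] i by (simp add: bij_betw_def)
      then obtain c where x: "(0, c) \<in> E d" "T (0, c) = i" by (auto simp: E_def)
      then have "(0, c) \<in> ?D d" using D_split[OF Nd] by blast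
      then show ?thesis using d.t_col_T[of 0 c] x by (simp add: E_def)
    qed
    have "tabloid (padded \<nu> d) T = t"
    proof
      fix i
      consider "i \<in> {1..N}" | "i \<in> {N<..d}" | "i \<notin> {1..d}" using Nd by fastforce
      then show "tabloid (padded \<nu> d) T i = t i"
      proof cases
        case 2
        then show ?thesis using high t_out[of i] by simp
      next
        case 3
        then show ?thesis using d.row_outside[of i] t_out[of i] sum[OF Nd] Nd by auto
      qed (use low in blast)
    qed
    moreover have "column_group d d.col = C"
    proof (intro subset_antisym subsetI)
      fix \<sigma> assume \<sigma>: "\<sigma> \<in> column_group d d.col"
      then have perm: "\<sigma> permutes {1..d}" and col: "\<And>i. i \<in> {1..d} \<Longrightarrow> d.col (\<sigma> i) = d.col i"
        by (auto simp: column_group_def perms_def)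
      \<comment> \<open>The image of i stays in a column numbered at least w, hence outside {1..N}
        and in row 0; sharing row and column with i, it is i.\<close>
      have fixed: "\<sigma> i = i" if i: "i \<in> {N<..d}" for i
      proof -
        have i': "i \<in> {1..d}" using i by auto
        have \<sigma>i: "\<sigma> i \<in> {1..d}" using permutes_in_image[OF perm] i' by blast
        have "w \<le> d.col (\<sigma> i)" using col[OF i'] high[OF i] by simp
        then have "\<sigma> i \<notin> {1..N}" using low[of "\<sigma> i"] by auto
        then have "\<sigma> i \<in> {N<..d}" using \<sigma>i by auto
        then show ?thesis
          using d.row_col_inj[of "\<sigma> i" i] high[of "\<sigma> i"] high[OF i] col[OF i'] \<sigma>i i' sum[OF Nd] by simp
      qed
      have permN: "\<sigma> permutes {1..N}"
        by (rule permutes_superset[OF perm]) (use fixed in auto)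
      have "N.col (\<sigma> i) = N.col i" if "i \<in> {1..N}" for i
        using that low[OF that] low[of "\<sigma> i"] permutes_in_image[OF permN, of i] col[of i] Nd by auto
      then show "\<sigma> \<in> C" using permN by (simp add: C_def column_group_def perms_def)
    next
      fix \<sigma> assume "\<sigma> \<in> C"
      then have perm: "\<sigma> permutes {1..N}" and col: "\<And>i. i \<in> {1..N} \<Longrightarrow> N.col (\<sigma> i) = N.col i"
        by (auto simp: C_def column_group_def perms_def)
      have "d.col (\<sigma> i) = d.col i" for i
      proof (cases "i \<in> {1..N}")
        case True
        then show ?thesis
          using low[OF True] low[of "\<sigma> i"] permutes_in_image[OF perm, of i] col[OF True] by auto
      qed (use permutes_not_in[OF perm] in auto)
      moreover have "\<sigma> permutes {1..d}" by (rule permutes_subset[OF perm]) (use Nd in auto)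
      ultimately show "\<sigma> \<in> column_group d d.col" by (simp add: column_group_def perms_def)
    qed
    ultimately show ?thesis by simp
  qed
  then show thesis
    using that[of C N t] t_out sum tab column_group_perms unfolding C_def by blast
qed

section \<open>Reduced Kronecker coefficients of columns\<close>

lemma reduced_kronecker_eqI:
  assumes "eventually (\<lambda>d. kronecker (padded \<kappa> d) (padded \<mu> d) (padded \<nu> d) = m) sequentially"
  shows "reduced_kronecker \<kappa> \<mu> \<nu> = m"
  unfolding reduced_kronecker_def
proof (rule the_equality)
  fix m' assume "\<forall>\<^sub>F d in sequentially. kronecker (padded \<kappa> d) (padded \<mu> d) (padded \<nu> d) = m'"
  from eventually_conj[OF this assms] show "m' = m"
    by (auto simp: eventually_sequentially)
qed (fact assms)

text \<open>The bound on d gives a < d and b < d, so both hooks have degree d, and it agrees with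
  the range in which the dimensions decrease.\<close>

lemma kronecker_hooks_padded:
  assumes "is_partition \<nu>"
  obtains N C t where "C \<subseteq> perms N" "\<And>i. i \<notin> {1..N} \<Longrightarrow> t i = 0"
    "\<And>a b d. N + (a + b + 2) \<le> d \<Longrightarrow>
      kronecker (hook d a) (hook d b) (padded \<nu> d) = hook_dim C t d a b"
proof -
  obtain N C t where st: "C \<subseteq> perms N" "\<And>i. i \<notin> {1..N} \<Longrightarrow> t i = 0"
    "\<And>d. N \<le> d \<Longrightarrow> sum_list (padded \<nu> d) = d"
    "\<And>d. N \<le> d \<Longrightarrow> \<exists>T. tableau (padded \<nu> d) T \<and>
      column_group d (tableau.col (padded \<nu> d) T) = C \<and> tabloid (padded \<nu> d) T = t"
    using ex_stable_tableaux[OF assms] by metis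
  have "kronecker (hook d a) (hook d b) (padded \<nu> d) = hook_dim C t d a b"
    if d: "N + (a + b + 2) \<le> d" for a b d
  proof -
    obtain T where T: "tableau (padded \<nu> d) T" "column_group d (tableau.col (padded \<nu> d) T) = C"
      "tabloid (padded \<nu> d) T = t" using st(4)[of d] d by auto
    then show ?thesis using kronecker_hooks[OF T(1), of d a b] st(3)[of d] d by simp
  qed
  then show thesis using that[of C N t] st(1,2) by blast
qed

text \<open>A sequence of naturals that eventually decreases is eventually constant, so the stable
  value exists. N, C and t do not depend on a and b, which makes the coefficients for different
  pairs of columns comparable as dimensions under one symmetrizer.\<close>

lemma reduced_kronecker_columns:
  assumes "is_partition \<nu>"
  obtains N C t where "C \<subseteq> perms N"
    "\<And>a b. \<forall>\<^sub>F d in sequentially. reduced_kronecker (column a) (column b) \<nu> = hook_dim C t d a b"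
proof -
  obtain N C t where st: "C \<subseteq> perms N" "\<And>i. i \<notin> {1..N} \<Longrightarrow> t i = 0"
    "\<And>a b d. N + (a + b + 2) \<le> d \<Longrightarrow>
      kronecker (hook d a) (hook d b) (padded \<nu> d) = hook_dim C t d a b"
    using kronecker_hooks_padded[OF assms] by metis
  have "\<forall>\<^sub>F d in sequentially. reduced_kronecker (column a) (column b) \<nu> = hook_dim C t d a b" for a b
  proof -
    have ge: "\<forall>\<^sub>F d in sequentially. N + (a + b + 2) \<le> d" by (rule eventually_ge_at_top)
    obtain m where m: "\<forall>\<^sub>F d in sequentially. hook_dim C t d a b = m"
      using decreasing_eventually_const[of "N + (a + b + 2)" "\<lambda>d. hook_dim C t d a b"]
        hook_dim_decreasing[of C N t a b] st(1,2) by blast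
    have "\<forall>\<^sub>F d in sequentially. kronecker (hook d a) (hook d b) (padded \<nu> d) = m"
      using m ge by eventually_elim (simp add: st(3))
    then have "reduced_kronecker (column a) (column b) \<nu> = m"
      unfolding hook_def by (rule reduced_kronecker_eqI)
    from m show ?thesis unfolding \<open>reduced_kronecker (column a) (column b) \<nu> = m\<close>
      by (rule eventually_mono) simp
  qed
  then show thesis using that[OF st(1)] by blast
qed

lemma reduced_kronecker_columns_mono:
  assumes \<nu>: "is_partition \<nu>" and "j + k = i + l" "i \<le> j \<and> j \<le> Suc k \<or> j \<le> i \<and> k \<le> Suc j"
  shows "reduced_kronecker (column i) (column l) \<nu> \<le> reduced_kronecker (column j) (column k) \<nu>"
proof -
  obtain N C t where st: "C \<subseteq> perms N"
    "\<And>a b. \<forall>\<^sub>F d in sequentially. reduced_kronecker (column a) (column b) \<nu> = hook_dim C t d a b"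
    using reduced_kronecker_columns[OF \<nu>] by metis
  \<comment> \<open>Neither side depends on d: at one large d both coefficients are dimensions of
    the same degree, where \<open>hook_dim_mono\<close> compares them.\<close>
  have "\<forall>\<^sub>F d in sequentially. reduced_kronecker (column i) (column l) \<nu> \<le>
      reduced_kronecker (column j) (column k) \<nu>"
    using st(2)[of i l] st(2)[of j k] eventually_ge_at_top[of N]
  proof eventually_elim
    case (elim d)
    have "C \<subseteq> perms d" using st(1) perms_mono[OF elim(3)] by blast
    then show ?case using hook_dim_mono[of C d j k i l t] assms(2,3) elim(1,2) by simp
  qed
  then show ?thesis by simp
qed

theorem theorem5p6:
  shows "(\<forall>(a::nat) (b::nat) \<nu>. is_partition \<nu> \<longrightarrow>
            reduced_kronecker (column (nat \<lceil>real (a + b) / 2\<rceil>)) (column (nat \<lfloor>real (a + b) / 2\<rfloor>)) \<nu>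
              \<ge> reduced_kronecker (column a) (column b) \<nu>) \<and>
         (\<forall>(i::nat) (j::nat) (k::nat) (l::nat) \<nu>.
            i < j \<and> j \<le> k \<and> k < l \<and> j + k = i + l \<longrightarrow> is_partition \<nu> \<longrightarrow>
            reduced_kronecker (column j) (column k) \<nu>
              \<ge> reduced_kronecker (column i) (column l) \<nu>)"
proof (intro conjI allI impI)
  fix a b :: nat and \<nu> assume \<nu>: "is_partition \<nu>"
  let ?p = "nat \<lceil>real (a + b) / 2\<rceil>" and ?q = "nat \<lfloor>real (a + b) / 2\<rfloor>"
  have q: "?q = (a + b) div 2"
    using floor_divide_of_nat_eq[of "a + b" 2, where 'a = real] by simp
  have "a + b \<le> 2 * ((a + b + 1) div 2)" "2 * ((a + b + 1) div 2) \<le> a + b + 1" by linarith+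
  then have "real (a + b) \<le> real (2 * ((a + b + 1) div 2))" "real (2 * ((a + b + 1) div 2)) \<le> real (a + b + 1)"
    by (simp_all only: of_nat_le_iff)
  then have "\<lceil>real (a + b) / 2\<rceil> = int ((a + b + 1) div 2)"
    by (intro ceiling_unique) simp_all
  then have p: "?p = (a + b + 1) div 2" by linarith
  show "reduced_kronecker (column a) (column b) \<nu> \<le> reduced_kronecker (column ?p) (column ?q) \<nu>"
    \<comment> \<open>Here p is q or q + 1. The first alternative covers a at most p, the second the
      remaining a.\<close>
    by (rule reduced_kronecker_columns_mono[OF \<nu>]) (unfold p q, linarith+)
next
  fix i j k l :: nat and \<nu> assume "i < j \<and> j \<le> k \<and> k < l \<and> j + k = i + l" "is_partition \<nu>"
  then show "reduced_kronecker (column i) (column l) \<nu> \<le> reduced_kronecker (column j) (column k) \<nu>"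
    using reduced_kronecker_columns_mono by simp
qed

end
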